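(* Let $\mathbf{k}$ be a commutative ring, $\lambda\in\mathbf{k}$ and $X$ a non-empty set. (a) The bijection $\phi_{\mathcal{R},\mathcal{V}}:\mathcal{R}(X)\to\mathcal{V}(X)$ extends (by $\mathbf{k}$-linearity) to an isomorphism $\phi_{\mathcal{R},\mathcal{V}}:(\mathbf{k}\mathcal{R}(X),\diamond_w,\lfloor\ \rfloor)\to(\mathbf{k}\mathcal{V}(X),\diamond_v,/\ \backslash)$ of Rota–Baxter algebras of weight $\lambda$. This isomorphism restricts to an isomorphism $\phi_{\mathcal{S}\mathcal{R},\mathcal{L}\mathcal{V}}:(\mathbf{k}(\mathcal{S}(X)\cap\mathcal{R}(X)),\diamond_w,\lfloor\ \rfloor)\to(\mathbf{k}(\mathcal{L}(X)\cap\mathcal{V}(X)),\diamond_v,/\ \backslash)$ of nonunitary Rota–Baxter algebras. (b) The quadruple $(\mathbf{k}\mathcal{R}(X),\diamond_w,\lfloor\ \rfloor,j_X)$ (resp. $(\mathbf{k}(\mathcal{S}(X)\cap\mathcal{R}(X)),\diamond_w,\lfloor\ \rfloor,j_X)$) is the free Rota–Baxter algebra (resp. free nonunitary Rota–Baxter algebra) of weight $\lambda$ on $X$.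
   Context: **Rota–Baxter algebras.** A (nonunitary) Rota–Baxter algebra of weight $\lambda$ is an associative unitary (resp. not necessarily unitary) $\mathbf{k}$-algebra $A$ with a $\mathbf{k}$-linear operator $P$ satisfying $P(x)P(y)=P(xP(y))+P(P(x)y)+\lambda P(xy)$ for all $x,y\in A$. Morphisms are algebra homomorphisms (unitary, resp. nonunitary) commuting with the operators. The free (nonunitary) Rota–Baxter algebra of weight $\lambda$ on $X$ is one, $U_X$, with a map of sets $j_X:X\to U_X$ such that for every (nonunitary) Rota–Baxter algebra $R$ of weight $\lambda$ and map of sets $f:X\to R$ there is a unique morphism $\bar f:U_X\to R$ with $f=\bar f\circ j_X$. For a set $Y$, $\mathbf{k}Y$ is the free $\mathbf{k}$-module with basis $Y$. **Bracketed words.** For a set $Y$, let $S(Y)$, $M(Y)$ be the free semigroup and the free monoid (with identity $\mathbf{1}$) on $Y$, and let $\lfloor Y\rfloor=\{\lfloor y\rfloor\mid y\in Y\}$ be formal symbols in bijection with $Y$, disjoint from $Y$. Put $\mathcal{S}_0=S(X)$, $\mathcal{M}_0=M(X)$, and for $n\ge1$ $\mathcal{S}_n=S(X\cup\lfloor\mathcal{S}_{n-1}\rfloor)$, $\mathcal{M}_n=M(X\cup\lfloor\mathcal{M}_{n-1}\rfloor)$, with natural inclusions; $\mathcal{S}(X)=\bigcup_n\mathcal{S}_n\subseteq\mathcal{M}(X)=\bigcup_n\mathcal{M}_n$, with concatenation product and operator $W\mapsto\lfloor W\rfloor$. $\mathcal{R}(X)\subseteq\mathcal{M}(X)$ is the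 set of words not containing $\rfloor\lfloor$, i.e. at no nesting level do two bracketed factors $\lfloor W_1\rfloor\lfloor W_2\rfloor$ occur adjacently. A word $W$ is indecomposable if $W=\mathbf{1}$, $W=x\in X$, or $W=\lfloor\overline W\rfloor$ for a bracketed word $\overline W$. $\diamond_w$ is the bilinear product on $\mathbf{k}\mathcal{R}(X)$ defined recursively and characterized by: (1) $\mathbf{1}$ is the identity; (2) for indecomposable $W,W'\in\mathcal{R}(X)\setminus\{\mathbf{1}\}$, $W\diamond_wW'=WW'$ (concatenation) if $W\in X$ or $W'\in X$, and $W\diamond_wW'=\lfloor\overline W\diamond_wW'\rfloor+\lfloor W\diamond_w\overline W'\rfloor+\lambda\lfloor\overline W\diamond_w\overline W'\rfloor$ if $W=\lfloor\overline W\rfloor$, $W'=\lfloor\overline W'\rfloor$; (3) if $W=W_1\cdots W_b$, $W'=W'_1\cdots W'_{b'}$ are the decompositions of words different from $\mathbf{1}$ into indecomposable words different from $\mathbf{1}$, then $W\diamond_wW'=W_1\cdots W_{b-1}(W_b\diamond_wW'_1)W'_2\cdots W'_{b'}$. The map $j_X$ sends $x\in X$ to $x\in\mathcal{S}(X)\cap\mathcal{R}(X)$. **Motzkin paths.** A Motzkin path is a lattice path in $\mathbb{N}^2$ (with $\mathbb{N}$ the non-negative integers) from $(0,0)$ to some $(n,0)$, $n\ge0$, with steps $(1,1)$ (up), $(1,-1)$ (down), $(1,0)$ (level). $\mathcal{P}(X)$ is the set of Motzkin paths with level steps decorated by $X$; $\bullet$ is the trivial one-point path; $\ell_x$ is one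 level step decorated by $x$. $\circ$ is the link product (joining paths end to end), extended multilinearly; $/\,\mathfrak{m}\,\backslash$ adds an up step at the left end and a down step at the right end, extended linearly. A path is indecomposable if it touches the $x$-axis only at its two end vertices; an indecomposable path is $\bullet$, some $\ell_x$, or $/\,\bar{\mathfrak{m}}\,\backslash$. $\mathcal{V}(X)$ is the set of valley-free paths (no down step immediately followed by an up step), and $\mathcal{L}(X)$ the set of peak-free paths (not $\bullet$, no up step immediately followed by a down step). $\diamond_v$ is the bilinear product on $\mathbf{k}\mathcal{V}(X)$ defined recursively and characterized by: (1) $\bullet$ is the identity; (2) for indecomposable $\mathfrak{m},\mathfrak{m}'\in\mathcal{V}(X)\setminus\{\bullet\}$, $\mathfrak{m}\diamond_v\mathfrak{m}'=\mathfrak{m}\circ\mathfrak{m}'$ if $\mathfrak{m}=\ell_x$ or $\mathfrak{m}'=\ell_{x'}$ for some $x,x'\in X$, and $\mathfrak{m}\diamond_v\mathfrak{m}'=/\,\bar{\mathfrak{m}}\diamond_v\mathfrak{m}'\,\backslash+/\,\mathfrak{m}\diamond_v\bar{\mathfrak{m}}'\,\backslash+\lambda/\,\bar{\mathfrak{m}}\diamond_v\bar{\mathfrak{m}}'\,\backslash$ if $\mathfrak{m}=/\,\bar{\mathfrak{m}}\,\backslash$, $\mathfrak{m}'=/\,\bar{\mathfrak{m}}'\,\backslash$; (3) $\mathfrak{m}\diamond_v\mathfrak{m}'=\mathfrak{m}_1\circ\cdots\circ\mathfrak{m}_{p-1}\circ(\mathfrak{m}_p\diamond_v\mathfrak{m}'_1)\circ\mathfrak{m}'_2\circ\cdots\circ\mathfrak{m}'_{p'}$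 for decompositions $\mathfrak{m}=\mathfrak{m}_1\circ\cdots\circ\mathfrak{m}_p$, $\mathfrak{m}'=\mathfrak{m}'_1\circ\cdots\circ\mathfrak{m}'_{p'}$ of non-trivial paths into non-trivial indecomposable paths. **The bijections.** $\phi_{\mathcal{R},\mathcal{V}}$ and $\phi_{\mathcal{S}\mathcal{R},\mathcal{L}\mathcal{V}}$ are the restrictions to $\mathcal{R}(X)$ and $\mathcal{S}(X)\cap\mathcal{R}(X)$ of the unique monoid isomorphism $\mathcal{M}(X)\to\mathcal{P}(X)$ that sends each $x\in X$ to $\ell_x$ and takes $\lfloor W\rfloor$ to the raising of the image of $W$. *)

theory Defs
  imports "HOL-Algebra.Module"
begin

section \<open>Rota--Baxter algebras\<close>

record ('k, 'a) rb_structure = "('k, 'a) module" +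
  rb_op :: "'a \<Rightarrow> 'a"

text \<open>
  The \<open>one\<close> field of a structure plays no role in the nonunitary notions below, and need not lie
  in the carrier there.
\<close>

locale nonunitary_algebra = module R A
  for R :: "('k, 'c) ring_scheme" (structure) and A :: "('k, 'a, 'm) module_scheme" (structure) +
  assumes mult_closed: "\<lbrakk>x \<in> carrier A; y \<in> carrier A\<rbrakk> \<Longrightarrow> x \<otimes>\<^bsub>A\<^esub> y \<in> carrier A"
    and mult_assoc: "\<lbrakk>x \<in> carrier A; y \<in> carrier A; z \<in> carrier A\<rbrakk>
      \<Longrightarrow> (x \<otimes>\<^bsub>A\<^esub> y) \<otimes>\<^bsub>A\<^esub> z = x \<otimes>\<^bsub>A\<^esub> (y \<otimes>\<^bsub>A\<^esub> z)"
    and distr_left: "\<lbrakk>x \<in> carrier A; y \<in> carrier A; z \<in> carrier A\<rbrakk>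
      \<Longrightarrow> (x \<oplus>\<^bsub>A\<^esub> y) \<otimes>\<^bsub>A\<^esub> z = x \<otimes>\<^bsub>A\<^esub> z \<oplus>\<^bsub>A\<^esub> y \<otimes>\<^bsub>A\<^esub> z"
    and distr_right: "\<lbrakk>x \<in> carrier A; y \<in> carrier A; z \<in> carrier A\<rbrakk>
      \<Longrightarrow> z \<otimes>\<^bsub>A\<^esub> (x \<oplus>\<^bsub>A\<^esub> y) = z \<otimes>\<^bsub>A\<^esub> x \<oplus>\<^bsub>A\<^esub> z \<otimes>\<^bsub>A\<^esub> y"
    and smult_mult_left: "\<lbrakk>a \<in> carrier R; x \<in> carrier A; y \<in> carrier A\<rbrakk>
      \<Longrightarrow> (a \<odot>\<^bsub>A\<^esub> x) \<otimes>\<^bsub>A\<^esub> y = a \<odot>\<^bsub>A\<^esub> (x \<otimes>\<^bsub>A\<^esub> y)"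
    and smult_mult_right: "\<lbrakk>a \<in> carrier R; x \<in> carrier A; y \<in> carrier A\<rbrakk>
      \<Longrightarrow> x \<otimes>\<^bsub>A\<^esub> (a \<odot>\<^bsub>A\<^esub> y) = a \<odot>\<^bsub>A\<^esub> (x \<otimes>\<^bsub>A\<^esub> y)"

locale nonunitary_rota_baxter_algebra = nonunitary_algebra R A
  for R :: "('k, 'c) ring_scheme" (structure) and lam :: 'k
    and A :: "('k, 'a, 'm) rb_structure_scheme" (structure) +
  assumes weight_closed: "lam \<in> carrier R"
    and rb_op_closed: "x \<in> carrier A \<Longrightarrow> rb_op A x \<in> carrier A"
    and rb_op_add: "\<lbrakk>x \<in> carrier A; y \<in> carrier A\<rbrakk>
      \<Longrightarrow> rb_op A (x \<oplus>\<^bsub>A\<^esub> y) = rb_op A x \<oplus>\<^bsub>A\<^esub> rb_op A y"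
    and rb_op_smult: "\<lbrakk>a \<in> carrier R; x \<in> carrier A\<rbrakk>
      \<Longrightarrow> rb_op A (a \<odot>\<^bsub>A\<^esub> x) = a \<odot>\<^bsub>A\<^esub> rb_op A x"
    and rota_baxter: "\<lbrakk>x \<in> carrier A; y \<in> carrier A\<rbrakk>
      \<Longrightarrow> rb_op A x \<otimes>\<^bsub>A\<^esub> rb_op A y =
          rb_op A (x \<otimes>\<^bsub>A\<^esub> rb_op A y) \<oplus>\<^bsub>A\<^esub> rb_op A (rb_op A x \<otimes>\<^bsub>A\<^esub> y)
            \<oplus>\<^bsub>A\<^esub> lam \<odot>\<^bsub>A\<^esub> rb_op A (x \<otimes>\<^bsub>A\<^esub> y)"

locale rota_baxter_algebra = nonunitary_rota_baxter_algebra R lam A + monoid A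
  for R :: "('k, 'c) ring_scheme" (structure) and lam :: 'k
    and A :: "('k, 'a, 'm) rb_structure_scheme" (structure)

definition nonunitary_rb_hom ::
  "('k, 'c) ring_scheme \<Rightarrow> ('k, 'a, 'm) rb_structure_scheme \<Rightarrow> ('k, 'b, 'n) rb_structure_scheme
    \<Rightarrow> ('a \<Rightarrow> 'b) set"
where
  "nonunitary_rb_hom R A B = {h \<in> carrier A \<rightarrow> carrier B.
     (\<forall>x\<in>carrier A. \<forall>y\<in>carrier A. h (x \<oplus>\<^bsub>A\<^esub> y) = h x \<oplus>\<^bsub>B\<^esub> h y) \<and>
     (\<forall>a\<in>carrier R. \<forall>x\<in>carrier A. h (a \<odot>\<^bsub>A\<^esub> x) = a \<odot>\<^bsub>B\<^esub> h x) \<and>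
     (\<forall>x\<in>carrier A. \<forall>y\<in>carrier A. h (x \<otimes>\<^bsub>A\<^esub> y) = h x \<otimes>\<^bsub>B\<^esub> h y) \<and>
     (\<forall>x\<in>carrier A. h (rb_op A x) = rb_op B (h x))}"

definition rb_hom ::
  "('k, 'c) ring_scheme \<Rightarrow> ('k, 'a, 'm) rb_structure_scheme \<Rightarrow> ('k, 'b, 'n) rb_structure_scheme
    \<Rightarrow> ('a \<Rightarrow> 'b) set"
where
  "rb_hom R A B = {h \<in> nonunitary_rb_hom R A B. h \<one>\<^bsub>A\<^esub> = \<one>\<^bsub>B\<^esub>}"

definition nonunitary_rb_iso ::
  "('k, 'c) ring_scheme \<Rightarrow> ('k, 'a, 'm) rb_structure_scheme \<Rightarrow> ('k, 'b, 'n) rb_structure_scheme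
    \<Rightarrow> ('a \<Rightarrow> 'b) set"
where
  "nonunitary_rb_iso R A B = {h \<in> nonunitary_rb_hom R A B. bij_betw h (carrier A) (carrier B)}"

definition rb_iso ::
  "('k, 'c) ring_scheme \<Rightarrow> ('k, 'a, 'm) rb_structure_scheme \<Rightarrow> ('k, 'b, 'n) rb_structure_scheme
    \<Rightarrow> ('a \<Rightarrow> 'b) set"
where
  "rb_iso R A B = {h \<in> rb_hom R A B. bij_betw h (carrier A) (carrier B)}"

text \<open>
  The test algebras \<open>B\<close> have elements in the type given by the first argument; a theorem in which
  that type is a free type variable speaks about test algebras over every type. Morphisms are
  identified when they agree on the carrier, hence the restriction to \<open>extensional\<close> functions
  in the uniqueness claims.
\<close>

definition free_rota_baxter_algebra ::
  "'b itself \<Rightarrow> ('k, 'c) ring_scheme \<Rightarrow> 'k \<Rightarrow> 'x set \<Rightarrow> ('k, 'a) rb_structure \<Rightarrow> ('x \<Rightarrow> 'a) \<Rightarrow> bool"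
where
  "free_rota_baxter_algebra (_ :: 'b itself) R lam X U j \<longleftrightarrow>
     rota_baxter_algebra R lam U \<and> j \<in> X \<rightarrow> carrier U \<and>
     (\<forall>B :: ('k, 'b) rb_structure. rota_baxter_algebra R lam B \<longrightarrow>
       (\<forall>f \<in> X \<rightarrow> carrier B.
         \<exists>!h. h \<in> rb_hom R U B \<and> h \<in> extensional (carrier U) \<and> (\<forall>x\<in>X. f x = h (j x))))"

definition free_nonunitary_rota_baxter_algebra ::
  "'b itself \<Rightarrow> ('k, 'c) ring_scheme \<Rightarrow> 'k \<Rightarrow> 'x set \<Rightarrow> ('k, 'a) rb_structure \<Rightarrow> ('x \<Rightarrow> 'a) \<Rightarrow> bool"
where
  "free_nonunitary_rota_baxter_algebra (_ :: 'b itself) R lam X U j \<longleftrightarrow>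
     nonunitary_rota_baxter_algebra R lam U \<and> j \<in> X \<rightarrow> carrier U \<and>
     (\<forall>B :: ('k, 'b) rb_structure. nonunitary_rota_baxter_algebra R lam B \<longrightarrow>
       (\<forall>f \<in> X \<rightarrow> carrier B.
         \<exists>!h. h \<in> nonunitary_rb_hom R U B \<and> h \<in> extensional (carrier U) \<and>
              (\<forall>x\<in>X. f x = h (j x))))"

section \<open>Free modules\<close>

text \<open>
  An element of the free module on \<open>Y\<close> is its finitely supported coefficient function, equal to
  zero outside \<open>Y\<close>; so the free module on a subset of \<open>Y\<close> is literally a submodule.
\<close>

definition free_carrier :: "('k, 'c) ring_scheme \<Rightarrow> 'w set \<Rightarrow> ('w \<Rightarrow> 'k) set" where
  "free_carrier R Y =
     {c. (\<forall>w. c w \<in> carrier R) \<and> (\<forall>w. w \<notin> Y \<longrightarrow> c w = \<zero>\<^bsub>R\<^esub>) \<and> finite {w. c w \<noteq> \<zero>\<^bsub>R\<^esub>}}"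

definition free_zero :: "('k, 'c) ring_scheme \<Rightarrow> 'w \<Rightarrow> 'k" where
  "free_zero R = (\<lambda>w. \<zero>\<^bsub>R\<^esub>)"

definition free_add :: "('k, 'c) ring_scheme \<Rightarrow> ('w \<Rightarrow> 'k) \<Rightarrow> ('w \<Rightarrow> 'k) \<Rightarrow> 'w \<Rightarrow> 'k" where
  "free_add R c d = (\<lambda>w. c w \<oplus>\<^bsub>R\<^esub> d w)"

definition free_smult :: "('k, 'c) ring_scheme \<Rightarrow> 'k \<Rightarrow> ('w \<Rightarrow> 'k) \<Rightarrow> 'w \<Rightarrow> 'k" where
  "free_smult R a c = (\<lambda>w. a \<otimes>\<^bsub>R\<^esub> c w)"

definition basis :: "('k, 'c) ring_scheme \<Rightarrow> 'w \<Rightarrow> 'w \<Rightarrow> 'k" where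
  "basis R w = (\<lambda>v. if v = w then \<one>\<^bsub>R\<^esub> else \<zero>\<^bsub>R\<^esub>)"

text \<open>The linear map sending the basis element \<open>w\<close> to \<open>g w\<close>.\<close>

definition lin_ext :: "('k, 'c) ring_scheme \<Rightarrow> ('w \<Rightarrow> 'v \<Rightarrow> 'k) \<Rightarrow> ('w \<Rightarrow> 'k) \<Rightarrow> 'v \<Rightarrow> 'k" where
  "lin_ext R g c = (\<lambda>v. \<Oplus>\<^bsub>R\<^esub>w\<in>{w. c w \<noteq> \<zero>\<^bsub>R\<^esub>}. c w \<otimes>\<^bsub>R\<^esub> g w v)"

definition bilin_ext ::
  "('k, 'c) ring_scheme \<Rightarrow> ('w \<Rightarrow> 'w \<Rightarrow> 'v \<Rightarrow> 'k) \<Rightarrow> ('w \<Rightarrow> 'k) \<Rightarrow> ('w \<Rightarrow> 'k) \<Rightarrow> 'v \<Rightarrow> 'k"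
where
  "bilin_ext R g c d = lin_ext R (\<lambda>w. lin_ext R (\<lambda>w'. g w w') d) c"

section \<open>Bracketed words\<close>

datatype 'x letter = Var 'x | Br "'x letter list"

type_synonym 'x bword = "'x letter list"

primrec M_stage :: "'x set \<Rightarrow> nat \<Rightarrow> 'x bword set" where
  "M_stage X 0 = lists (Var ` X)"
| "M_stage X (Suc n) = lists (Var ` X \<union> Br ` M_stage X n)"

primrec S_stage :: "'x set \<Rightarrow> nat \<Rightarrow> 'x bword set" where
  "S_stage X 0 = lists (Var ` X) - {[]}"
| "S_stage X (Suc n) = lists (Var ` X \<union> Br ` S_stage X n) - {[]}"

definition bracketed_words :: "'x set \<Rightarrow> 'x bword set" where
  "bracketed_words X = (\<Union>n. M_stage X n)"

definition bracketed_words_S :: "'x set \<Rightarrow> 'x bword set" where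
  "bracketed_words_S X = (\<Union>n. S_stage X n)"

inductive no_adjacent_brackets :: "'x bword \<Rightarrow> bool" where
  "\<lbrakk>\<nexists>u V V' v. W = u @ [Br V, Br V'] @ v; \<forall>V. Br V \<in> set W \<longrightarrow> no_adjacent_brackets V\<rbrakk>
    \<Longrightarrow> no_adjacent_brackets W"

definition rb_words :: "'x set \<Rightarrow> 'x bword set" where
  "rb_words X = {W \<in> bracketed_words X. no_adjacent_brackets W}"

lemma size_letter_less: "a \<in> set W \<Longrightarrow> size a + 1 \<le> size_list size W"
  by (induction W) auto

text \<open>
  The indecomposable words other than the empty word are the one-letter words.
  \<open>diamond_w_basis\<close> multiplies words, \<open>diamond_w_letter\<close> one-letter words.
\<close>

function diamond_w_basis ::
    "('k, 'c) ring_scheme \<Rightarrow> 'k \<Rightarrow> 'x bword \<Rightarrow> 'x bword \<Rightarrow> 'x bword \<Rightarrow> 'k"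
  and diamond_w_letter ::
    "('k, 'c) ring_scheme \<Rightarrow> 'k \<Rightarrow> 'x letter \<Rightarrow> 'x letter \<Rightarrow> 'x bword \<Rightarrow> 'k"
where
  "diamond_w_basis R lam W W' =
     (if W = [] then basis R W'
      else if W' = [] then basis R W
      else lin_ext R (\<lambda>Z. basis R (butlast W @ Z @ tl W'))
             (diamond_w_letter R lam (last W) (hd W')))"
| "diamond_w_letter R lam (Var x) a = basis R [Var x, a]"
| "diamond_w_letter R lam (Br U) (Var x) = basis R [Br U, Var x]"
| "diamond_w_letter R lam (Br U) (Br V) =
     free_add R
       (free_add R
         (lin_ext R (\<lambda>Z. basis R [Br Z]) (diamond_w_basis R lam U [Br V]))
         (lin_ext R (\<lambda>Z. basis R [Br Z]) (diamond_w_basis R lam [Br U] V)))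
       (free_smult R lam
         (lin_ext R (\<lambda>Z. basis R [Br Z]) (diamond_w_basis R lam U V)))"
  by pat_completeness auto
termination
proof (relation "measure (\<lambda>z. case z of
      Inl (R, lam, W, W') \<Rightarrow> 2 * (size_list size W + size_list size W') + 1
    | Inr (R, lam, a, b) \<Rightarrow> 2 * (size a + size b + 2))", goal_cases)
  case (2 R lam W W')
  then have "size (last W) + 1 \<le> size_list size W" "size (hd W') + 1 \<le> size_list size W'"
    by (simp_all only: size_letter_less last_in_set hd_in_set not_False_eq_True)
  then show ?case by simp
qed auto

declare diamond_w_basis.simps [simp del]

definition word_rb :: "('k, 'c) ring_scheme \<Rightarrow> 'k \<Rightarrow> 'x bword set \<Rightarrow> ('k, 'x bword \<Rightarrow> 'k) rb_structure"
where
  "word_rb R lam Y =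
     \<lparr>carrier = free_carrier R Y,
      mult = bilin_ext R (diamond_w_basis R lam),
      one = basis R [],
      zero = free_zero R,
      add = free_add R,
      smult = free_smult R,
      rb_op = lin_ext R (\<lambda>W. basis R [Br W])\<rparr>"

definition word_j :: "('k, 'c) ring_scheme \<Rightarrow> 'x \<Rightarrow> 'x bword \<Rightarrow> 'k" where
  "word_j R x = basis R [Var x]"

section \<open>Motzkin paths\<close>

text \<open>
  A lattice path starting at the origin is the list of its steps; the point reached after \<open>i\<close>
  steps is \<open>(i, height (take i p))\<close>.
\<close>

datatype 'x step = Up | Down | Level 'x

primrec rise :: "'x step \<Rightarrow> int" where
  "rise Up = 1"
| "rise Down = - 1"
| "rise (Level x) = 0"

definition height :: "'x step list \<Rightarrow> int" where
  "height p = sum_list (map rise p)"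

definition motzkin_paths :: "'x set \<Rightarrow> 'x step list set" where
  "motzkin_paths X =
     {p \<in> lists ({Up, Down} \<union> Level ` X). (\<forall>i\<le>length p. 0 \<le> height (take i p)) \<and> height p = 0}"

definition raise_path :: "'x step list \<Rightarrow> 'x step list" where
  "raise_path p = Up # p @ [Down]"

definition valley_free :: "'x set \<Rightarrow> 'x step list set" where
  "valley_free X = {p \<in> motzkin_paths X. \<nexists>u v. p = u @ [Down, Up] @ v}"

definition peak_free :: "'x set \<Rightarrow> 'x step list set" where
  "peak_free X = {p \<in> motzkin_paths X. p \<noteq> [] \<and> (\<nexists>u v. p = u @ [Up, Down] @ v)}"

definition axis_visits :: "'x step list \<Rightarrow> nat set" where
  "axis_visits p = {i. i \<le> length p \<and> height (take i p) = 0}"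

definition indecomposable_path :: "'x set \<Rightarrow> 'x step list \<Rightarrow> bool" where
  "indecomposable_path X p \<longleftrightarrow> p \<in> motzkin_paths X \<and> axis_visits p \<subseteq> {0, length p}"

text \<open>
  Cutting a non-trivial Motzkin path at \<open>first_return\<close> splits off its first non-trivial
  indecomposable factor, cutting at \<open>last_departure\<close> its last one;
  see \<open>first_return_factor\<close> and \<open>last_departure_factor\<close> below.
\<close>

definition first_return :: "'x step list \<Rightarrow> nat" where
  "first_return p = Min (axis_visits p - {0})"

definition last_departure :: "'x step list \<Rightarrow> nat" where
  "last_departure p = Max (axis_visits p - {length p})"

text \<open>
  \<open>diamond_v_basis\<close> multiplies paths, \<open>diamond_v_indec\<close> non-trivial indecomposable paths: a path of
  this kind other than a level step is \<open>raise_path q\<close> with \<open>q = butlast (tl p)\<close>. That the recursion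
  on factors is the one on decompositions into indecomposables is stated in
  \<open>diamond_v_basis_concat\<close>.
\<close>

function diamond_v_basis ::
    "('k, 'c) ring_scheme \<Rightarrow> 'k \<Rightarrow> 'x step list \<Rightarrow> 'x step list \<Rightarrow> 'x step list \<Rightarrow> 'k"
  and diamond_v_indec ::
    "('k, 'c) ring_scheme \<Rightarrow> 'k \<Rightarrow> 'x step list \<Rightarrow> 'x step list \<Rightarrow> 'x step list \<Rightarrow> 'k"
where
  "diamond_v_basis R lam p p' =
     (if p = [] then basis R p'
      else if p' = [] then basis R p
      else lin_ext R (\<lambda>z. basis R (take (last_departure p) p @ z @ drop (first_return p') p'))
             (diamond_v_indec R lam (drop (last_departure p) p) (take (first_return p') p')))"
| "diamond_v_indec R lam p p' =
     (let q = butlast (tl p); q' = butlast (tl p') in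
      if p = raise_path q \<and> p' = raise_path q' then
        free_add R
          (free_add R
            (lin_ext R (\<lambda>z. basis R (raise_path z)) (diamond_v_basis R lam q p'))
            (lin_ext R (\<lambda>z. basis R (raise_path z)) (diamond_v_basis R lam p q')))
          (free_smult R lam
            (lin_ext R (\<lambda>z. basis R (raise_path z)) (diamond_v_basis R lam q q')))
      else basis R (p @ p'))"
  by pat_completeness auto
termination
proof (relation "measure (\<lambda>z. case z of
      Inl (R, lam, p, p') \<Rightarrow> 2 * (length p + length p') + 1
    | Inr (R, lam, p, p') \<Rightarrow> 2 * (length p + length p'))", goal_cases)
  case (3 R lam p p' q q')
  then have "length p = length q + 2"
    by (metis raise_path_def length_Cons length_append_singleton add_2_eq_Suc')
  then show ?case by simp
next
  case (4 R lam p p' q q')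
  then have "length p' = length q' + 2"
    by (metis raise_path_def length_Cons length_append_singleton add_2_eq_Suc')
  then show ?case by simp
next
  case (5 R lam p p' q q')
  then have "length p = length q + 2" "length p' = length q' + 2"
    by (metis raise_path_def length_Cons length_append_singleton add_2_eq_Suc')+
  then show ?case by simp
qed auto

declare diamond_v_basis.simps [simp del] diamond_v_indec.simps [simp del]

definition path_rb ::
  "('k, 'c) ring_scheme \<Rightarrow> 'k \<Rightarrow> 'x step list set \<Rightarrow> ('k, 'x step list \<Rightarrow> 'k) rb_structure"
where
  "path_rb R lam Y =
     \<lparr>carrier = free_carrier R Y,
      mult = bilin_ext R (diamond_v_basis R lam),
      one = basis R [],
      zero = free_zero R,
      add = free_add R,
      smult = free_smult R,
      rb_op = lin_ext R (\<lambda>p. basis R (raise_path p))\<rparr>"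

lemma height_append: "height (p @ q) = height p + height q"
  by (simp add: height_def)

lemma first_return_factor:
  assumes "indecomposable_path X p" "p \<noteq> []"
  shows "first_return (p @ q) = length p"
  unfolding first_return_def
proof (rule Min_eqI)
  show "finite (axis_visits (p @ q) - {0})"
    by (rule finite_subset[of _ "{..length (p @ q)}"]) (auto simp: axis_visits_def)
  show "length p \<in> axis_visits (p @ q) - {0}"
    using assms by (auto simp: axis_visits_def indecomposable_path_def motzkin_paths_def)
  show "length p \<le> i" if "i \<in> axis_visits (p @ q) - {0}" for i
  proof (rule ccontr)
    assume "\<not> length p \<le> i"
    with that have "i \<in> axis_visits p" "i \<noteq> 0" "i \<noteq> length p"
      by (auto simp: axis_visits_def)
    with assms show False by (auto simp: indecomposable_path_def)
  qed
qed

lemma last_departure_factor: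
  assumes "indecomposable_path X p" "p \<noteq> []" "height q = 0"
  shows "last_departure (q @ p) = length q"
  unfolding last_departure_def
proof (rule Max_eqI)
  show "finite (axis_visits (q @ p) - {length (q @ p)})"
    by (rule finite_subset[of _ "{..length (q @ p)}"]) (auto simp: axis_visits_def)
  show "length q \<in> axis_visits (q @ p) - {length (q @ p)}"
    using assms by (auto simp: axis_visits_def)
  show "i \<le> length q" if "i \<in> axis_visits (q @ p) - {length (q @ p)}" for i
  proof (rule ccontr)
    assume "\<not> i \<le> length q"
    with that assms have "i - length q \<in> axis_visits p" "i - length q \<noteq> 0" "i - length q \<noteq> length p"
      by (auto simp: axis_visits_def height_append)
    with assms show False by (auto simp: indecomposable_path_def)
  qed
qed

lemma height_concat_indecomposable:
  assumes "\<forall>p\<in>set ps. indecomposable_path X p"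
  shows "height (concat ps) = 0"
  using assms
  by (induction ps) (auto simp: height_append indecomposable_path_def motzkin_paths_def height_def)

theorem diamond_v_basis_concat:
  assumes ps: "ps \<noteq> []" "\<forall>p\<in>set ps. indecomposable_path X p \<and> p \<noteq> []"
    and ps': "ps' \<noteq> []" "\<forall>p\<in>set ps'. indecomposable_path X p \<and> p \<noteq> []"
  shows "diamond_v_basis R lam (concat ps) (concat ps') =
    lin_ext R (\<lambda>z. basis R (concat (butlast ps) @ z @ concat (tl ps')))
      (diamond_v_indec R lam (last ps) (hd ps'))"
proof -
  obtain qs p where p: "ps = qs @ [p]" using ps(1) by (metis rev_exhaust)
  obtain p' qs' where p': "ps' = p' # qs'" using ps'(1) by (metis list.exhaust)
  have "last_departure (concat qs @ p) = length (concat qs)"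
    using ps(2) p by (intro last_departure_factor height_concat_indecomposable[of _ X]) auto
  moreover have "first_return (p' @ concat qs') = length p'"
    using ps'(2) p' by (intro first_return_factor) auto
  moreover have "p \<noteq> []" "p' \<noteq> []" using ps(2) ps'(2) p p' by auto
  ultimately show ?thesis
    by (simp add: p p' diamond_v_basis.simps)
qed

lemma indecomposable_path_cases:
  assumes "indecomposable_path X p" "p \<noteq> []"
  obtains x where "x \<in> X" "p = [Level x]"
    | q where "q \<in> motzkin_paths X" "p = raise_path q"
proof -
  from assms obtain s r where s: "p = s # r" by (metis list.exhaust)
  have mp: "p \<in> motzkin_paths X" and ax: "axis_visits p \<subseteq> {0, length p}"
    using assms by (auto simp: indecomposable_path_def)
  have nonneg: "0 \<le> height (take i p)" if "i \<le> length p" for i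
    using mp that by (auto simp: motzkin_paths_def)
  have ht: "height p = 0" using mp by (auto simp: motzkin_paths_def)
  have pos: "0 < height (take i p)" if "0 < i" "i < length p" for i
  proof -
    have "i \<notin> axis_visits p" using ax that by auto
    then show ?thesis using nonneg[of i] that by (simp add: axis_visits_def)
  qed
  show ?thesis
  proof (cases s)
    case (Level x)
    then have "1 \<in> axis_visits p" by (auto simp: s axis_visits_def height_def)
    then have "r = []" using ax s by auto
    moreover have "x \<in> X" using mp s Level by (auto simp: motzkin_paths_def)
    ultimately show ?thesis using that(1) s Level by auto
  next
    case Down
    then show ?thesis using nonneg[of 1] s by (auto simp: height_def)
  next
    case Up
    then have "r \<noteq> []" using ht s by (auto simp: height_def)
    then obtain q t where r: "r = q @ [t]" by (metis rev_exhaust)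
    have p: "p = Up # q @ [t]" using s r Up by simp
    have pos': "0 \<le> height (take i q)" if "i \<le> length q" for i
      using pos[of "Suc i"] that by (simp add: p height_def)
    have tot: "1 + height q + rise t = 0" using ht by (simp add: p height_def)
    have "t = Down" using tot pos'[of "length q"] by (cases t) auto
    then have "height q = 0" using tot by simp
    then have "q \<in> motzkin_paths X" using pos' mp p by (auto simp: motzkin_paths_def)
    then show ?thesis using that(2) p \<open>t = Down\<close> by (auto simp: raise_path_def)
  qed
qed

lemma diamond_v_indec_level:
  "diamond_v_indec R lam [Level x] p = basis R ([Level x] @ p)"
  "diamond_v_indec R lam p [Level x] = basis R (p @ [Level x])"
  by (simp_all add: diamond_v_indec.simps Let_def raise_path_def)

lemma diamond_v_indec_raise:
  "diamond_v_indec R lam (raise_path q) (raise_path q') =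
    free_add R
      (free_add R
        (lin_ext R (\<lambda>z. basis R (raise_path z)) (diamond_v_basis R lam q (raise_path q')))
        (lin_ext R (\<lambda>z. basis R (raise_path z)) (diamond_v_basis R lam (raise_path q) q')))
      (free_smult R lam
        (lin_ext R (\<lambda>z. basis R (raise_path z)) (diamond_v_basis R lam q q')))"
  by (subst diamond_v_indec.simps) (simp add: Let_def raise_path_def)

section \<open>From words to paths\<close>

fun word_to_path :: "'x bword \<Rightarrow> 'x step list" where
  "word_to_path [] = []"
| "word_to_path (Var x # W) = Level x # word_to_path W"
| "word_to_path (Br V # W) = raise_path (word_to_path V) @ word_to_path W"

lemma word_to_path_append: "word_to_path (W @ W') = word_to_path W @ word_to_path W'"
  by (induction W rule: word_to_path.induct) auto

text \<open>
  \<open>word_to_path\<close> is the only monoid homomorphism with the prescribed values.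
\<close>

lemma word_to_path_unique:
  assumes "f [] = []" and app: "\<And>W W'. f (W @ W') = f W @ f W'"
    and "\<And>x. f [Var x] = [Level x]" and "\<And>W. f [Br W] = raise_path (f W)"
  shows "f W = word_to_path W"
proof (induction W rule: word_to_path.induct)
  case (2 x W)
  then show ?case using app[of "[Var x]" W] assms by simp
next
  case (3 V W)
  then show ?case using app[of "[Br V]" W] assms by simp
qed (use assms in simp)

end

theory Submission
  imports Defs
begin

text \<open>
  The one substantial point is that the recursively defined product of words is associative. It is
  easier to prove on the span of all bracketed words, with adjacent brackets allowed, because the
  recursion makes sense there and because that span also carries the plain concatenation
  product \<open>\<bullet>\<close>. The product of two words only changes the last letter of the first and the
  first letter of the second, so it satisfies \<open>x \<diamond> (y \<bullet> z) = (x \<diamond> y) \<bullet> z\<close> and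
  \<open>(z \<bullet> y) \<diamond> x = z \<bullet> (y \<diamond> x)\<close> when no empty word occurs in \<open>y\<close>
  (\<open>mult_conc_right\<close>, \<open>mult_conc_left\<close>). These two laws settle the associativity of a triple whose
  middle word has at least two letters, and reduce other nonempty triples to single letters. A
  variable multiplies by concatenation, so only three brackets \<open>P u\<close>, \<open>P v\<close>, \<open>P w\<close> are left. For them
  both sides are expanded by the Rota--Baxter identity, which for brackets is the defining
  recursion; the resulting terms agree by the associativity of seven triples of smaller total size
  (\<open>assoc_rb_op\<close>, \<open>assoc_words\<close>). The words without adjacent brackets, with or without empty
  words inside, span subalgebras because multiplying never creates adjacent brackets
  (\<open>mult_stable_rb_words_over\<close>).

  For freeness, a map \<open>f\<close> from \<open>X\<close> to a test algebra extends to words by reading letters as values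
  of \<open>f\<close>, brackets as the operator and concatenation as the product. The linear extension of this
  evaluation is multiplicative by induction along the recursion of the product (\<open>lift_diamond\<close>).
  It is the only possible extension since a word without adjacent brackets is the product of its
  letters (\<open>hom_on_words\<close>): this is where the exclusion of adjacent brackets enters.

  On the side of paths, a word is read as the path in which brackets are up and down steps. This is
  a bijection from all bracketed words onto Motzkin paths: it is inverted by splitting a path at its
  first return to the axis. A valley is a pair of adjacent brackets and a peak is an empty bracket,
  so the bijection restricts as claimed (\<open>bij_rb_words\<close>, \<open>bij_rb_words_nonunitary\<close>). The
  two products are given by the same recursion under this translation (\<open>path_map_diamond\<close>); hence
  the Rota--Baxter identities need not be proved again for paths, they are transported along a
  surjective homomorphism (\<open>rb_image\<close>).
\<close>

section \<open>Linear maps on free modules\<close>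

definition linear_on ::
  "('k, 'c) ring_scheme \<Rightarrow> 'w set \<Rightarrow> ('k, 'b, 'm) module_scheme \<Rightarrow> (('w \<Rightarrow> 'k) \<Rightarrow> 'b) \<Rightarrow> bool"
where
  "linear_on R Y M f \<longleftrightarrow> f \<in> free_carrier R Y \<rightarrow> carrier M \<and>
     (\<forall>c\<in>free_carrier R Y. \<forall>d\<in>free_carrier R Y. f (free_add R c d) = f c \<oplus>\<^bsub>M\<^esub> f d) \<and>
     (\<forall>a\<in>carrier R. \<forall>c\<in>free_carrier R Y. f (free_smult R a c) = a \<odot>\<^bsub>M\<^esub> f c)"

text \<open>
  The counterpart of \<open>lin_ext\<close> with values in an arbitrary module: the linear map with
  \<open>basis R w \<mapsto> g w\<close>.
\<close>

definition lin_to ::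
  "('k, 'c) ring_scheme \<Rightarrow> ('k, 'b, 'm) module_scheme \<Rightarrow> ('w \<Rightarrow> 'b) \<Rightarrow> ('w \<Rightarrow> 'k) \<Rightarrow> 'b"
where
  "lin_to R M g c = (\<Oplus>\<^bsub>M\<^esub>w\<in>{w. c w \<noteq> \<zero>\<^bsub>R\<^esub>}. c w \<odot>\<^bsub>M\<^esub> g w)"

text \<open>
  The linear structure shared by the algebras of words and of paths, packaged so that it can serve
  as the target of a linear map.
\<close>

definition free_module :: "('k, 'c) ring_scheme \<Rightarrow> 'w set \<Rightarrow> ('k, 'w \<Rightarrow> 'k) module" where
  "free_module R Y =
     \<lparr>carrier = free_carrier R Y, mult = undefined, one = undefined,
      zero = free_zero R, add = free_add R, smult = free_smult R\<rparr>"

lemma free_module_simps [simp]: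
  "carrier (free_module R Y) = free_carrier R Y"
  "zero (free_module R Y) = free_zero R"
  "add (free_module R Y) = free_add R"
  "smult (free_module R Y) = free_smult R"
  by (simp_all add: free_module_def)

lemma basis_apply: "basis R w v = (if v = w then \<one>\<^bsub>R\<^esub> else \<zero>\<^bsub>R\<^esub>)"
  by (simp add: basis_def)

lemma free_carrier_mono: "Y \<subseteq> Z \<Longrightarrow> c \<in> free_carrier R Y \<Longrightarrow> c \<in> free_carrier R Z"
  by (auto simp: free_carrier_def)

lemma free_carrier_Int: "free_carrier R (Y \<inter> Z) = free_carrier R Y \<inter> free_carrier R Z"
  by (auto simp: free_carrier_def)

lemma free_carrier_support: "c \<in> free_carrier R Y \<Longrightarrow> {w. c w \<noteq> \<zero>\<^bsub>R\<^esub>} \<subseteq> Y"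
  by (auto simp: free_carrier_def)

lemma free_carrier_finite: "c \<in> free_carrier R Y \<Longrightarrow> finite {w. c w \<noteq> \<zero>\<^bsub>R\<^esub>}"
  by (auto simp: free_carrier_def)

lemma free_carrier_coeff: "c \<in> free_carrier R Y \<Longrightarrow> c w \<in> carrier R"
  by (auto simp: free_carrier_def)

context cring
begin

lemma free_zero_closed [simp]: "free_zero R \<in> free_carrier R Y"
  by (auto simp: free_carrier_def free_zero_def)

lemma free_add_closed [simp]:
  assumes "c \<in> free_carrier R Y" "d \<in> free_carrier R Y"
  shows "free_add R c d \<in> free_carrier R Y"
proof -
  have "{w. c w \<oplus> d w \<noteq> \<zero>} \<subseteq> {w. c w \<noteq> \<zero>} \<union> {w. d w \<noteq> \<zero>}" by auto
  then have "finite {w. c w \<oplus> d w \<noteq> \<zero>}"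
    using finite_UnI[OF assms[THEN free_carrier_finite]] by (rule finite_subset)
  then show ?thesis using assms by (auto simp: free_carrier_def free_add_def)
qed

lemma free_smult_closed [simp]:
  assumes "a \<in> carrier R" "c \<in> free_carrier R Y"
  shows "free_smult R a c \<in> free_carrier R Y"
proof -
  have "{w. a \<otimes> c w \<noteq> \<zero>} \<subseteq> {w. c w \<noteq> \<zero>}" using assms(1) by auto
  then have "finite {w. a \<otimes> c w \<noteq> \<zero>}" using free_carrier_finite[OF assms(2)] by (rule finite_subset)
  then show ?thesis using assms by (auto simp: free_carrier_def free_smult_def)
qed

lemma basis_closed [simp]: "w \<in> Y \<Longrightarrow> basis R w \<in> free_carrier R Y"
  by (auto simp: free_carrier_def basis_def)

lemma module_freeI:
  assumes M: "carrier M = free_carrier R Y" "add M = free_add R" "zero M = free_zero R"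
    "smult M = free_smult R"
  shows "module R M"
proof (rule moduleI)
  show "cring R" by (rule is_cring)
  show "abelian_group M"
  proof (rule abelian_groupI)
    fix x assume "x \<in> carrier M"
    then have "free_smult R (\<ominus> \<one>) x \<oplus>\<^bsub>M\<^esub> x = \<zero>\<^bsub>M\<^esub>" "free_smult R (\<ominus> \<one>) x \<in> carrier M"
      by (simp_all add: M)
        (auto simp: free_smult_def free_add_def free_zero_def fun_eq_iff free_carrier_coeff
            l_minus l_neg)
    then show "\<exists>y\<in>carrier M. y \<oplus>\<^bsub>M\<^esub> x = \<zero>\<^bsub>M\<^esub>" by auto
  qed (auto simp: M free_add_def free_zero_def fun_eq_iff free_carrier_coeff a_ac
         intro!: free_add_closed[unfolded free_add_def] free_zero_closed[unfolded free_zero_def])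
qed (auto simp: M free_add_def free_smult_def fun_eq_iff free_carrier_coeff l_distr r_distr m_assoc
       intro!: free_smult_closed[unfolded free_smult_def])

lemma module_free_module [simp]: "module R (free_module R Y)"
  by (rule module_freeI) simp_all

lemma free_induct [consumes 1, case_names zero add]:
  assumes c: "c \<in> free_carrier R Y" and zero: "P (free_zero R)"
    and add: "\<And>a w d. \<lbrakk>a \<in> carrier R; w \<in> Y; d \<in> free_carrier R Y; P d\<rbrakk>
      \<Longrightarrow> P (free_add R (free_smult R a (basis R w)) d)"
  shows "P c"
proof -
  have "finite {w. c w \<noteq> \<zero>}" using c by (rule free_carrier_finite)
  then show ?thesis using c
  proof (induction "{w. c w \<noteq> \<zero>}" arbitrary: c rule: finite_induct)
    case empty
    then have "c = free_zero R" by (auto simp: free_zero_def)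
    then show ?case using zero by simp
  next
    case (insert w S)
    define d where "d = c(w := \<zero>)"
    have d: "{v. d v \<noteq> \<zero>} = S" using insert.hyps(2,4) by (auto simp: d_def)
    have "d \<in> free_carrier R Y"
      using insert.prems d insert.hyps(1) by (auto simp: free_carrier_def d_def)
    moreover from this have "P d" using insert.hyps(3) d by simp
    moreover have "w \<in> Y" using insert.hyps(4) free_carrier_support[OF insert.prems] by auto
    moreover have "c = free_add R (free_smult R (c w) (basis R w)) d"
      using insert.prems
      by (auto simp: fun_eq_iff free_add_def free_smult_def basis_def d_def free_carrier_coeff)
    ultimately show ?case using add free_carrier_coeff[OF insert.prems] by metis
  qed
qed

end

lemma linear_on_closed: "linear_on R Y M f \<Longrightarrow> c \<in> free_carrier R Y \<Longrightarrow> f c \<in> carrier M"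
  by (auto simp: linear_on_def)

lemma linear_on_plus:
  "\<lbrakk>linear_on R Y M f; c \<in> free_carrier R Y; d \<in> free_carrier R Y\<rbrakk>
    \<Longrightarrow> f (free_add R c d) = f c \<oplus>\<^bsub>M\<^esub> f d"
  by (auto simp: linear_on_def)

lemma linear_on_scale:
  "\<lbrakk>linear_on R Y M f; a \<in> carrier R; c \<in> free_carrier R Y\<rbrakk>
    \<Longrightarrow> f (free_smult R a c) = a \<odot>\<^bsub>M\<^esub> f c"
  by (auto simp: linear_on_def)

context module
begin

lemma linear_on_zero: "linear_on R Y M f \<Longrightarrow> f (free_zero R) = \<zero>\<^bsub>M\<^esub>"
proof -
  assume f: "linear_on R Y M f"
  have "f (free_zero R) = f (free_smult R \<zero> (free_zero R))"
    by (simp add: free_zero_def free_smult_def)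
  also have "\<dots> = \<zero> \<odot>\<^bsub>M\<^esub> f (free_zero R)" using linear_on_scale[OF f, of \<zero> "free_zero R"] by simp
  also have "\<dots> = \<zero>\<^bsub>M\<^esub>" using linear_on_closed[OF f] by simp
  finally show ?thesis .
qed

lemma linear_on_eqI:
  assumes "linear_on R Y M f" "linear_on R Y M g" "\<And>w. w \<in> Y \<Longrightarrow> f (basis R w) = g (basis R w)"
    and "c \<in> free_carrier R Y"
  shows "f c = g c"
  using assms(4)
proof (induction rule: free_induct)
  case zero
  then show ?case using assms by (simp add: linear_on_zero)
next
  case (add a w d)
  then show ?case
    by (simp add: assms(3) linear_on_plus[OF assms(1)] linear_on_plus[OF assms(2)]
        linear_on_scale[OF assms(1)] linear_on_scale[OF assms(2)])
qed

lemma linear_on_add_fun: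
  assumes "linear_on R Y M f" "linear_on R Y M g"
  shows "linear_on R Y M (\<lambda>c. f c \<oplus>\<^bsub>M\<^esub> g c)"
  using assms unfolding linear_on_def
  by (auto simp: smult_r_distr Pi_iff M.a_ac)

lemma linear_on_smult_fun:
  assumes "a \<in> carrier R" "linear_on R Y M f"
  shows "linear_on R Y M (\<lambda>c. a \<odot>\<^bsub>M\<^esub> f c)"
  using assms unfolding linear_on_def
  by (auto simp: smult_r_distr Pi_iff smult_assoc1[symmetric] R.m_comm)

text \<open>Enlarging the index set beyond the support lets sums over two supports be compared.\<close>

lemma lin_to_superset:
  assumes "c \<in> free_carrier R Y" "g \<in> Y \<rightarrow> carrier M" "finite S" "{w. c w \<noteq> \<zero>} \<subseteq> S" "S \<subseteq> Y"
  shows "lin_to R M g c = (\<Oplus>\<^bsub>M\<^esub>w\<in>S. c w \<odot>\<^bsub>M\<^esub> g w)"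
  unfolding lin_to_def
proof (rule M.add.finprod_mono_neutral_cong_left)
  fix w assume "w \<in> S - {w. c w \<noteq> \<zero>}"
  then have "c w = \<zero>" "g w \<in> carrier M" using assms by auto
  then show "c w \<odot>\<^bsub>M\<^esub> g w = \<zero>\<^bsub>M\<^esub>" by simp
next
  show "(\<lambda>w. c w \<odot>\<^bsub>M\<^esub> g w) \<in> S \<rightarrow> carrier M"
    using assms by (auto intro!: smult_closed simp: free_carrier_coeff)
qed (use assms in auto)

lemma linear_on_lin_to:
  assumes g: "g \<in> Y \<rightarrow> carrier M"
  shows "linear_on R Y M (lin_to R M g)"
  unfolding linear_on_def
proof (intro conjI ballI Pi_I)
  fix c assume c: "c \<in> free_carrier R Y"
  note supp = free_carrier_finite[OF c] free_carrier_support[OF c]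
  have cl: "(\<lambda>w. c w \<odot>\<^bsub>M\<^esub> g w) \<in> {w. c w \<noteq> \<zero>} \<rightarrow> carrier M"
    using c supp g by (auto intro!: smult_closed simp: free_carrier_coeff)
  then show "lin_to R M g c \<in> carrier M"
    unfolding lin_to_def by (rule M.finsum_closed)
  show "lin_to R M g (free_smult R a c) = a \<odot>\<^bsub>M\<^esub> lin_to R M g c" if a: "a \<in> carrier R" for a
  proof -
    have "lin_to R M g (free_smult R a c) =
        (\<Oplus>\<^bsub>M\<^esub>w\<in>{w. c w \<noteq> \<zero>}. free_smult R a c w \<odot>\<^bsub>M\<^esub> g w)"
      using supp a g free_smult_closed[OF a c]
      by (intro lin_to_superset[of _ Y]) (auto simp: free_smult_def)
    also have "\<dots> = (\<Oplus>\<^bsub>M\<^esub>w\<in>{w. c w \<noteq> \<zero>}. a \<odot>\<^bsub>M\<^esub> (c w \<odot>\<^bsub>M\<^esub> g w))"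
    proof (rule M.add.finprod_cong')
      fix w assume "w \<in> {w. c w \<noteq> \<zero>}"
      then have "g w \<in> carrier M" using supp g by auto
      then show "free_smult R a c w \<odot>\<^bsub>M\<^esub> g w = a \<odot>\<^bsub>M\<^esub> (c w \<odot>\<^bsub>M\<^esub> g w)"
        using a c by (simp add: free_smult_def smult_assoc1 free_carrier_coeff)
    qed (use a cl in auto)
    also have "\<dots> = a \<odot>\<^bsub>M\<^esub> lin_to R M g c"
      unfolding lin_to_def using finsum_smult_ldistr[OF supp(1) a cl] by simp
    finally show ?thesis .
  qed
  fix d assume d: "d \<in> free_carrier R Y"
  define S where "S = {w. c w \<noteq> \<zero>} \<union> {w. d w \<noteq> \<zero>}"
  have S: "finite S" "S \<subseteq> Y"
    unfolding S_def using supp free_carrier_finite[OF d] free_carrier_support[OF d] by auto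
  then have gS: "g w \<in> carrier M" if "w \<in> S" for w using g that by auto
  have "lin_to R M g (free_add R c d) = (\<Oplus>\<^bsub>M\<^esub>w\<in>S. free_add R c d w \<odot>\<^bsub>M\<^esub> g w)"
    using S g free_add_closed[OF c d]
    by (intro lin_to_superset[of _ Y]) (auto simp: S_def free_add_def free_carrier_coeff[OF c])
  also have "\<dots> = (\<Oplus>\<^bsub>M\<^esub>w\<in>S. c w \<odot>\<^bsub>M\<^esub> g w \<oplus>\<^bsub>M\<^esub> d w \<odot>\<^bsub>M\<^esub> g w)"
    using c d gS
    by (intro M.add.finprod_cong') (auto simp: free_add_def smult_l_distr free_carrier_coeff)
  also have "\<dots> = (\<Oplus>\<^bsub>M\<^esub>w\<in>S. c w \<odot>\<^bsub>M\<^esub> g w) \<oplus>\<^bsub>M\<^esub> (\<Oplus>\<^bsub>M\<^esub>w\<in>S. d w \<odot>\<^bsub>M\<^esub> g w)"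
    using c d gS by (intro M.finsum_addf) (auto simp: free_carrier_coeff)
  also have "\<dots> = lin_to R M g c \<oplus>\<^bsub>M\<^esub> lin_to R M g d"
    using S c d g by (simp add: lin_to_superset[of _ Y g S] S_def)
  finally show "lin_to R M g (free_add R c d) = lin_to R M g c \<oplus>\<^bsub>M\<^esub> lin_to R M g d" .
qed

lemma lin_to_basis:
  assumes "g w \<in> carrier M"
  shows "lin_to R M g (basis R w) = g w"
proof -
  have "lin_to R M g (basis R w) = (\<Oplus>\<^bsub>M\<^esub>v\<in>{w}. basis R w v \<odot>\<^bsub>M\<^esub> g v)"
    using assms by (intro lin_to_superset[of _ "{w}"]) (simp_all add: basis_apply subset_iff)
  also have "\<dots> = g w" using assms by (simp add: basis_def)
  finally show ?thesis .
qed

end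

context cring
begin

lemma finsum_free_module:
  assumes "finite S" "g \<in> S \<rightarrow> free_carrier R Z"
  shows "(\<Oplus>\<^bsub>free_module R Z\<^esub>w\<in>S. g w) v = (\<Oplus>w\<in>S. g w v)"
proof -
  interpret F: module R "free_module R Z" by simp
  show ?thesis using assms
  proof (induction S rule: finite_induct)
    case empty
    then show ?case by (simp add: free_zero_def)
  next
    case (insert w S)
    then have "(\<Oplus>\<^bsub>free_module R Z\<^esub>w\<in>insert w S. g w) v = g w v \<oplus> (\<Oplus>\<^bsub>free_module R Z\<^esub>w\<in>S. g w) v"
      by (simp add: free_add_def Pi_iff)
    moreover have "(\<lambda>w. g w v) \<in> S \<rightarrow> carrier R" "g w v \<in> carrier R"
      using insert.prems by (auto simp: Pi_iff intro: free_carrier_coeff)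
    ultimately show ?case using insert by simp
  qed
qed

text \<open>
  Sums in a free module are computed coefficientwise, so \<open>lin_ext\<close> inherits linearity and
  its values on basis elements from \<open>lin_to\<close>.
\<close>

lemma lin_ext_eq_lin_to:
  assumes "g \<in> Y \<rightarrow> free_carrier R Z" "c \<in> free_carrier R Y"
  shows "lin_ext R g c = lin_to R (free_module R Z) g c"
proof
  fix v
  have "lin_to R (free_module R Z) g c v = (\<Oplus>w\<in>{w. c w \<noteq> \<zero>}. (free_smult R (c w) (g w)) v)"
    unfolding lin_to_def using assms free_carrier_support[OF assms(2)] free_carrier_finite[OF assms(2)]
    by (subst finsum_free_module) (auto intro!: free_smult_closed simp: free_carrier_coeff)
  then show "lin_ext R g c v = lin_to R (free_module R Z) g c v"
    by (simp add: lin_ext_def free_smult_def)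
qed

lemma linear_on_cong:
  assumes "linear_on R Y M f" "\<And>c. c \<in> free_carrier R Y \<Longrightarrow> f c = g c"
  shows "linear_on R Y M g"
  using assms unfolding linear_on_def by (simp add: Pi_iff)

lemma linear_on_lin_ext:
  assumes "g \<in> Y \<rightarrow> free_carrier R Z"
  shows "linear_on R Y (free_module R Z) (lin_ext R g)"
proof -
  interpret F: module R "free_module R Z" by simp
  show ?thesis
    by (rule linear_on_cong[OF F.linear_on_lin_to[of g Y]])
      (use assms in \<open>simp_all add: lin_ext_eq_lin_to\<close>)
qed

lemma lin_ext_closed:
  assumes "\<And>w. w \<in> Y \<Longrightarrow> g w \<in> free_carrier R Z" "c \<in> free_carrier R Y"
  shows "lin_ext R g c \<in> free_carrier R Z"
  using linear_on_closed[OF linear_on_lin_ext[of g Y Z] assms(2)] assms(1) by auto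

lemma lin_ext_basis:
  assumes "g w \<in> free_carrier R Z"
  shows "lin_ext R g (basis R w) = g w"
proof -
  interpret F: module R "free_module R Z" by simp
  show ?thesis
    using assms F.lin_to_basis[of g w] by (simp add: lin_ext_eq_lin_to[of g "{w}" Z])
qed

lemma lin_ext_add:
  assumes "\<And>w. w \<in> Y \<Longrightarrow> g w \<in> free_carrier R UNIV" "c \<in> free_carrier R Y" "d \<in> free_carrier R Y"
  shows "lin_ext R g (free_add R c d) = free_add R (lin_ext R g c) (lin_ext R g d)"
  using linear_on_plus[OF linear_on_lin_ext[of g Y UNIV] assms(2,3)] assms(1) by auto

lemma lin_ext_smult:
  assumes "\<And>w. w \<in> Y \<Longrightarrow> g w \<in> free_carrier R UNIV" "a \<in> carrier R" "c \<in> free_carrier R Y"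
  shows "lin_ext R g (free_smult R a c) = free_smult R a (lin_ext R g c)"
  using linear_on_scale[OF linear_on_lin_ext[of g Y UNIV] assms(2,3)] assms(1) by auto

lemma linear_on_comp:
  assumes "linear_on R Y (free_module R Z) f" "linear_on R Z M g"
  shows "linear_on R Y M (\<lambda>c. g (f c))"
  using assms unfolding linear_on_def by (auto simp: Pi_iff)

lemma lin_ext_lin_ext:
  assumes "\<And>w. w \<in> Y \<Longrightarrow> h w \<in> free_carrier R Z" "\<And>w. w \<in> Z \<Longrightarrow> g w \<in> free_carrier R V"
    and c: "c \<in> free_carrier R Y"
  shows "lin_ext R g (lin_ext R h c) = lin_ext R (\<lambda>w. lin_ext R g (h w)) c"
proof -
  interpret F: module R "free_module R V" by simp
  have cl: "lin_ext R g (h w) \<in> free_carrier R V" if "w \<in> Y" for w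
    using assms(1)[OF that] assms(2) by (rule lin_ext_closed[rotated])
  show ?thesis
  proof (rule F.linear_on_eqI[OF _ _ _ c])
    show "linear_on R Y (free_module R V) (\<lambda>c. lin_ext R g (lin_ext R h c))"
      by (rule linear_on_comp[of Y Z]; rule linear_on_lin_ext) (use assms in auto)
    show "linear_on R Y (free_module R V) (lin_ext R (\<lambda>w. lin_ext R g (h w)))"
      by (rule linear_on_lin_ext) (use cl in auto)
    show "lin_ext R g (lin_ext R h (basis R w)) = lin_ext R (\<lambda>w. lin_ext R g (h w)) (basis R w)"
      if "w \<in> Y" for w
      using cl[OF that] assms(1)[OF that] by (simp add: lin_ext_basis)
  qed
qed

lemma lin_ext_cong:
  assumes "c \<in> free_carrier R Y" "\<And>w. w \<in> Y \<Longrightarrow> g w = h w" "\<And>w. w \<in> Y \<Longrightarrow> g w \<in> free_carrier R Z"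
  shows "lin_ext R g c = lin_ext R h c"
proof -
  interpret F: module R "free_module R Z" by simp
  show ?thesis
    by (rule F.linear_on_eqI[OF linear_on_lin_ext linear_on_lin_ext _ assms(1)])
      (use assms in \<open>auto simp: lin_ext_basis[of _ _ Z]\<close>)
qed

lemma lin_ext_basis_id:
  assumes "c \<in> free_carrier R Y"
  shows "lin_ext R (basis R) c = c"
proof -
  interpret F: module R "free_module R Y" by simp
  have "linear_on R Y (free_module R Y) (\<lambda>c. c)" by (auto simp: linear_on_def)
  moreover have "linear_on R Y (free_module R Y) (lin_ext R (basis R))"
    by (rule linear_on_lin_ext) auto
  ultimately show ?thesis
    using F.linear_on_eqI[of Y "lin_ext R (basis R)" "\<lambda>c. c" c] assms
    by (auto simp: lin_ext_basis[of _ _ Y])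
qed

text \<open>
  The inverse is the linear extension of the inverse bijection.
\<close>

lemma lin_ext_bij_betw:
  assumes "bij_betw f Y Z"
  shows "bij_betw (lin_ext R (\<lambda>w. basis R (f w))) (free_carrier R Y) (free_carrier R Z)"
proof -
  define g where "g = inv_into Y f"
  have f: "f w \<in> Z" "g (f w) = w" if "w \<in> Y" for w
    using assms that bij_betw_apply[OF assms] by (auto simp: g_def bij_betw_def)
  have g: "g z \<in> Y" "f (g z) = z" if "z \<in> Z" for z
    using assms that bij_betw_apply[OF bij_betw_inv_into[OF assms]]
    by (auto simp: g_def bij_betw_inv_into_right)
  show ?thesis
  proof (rule bij_betw_byWitness[where f' = "lin_ext R (\<lambda>z. basis R (g z))"])
    show "\<forall>c\<in>free_carrier R Y. lin_ext R (\<lambda>z. basis R (g z)) (lin_ext R (\<lambda>w. basis R (f w)) c) = c"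
    proof
      fix c assume c: "c \<in> free_carrier R Y"
      have "lin_ext R (\<lambda>z. basis R (g z)) (lin_ext R (\<lambda>w. basis R (f w)) c) =
          lin_ext R (\<lambda>w. lin_ext R (\<lambda>z. basis R (g z)) (basis R (f w))) c"
        by (rule lin_ext_lin_ext[of Y _ Z _ Y]) (use f g c in auto)
      also have "\<dots> = lin_ext R (basis R) c"
        by (rule lin_ext_cong[of _ Y _ _ Y]) (use f g c in \<open>auto simp: lin_ext_basis[of _ _ Y]\<close>)
      finally show "lin_ext R (\<lambda>z. basis R (g z)) (lin_ext R (\<lambda>w. basis R (f w)) c) = c"
        using c by (simp add: lin_ext_basis_id)
    qed
    show "\<forall>c\<in>free_carrier R Z. lin_ext R (\<lambda>w. basis R (f w)) (lin_ext R (\<lambda>z. basis R (g z)) c) = c"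
    proof
      fix c assume c: "c \<in> free_carrier R Z"
      have "lin_ext R (\<lambda>w. basis R (f w)) (lin_ext R (\<lambda>z. basis R (g z)) c) =
          lin_ext R (\<lambda>z. lin_ext R (\<lambda>w. basis R (f w)) (basis R (g z))) c"
        by (rule lin_ext_lin_ext[of Z _ Y _ Z]) (use f g c in auto)
      also have "\<dots> = lin_ext R (basis R) c"
        by (rule lin_ext_cong[of _ Z _ _ Z]) (use f g c in \<open>auto simp: lin_ext_basis[of _ _ Z]\<close>)
      finally show "lin_ext R (\<lambda>w. basis R (f w)) (lin_ext R (\<lambda>z. basis R (g z)) c) = c"
        using c by (simp add: lin_ext_basis_id)
    qed
  qed (use f g in \<open>auto intro!: lin_ext_closed[of Y _ Z] lin_ext_closed[of Z _ Y]\<close>)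
qed

subsection \<open>Bilinear maps\<close>

lemma linear_on_bilin_left:
  assumes "\<And>w w'. w \<in> Y \<Longrightarrow> w' \<in> Y \<Longrightarrow> g w w' \<in> free_carrier R Z" "d \<in> free_carrier R Y"
  shows "linear_on R Y (free_module R Z) (\<lambda>c. bilin_ext R g c d)"
  unfolding bilin_ext_def
  by (rule linear_on_lin_ext) (use assms in \<open>auto intro!: lin_ext_closed[of Y]\<close>)

lemma bilin_ext_basis_left:
  assumes "\<And>w w'. w \<in> Y \<Longrightarrow> w' \<in> Y \<Longrightarrow> g w w' \<in> free_carrier R Z" "w \<in> Y" "d \<in> free_carrier R Y"
  shows "bilin_ext R g (basis R w) d = lin_ext R (g w) d"
  unfolding bilin_ext_def
  by (rule lin_ext_basis[of _ _ Z]) (use assms in \<open>auto intro!: lin_ext_closed[of Y]\<close>)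

lemma bilin_ext_closed:
  assumes "\<And>w w'. w \<in> Y \<Longrightarrow> w' \<in> Y \<Longrightarrow> g w w' \<in> free_carrier R Z"
    "c \<in> free_carrier R Y" "d \<in> free_carrier R Y"
  shows "bilin_ext R g c d \<in> free_carrier R Z"
  using linear_on_closed[OF linear_on_bilin_left[of Y g Z d]] assms by auto

text \<open>
  Only linearity in the first argument is built into the nested definition of \<open>bilin_ext\<close>.
  For the second argument, both sides of each linearity equation are linear in the first one, so it
  is enough to compare them when the first argument is a basis element.
\<close>

lemma linear_on_bilin_right:
  assumes g: "\<And>w w'. w \<in> Y \<Longrightarrow> w' \<in> Y \<Longrightarrow> g w w' \<in> free_carrier R Z" and c: "c \<in> free_carrier R Y"
  shows "linear_on R Y (free_module R Z) (bilin_ext R g c)"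
proof -
  interpret F: module R "free_module R Z" by simp
  note left = linear_on_bilin_left[of Y g Z, OF g]
  have lin: "linear_on R Y (free_module R Z) (lin_ext R (g w))" if "w \<in> Y" for w
    by (rule linear_on_lin_ext) (use g that in auto)
  note bl = bilin_ext_basis_left[of Y g Z, OF g]
  show ?thesis unfolding linear_on_def
  proof (intro conjI ballI Pi_I)
    fix d assume d: "d \<in> free_carrier R Y"
    show "bilin_ext R g c d \<in> carrier (free_module R Z)"
      using bilin_ext_closed[OF g c d] by simp
    show "bilin_ext R g c (free_smult R a d) = a \<odot>\<^bsub>free_module R Z\<^esub> bilin_ext R g c d"
      if a: "a \<in> carrier R" for a
    proof (rule F.linear_on_eqI[OF left F.linear_on_smult_fun[OF a left] _ c])
      show "bilin_ext R g (basis R w) (free_smult R a d) =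
          a \<odot>\<^bsub>free_module R Z\<^esub> bilin_ext R g (basis R w) d" if "w \<in> Y" for w
        using linear_on_scale[OF lin[OF that] a d] a d that by (simp add: bl)
    qed (use a d in simp_all)
    fix e assume e: "e \<in> free_carrier R Y"
    show "bilin_ext R g c (free_add R d e) =
        bilin_ext R g c d \<oplus>\<^bsub>free_module R Z\<^esub> bilin_ext R g c e"
    proof (rule F.linear_on_eqI[OF left F.linear_on_add_fun[OF left left] _ c])
      show "bilin_ext R g (basis R w) (free_add R d e) =
          bilin_ext R g (basis R w) d \<oplus>\<^bsub>free_module R Z\<^esub> bilin_ext R g (basis R w) e"
        if "w \<in> Y" for w
        using linear_on_plus[OF lin[OF that] d e] d e that by (simp add: bl)
    qed (use d e in simp_all)
  qed
qed

lemma bilin_ext_basis: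
  assumes "g w w' \<in> free_carrier R Z"
  shows "bilin_ext R g (basis R w) (basis R w') = g w w'"
  unfolding bilin_ext_def using assms
  by (simp add: lin_ext_basis[of "g w" w' Z] lin_ext_basis[of _ w Z])

lemma linear_on_id: "linear_on R Y (free_module R UNIV) (\<lambda>c. c)"
  by (auto simp: linear_on_def intro: free_carrier_mono)

end

lemma (in module) bilinear_eqI:
  assumes "\<And>y. y \<in> free_carrier R Z \<Longrightarrow> linear_on R Y M (\<lambda>x. f x y)"
    and "\<And>y. y \<in> free_carrier R Z \<Longrightarrow> linear_on R Y M (\<lambda>x. g x y)"
    and "\<And>x. x \<in> free_carrier R Y \<Longrightarrow> linear_on R Z M (f x)"
    and "\<And>x. x \<in> free_carrier R Y \<Longrightarrow> linear_on R Z M (g x)"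
    and eq: "\<And>v w. v \<in> Y \<Longrightarrow> w \<in> Z \<Longrightarrow> f (basis R v) (basis R w) = g (basis R v) (basis R w)"
    and x: "x \<in> free_carrier R Y" and y: "y \<in> free_carrier R Z"
  shows "f x y = g x y"
proof (rule linear_on_eqI[OF assms(1)[OF y] assms(2)[OF y] _ x])
  fix v assume "v \<in> Y"
  then show "f (basis R v) y = g (basis R v) y"
    by (intro linear_on_eqI[OF assms(3,4) eq y]) auto
qed

lemma (in module) trilinear_eqI:
  assumes "\<And>y z. y \<in> free_carrier R Z \<Longrightarrow> z \<in> free_carrier R V \<Longrightarrow> linear_on R Y M (\<lambda>x. f x y z)"
    and "\<And>y z. y \<in> free_carrier R Z \<Longrightarrow> z \<in> free_carrier R V \<Longrightarrow> linear_on R Y M (\<lambda>x. g x y z)"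
    and "\<And>x z. x \<in> free_carrier R Y \<Longrightarrow> z \<in> free_carrier R V \<Longrightarrow> linear_on R Z M (\<lambda>y. f x y z)"
    and "\<And>x z. x \<in> free_carrier R Y \<Longrightarrow> z \<in> free_carrier R V \<Longrightarrow> linear_on R Z M (\<lambda>y. g x y z)"
    and "\<And>x y. x \<in> free_carrier R Y \<Longrightarrow> y \<in> free_carrier R Z \<Longrightarrow> linear_on R V M (f x y)"
    and "\<And>x y. x \<in> free_carrier R Y \<Longrightarrow> y \<in> free_carrier R Z \<Longrightarrow> linear_on R V M (g x y)"
    and eq: "\<And>u v w. \<lbrakk>u \<in> Y; v \<in> Z; w \<in> V\<rbrakk>
      \<Longrightarrow> f (basis R u) (basis R v) (basis R w) = g (basis R u) (basis R v) (basis R w)"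
    and x: "x \<in> free_carrier R Y" and y: "y \<in> free_carrier R Z" and z: "z \<in> free_carrier R V"
  shows "f x y z = g x y z"
proof (rule linear_on_eqI[OF assms(1)[OF y z] assms(2)[OF y z] _ x])
  fix v assume v: "v \<in> Y"
  then have bv: "basis R v \<in> free_carrier R Y" by simp
  show "f (basis R v) y z = g (basis R v) y z"
    by (rule bilinear_eqI[where f = "f (basis R v)" and g = "g (basis R v)" and Y = Z and Z = V,
          OF assms(3)[OF bv] assms(4)[OF bv] assms(5)[OF bv] assms(6)[OF bv] eq[OF v] y z])
qed

section \<open>The product of words\<close>

text \<open>
  Induction along the recursion that defines the product, for properties that do not mention the
  coefficient ring and the weight as arguments.
\<close>

lemma diamond_induct [case_names words var_left var_right brackets]:
  fixes P :: "'x bword \<Rightarrow> 'x bword \<Rightarrow> bool" and Q :: "'x letter \<Rightarrow> 'x letter \<Rightarrow> bool"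
  assumes "\<And>W W'. (W \<noteq> [] \<Longrightarrow> W' \<noteq> [] \<Longrightarrow> Q (last W) (hd W')) \<Longrightarrow> P W W'"
    and "\<And>x a. Q (Var x) a"
    and "\<And>U x. Q (Br U) (Var x)"
    and "\<And>U V. \<lbrakk>P U [Br V]; P [Br U] V; P U V\<rbrakk> \<Longrightarrow> Q (Br U) (Br V)"
  shows "P W W'" and "Q a b"
proof -
  \<comment> \<open>The recursion on words is the same over every ring, so any ring can be put in.\<close>
  let ?P = "\<lambda>(_ :: (unit, unit) ring_scheme) (_ :: unit). P"
  let ?Q = "\<lambda>(_ :: (unit, unit) ring_scheme) (_ :: unit). Q"
  note induct = diamond_w_basis_diamond_w_letter.induct[where P = ?P and Q = ?Q]
  show "P W W'"
    by (rule induct(1), rule assms(1), simp, rule assms(2), rule assms(3), rule assms(4))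
  show "Q a b"
    by (rule induct(2), rule assms(1), simp, rule assms(2), rule assms(3), rule assms(4))
qed

lemma word_rb_simps [simp]:
  "carrier (word_rb R lam Y) = free_carrier R Y"
  "zero (word_rb R lam Y) = free_zero R"
  "add (word_rb R lam Y) = free_add R"
  "smult (word_rb R lam Y) = free_smult R"
  "one (word_rb R lam Y) = basis R []"
  by (simp_all add: word_rb_def)

lemma mult_word_rb: "mult (word_rb R lam Y) = bilin_ext R (diamond_w_basis R lam)"
  by (simp add: word_rb_def)

lemma rb_op_word_rb: "rb_op (word_rb R lam Y) = lin_ext R (\<lambda>W. basis R [Br W])"
  by (simp add: word_rb_def)

lemma diamond_w_basis_Nil [simp]:
  "diamond_w_basis R lam [] W = basis R W" "diamond_w_basis R lam W [] = basis R W"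
  by (simp_all add: diamond_w_basis.simps)

text \<open>
  A condition on words that makes their span closed under the product. A product of two letters
  lands between the remaining letters of the two factors, so closure is asked for words in that
  context.
\<close>

definition mult_stable :: "'x bword set \<Rightarrow> bool" where
  "mult_stable Y \<longleftrightarrow>
     (\<forall>u v a b. u @ [a] \<in> Y \<longrightarrow> b # v \<in> Y \<longrightarrow> (\<nexists>U V. a = Br U \<and> b = Br V) \<longrightarrow> u @ a # b # v \<in> Y) \<and>
     (\<forall>u v U V. u @ [Br U] \<in> Y \<longrightarrow> Br V # v \<in> Y \<longrightarrow>
        U \<in> Y \<and> V \<in> Y \<and> [Br U] \<in> Y \<and> [Br V] \<in> Y \<and> (\<forall>Z\<in>Y. u @ Br Z # v \<in> Y))"

lemma mult_stable_letters:
  "\<lbrakk>mult_stable Y; u @ [a] \<in> Y; b # v \<in> Y; \<nexists>U V. a = Br U \<and> b = Br V\<rbrakk> \<Longrightarrow> u @ a # b # v \<in> Y"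
  unfolding mult_stable_def by blast

lemma mult_stable_brackets:
  "\<lbrakk>mult_stable Y; u @ [Br U] \<in> Y; Br V # v \<in> Y\<rbrakk>
    \<Longrightarrow> U \<in> Y \<and> V \<in> Y \<and> [Br U] \<in> Y \<and> [Br V] \<in> Y \<and> (\<forall>Z\<in>Y. u @ Br Z # v \<in> Y)"
  unfolding mult_stable_def by blast

lemma mult_stable_UNIV [simp]: "mult_stable UNIV"
  by (simp add: mult_stable_def)

locale rb_weight = cring R for R :: "('k, 'c) ring_scheme" (structure) +
  fixes lam :: 'k
  assumes lam_closed [simp]: "lam \<in> carrier R"
begin

text \<open>
  For single letters the induction needs the stronger statement about the letters in
  context: \<open>[a]\<close>, \<open>[b]\<close> and the words in their product need not lie in \<open>Y\<close> by themselves.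
\<close>

lemma diamond_closed_aux:
  assumes st: "mult_stable Y"
  shows "\<lbrakk>W \<in> Y; W' \<in> Y\<rbrakk> \<Longrightarrow> diamond_w_basis R lam W W' \<in> free_carrier R Y"
    and "\<lbrakk>u @ [a] \<in> Y; b # v \<in> Y\<rbrakk> \<Longrightarrow> diamond_w_letter R lam a b \<in> free_carrier R {Z. u @ Z @ v \<in> Y}"
proof (induction W W' and a b arbitrary: and u v rule: diamond_induct)
  case (words W W')
  show ?case
  proof (cases "W = [] \<or> W' = []")
    case False
    then have "diamond_w_letter R lam (last W) (hd W') \<in>
        free_carrier R {Z. butlast W @ Z @ tl W' \<in> Y}"
      using words by auto
    then have "lin_ext R (\<lambda>Z. basis R (butlast W @ Z @ tl W')) (diamond_w_letter R lam (last W) (hd W'))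
        \<in> free_carrier R Y"
      by (rule lin_ext_closed[rotated]) auto
    then show ?thesis using False by (simp add: diamond_w_basis.simps)
  qed (use words in auto)
next
  case (var_left x a)
  then have "u @ Var x # a # v \<in> Y" using mult_stable_letters[OF st] by blast
  then show ?case by simp
next
  case (var_right U x)
  then have "u @ Br U # Var x # v \<in> Y" using mult_stable_letters[OF st] by blast
  then show ?case by simp
next
  case (brackets U V)
  then have Y: "U \<in> Y" "V \<in> Y" "[Br U] \<in> Y" "[Br V] \<in> Y" "\<And>Z. Z \<in> Y \<Longrightarrow> u @ Br Z # v \<in> Y"
    using mult_stable_brackets[OF st brackets.prems] by blast+
  then have "lin_ext R (\<lambda>Z. basis R [Br Z]) c \<in> free_carrier R {Z. u @ Z @ v \<in> Y}"
    if "c \<in> free_carrier R Y" for c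
    using that by (intro lin_ext_closed[of Y]) auto
  then show ?case using brackets.IH Y by simp
qed

lemmas diamond_closed = diamond_closed_aux(1)

lemma diamond_closed_UNIV [simp]: "diamond_w_basis R lam W W' \<in> free_carrier R UNIV"
  by (rule diamond_closed) auto

lemma diamond_letter_closed [simp]: "diamond_w_letter R lam a b \<in> free_carrier R UNIV"
  using diamond_closed_aux(2)[of UNIV "[]" a b "[]"] by simp

lemma diamond_letter_nonempty:
  fixes a b :: "'x letter"
  shows "diamond_w_letter R lam a b \<in> free_carrier R {Z. Z \<noteq> []}"
proof (cases a; cases b)
  fix U V assume *: "a = Br U" "b = Br V"
  have "lin_ext R (\<lambda>Z. basis R [Br Z]) c \<in> free_carrier R {Z. Z \<noteq> []}"
    if "c \<in> free_carrier R UNIV" for c :: "'x bword \<Rightarrow> 'k"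
    using that by (intro lin_ext_closed[of UNIV]) auto
  then show ?thesis by (simp add: *)
qed auto

text \<open>
  The algebra on all words. The algebras of the theorem are the restrictions of its operations to
  the spans of smaller sets of words.
\<close>

abbreviation A :: "('k, 'x bword \<Rightarrow> 'k) rb_structure" where
  "A \<equiv> word_rb R lam UNIV"

lemma module_A [simp]: "module R A"
  by (rule module_freeI) simp_all

definition conc :: "('x bword \<Rightarrow> 'k) \<Rightarrow> ('x bword \<Rightarrow> 'k) \<Rightarrow> 'x bword \<Rightarrow> 'k" (infixl \<open>\<bullet>\<close> 70) where
  "conc = bilin_ext R (\<lambda>W W'. basis R (W @ W'))"

lemma conc_basis: "basis R W \<bullet> basis R W' = basis R (W @ W')"
  unfolding conc_def by (rule bilin_ext_basis[of _ _ _ UNIV]) simp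

lemma conc_closed [simp]:
  "\<lbrakk>x \<in> free_carrier R UNIV; y \<in> free_carrier R UNIV\<rbrakk> \<Longrightarrow> x \<bullet> y \<in> free_carrier R UNIV"
  unfolding conc_def by (rule bilin_ext_closed) simp_all

lemma mult_basis: "basis R W \<otimes>\<^bsub>A\<^esub> basis R W' = diamond_w_basis R lam W W'"
  unfolding mult_word_rb by (rule bilin_ext_basis[of _ _ _ UNIV]) simp

lemma mult_A_closed [simp]:
  "\<lbrakk>x \<in> free_carrier R UNIV; y \<in> free_carrier R UNIV\<rbrakk> \<Longrightarrow> x \<otimes>\<^bsub>A\<^esub> y \<in> free_carrier R UNIV"
  unfolding mult_word_rb by (rule bilin_ext_closed) simp_all

lemma rb_op_basis: "rb_op A (basis R W) = basis R [Br W]"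
  unfolding rb_op_word_rb by (rule lin_ext_basis[of _ _ UNIV]) simp

lemma rb_op_A_closed [simp]: "x \<in> free_carrier R UNIV \<Longrightarrow> rb_op A x \<in> free_carrier R UNIV"
  unfolding rb_op_word_rb by (rule lin_ext_closed[of UNIV]) simp_all

lemma linear_on_id_A: "linear_on R Y A (\<lambda>c. c)"
  using linear_on_id by (simp add: linear_on_def)

lemma linear_on_comp_A: "linear_on R Y A f \<Longrightarrow> linear_on R UNIV (free_module R UNIV) g
    \<Longrightarrow> linear_on R Y A (\<lambda>c. g (f c))"
  by (auto simp: linear_on_def Pi_iff)

lemma linear_on_mult_left:
  "linear_on R Y A f \<Longrightarrow> y \<in> free_carrier R UNIV \<Longrightarrow> linear_on R Y A (\<lambda>c. f c \<otimes>\<^bsub>A\<^esub> y)"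
  unfolding mult_word_rb
  by (rule linear_on_comp_A[where g = "\<lambda>c. bilin_ext R (diamond_w_basis R lam) c y"])
    (auto intro: linear_on_bilin_left)

lemma linear_on_mult_right:
  "x \<in> free_carrier R UNIV \<Longrightarrow> linear_on R Y A f \<Longrightarrow> linear_on R Y A (\<lambda>c. x \<otimes>\<^bsub>A\<^esub> f c)"
  unfolding mult_word_rb
  by (rule linear_on_comp_A[where g = "\<lambda>c. bilin_ext R (diamond_w_basis R lam) x c"])
    (auto intro: linear_on_bilin_right)

lemma linear_on_conc_left:
  "linear_on R Y A f \<Longrightarrow> y \<in> free_carrier R UNIV \<Longrightarrow> linear_on R Y A (\<lambda>c. f c \<bullet> y)"
  unfolding conc_def
  by (rule linear_on_comp_A[where g = "\<lambda>c. bilin_ext R (\<lambda>W W'. basis R (W @ W')) c y"])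
    (auto intro: linear_on_bilin_left)

lemma linear_on_conc_right:
  "x \<in> free_carrier R UNIV \<Longrightarrow> linear_on R Y A f \<Longrightarrow> linear_on R Y A (\<lambda>c. x \<bullet> f c)"
  unfolding conc_def
  by (rule linear_on_comp_A[where g = "\<lambda>c. bilin_ext R (\<lambda>W W'. basis R (W @ W')) x c"])
    (auto intro: linear_on_bilin_right)

lemma linear_on_rb_op: "linear_on R Y A f \<Longrightarrow> linear_on R Y A (\<lambda>c. rb_op A (f c))"
  unfolding rb_op_word_rb
  by (rule linear_on_comp_A[where g = "lin_ext R (\<lambda>W. basis R [Br W])"])
    (auto intro: linear_on_lin_ext)

lemmas linear_on_add_A = module.linear_on_add_fun[OF module_A]
lemmas linear_on_smult_A = module.linear_on_smult_fun[OF module_A]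

lemmas linear_on_intros = linear_on_id_A linear_on_mult_left linear_on_mult_right
  linear_on_conc_left linear_on_conc_right linear_on_rb_op
  linear_on_add_A[unfolded word_rb_simps] linear_on_smult_A[unfolded word_rb_simps]

lemma free_carrier_UNIV_I [simp]: "x \<in> free_carrier R Y \<Longrightarrow> x \<in> free_carrier R UNIV"
  by (rule free_carrier_mono) auto

lemma conc_assoc:
  assumes "x \<in> free_carrier R UNIV" "y \<in> free_carrier R UNIV" "z \<in> free_carrier R UNIV"
  shows "x \<bullet> y \<bullet> z = x \<bullet> (y \<bullet> z)"
  by (rule module.trilinear_eqI[OF module_A, where f = "\<lambda>x y z. x \<bullet> y \<bullet> z"
        and g = "\<lambda>x y z. x \<bullet> (y \<bullet> z)", OF _ _ _ _ _ _ _ assms])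
    (auto intro!: linear_on_intros simp: conc_basis)

lemma conc_one [simp]:
  assumes "x \<in> free_carrier R UNIV"
  shows "basis R [] \<bullet> x = x" "x \<bullet> basis R [] = x"
  by (rule module.linear_on_eqI[OF module_A _ _ _ assms];
      auto intro!: linear_on_intros simp: conc_basis)+

lemma lin_ext_context:
  assumes "c \<in> free_carrier R UNIV"
  shows "lin_ext R (\<lambda>Z. basis R (u @ Z @ v)) c = basis R u \<bullet> c \<bullet> basis R v"
proof (rule module.linear_on_eqI[OF module_A _ _ _ assms])
  show "linear_on R UNIV A (lin_ext R (\<lambda>Z. basis R (u @ Z @ v)))"
    by (rule linear_on_comp_A[OF linear_on_id_A linear_on_lin_ext]) auto
qed (auto intro!: linear_on_intros simp: conc_basis lin_ext_basis[of _ _ UNIV])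

lemma diamond_conc:
  assumes "W \<noteq> []" "W' \<noteq> []"
  shows "diamond_w_basis R lam W W' =
    basis R (butlast W) \<bullet> diamond_w_letter R lam (last W) (hd W') \<bullet> basis R (tl W')"
  using assms by (simp add: diamond_w_basis.simps lin_ext_context)

lemma mult_letters: "basis R [a] \<otimes>\<^bsub>A\<^esub> basis R [b] = diamond_w_letter R lam a b"
  by (simp add: mult_basis diamond_conc)

lemma mult_one_A [simp]:
  assumes "x \<in> free_carrier R UNIV"
  shows "basis R [] \<otimes>\<^bsub>A\<^esub> x = x" "x \<otimes>\<^bsub>A\<^esub> basis R [] = x"
  by (rule module.linear_on_eqI[OF module_A _ _ _ assms];
      auto intro!: linear_on_intros simp: mult_basis)+

text \<open>
  Multiplication from the left only touches the first letter of the right factor, which belongs to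
  \<open>y\<close> because \<open>y\<close> involves nonempty words only; dually below.
\<close>

lemma mult_conc_right:
  fixes x y z :: "'x bword \<Rightarrow> 'k"
  assumes "x \<in> free_carrier R UNIV" "y \<in> free_carrier R {W. W \<noteq> []}" "z \<in> free_carrier R UNIV"
  shows "x \<otimes>\<^bsub>A\<^esub> (y \<bullet> z) = x \<otimes>\<^bsub>A\<^esub> y \<bullet> z"
proof (rule module.trilinear_eqI[OF module_A, where f = "\<lambda>x y z. x \<otimes>\<^bsub>A\<^esub> (y \<bullet> z)"
        and g = "\<lambda>x y z. x \<otimes>\<^bsub>A\<^esub> y \<bullet> z", OF _ _ _ _ _ _ _ assms])
  fix U V W :: "'x bword"
  assume "V \<in> {W. W \<noteq> []}"
  then show "basis R U \<otimes>\<^bsub>A\<^esub> (basis R V \<bullet> basis R W) = basis R U \<otimes>\<^bsub>A\<^esub> basis R V \<bullet> basis R W"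
    by (cases "U = []") (auto simp: conc_basis mult_basis diamond_conc conc_assoc)
qed (auto intro!: linear_on_intros)

lemma mult_conc_left:
  fixes x y z :: "'x bword \<Rightarrow> 'k"
  assumes "z \<in> free_carrier R UNIV" "y \<in> free_carrier R {W. W \<noteq> []}" "x \<in> free_carrier R UNIV"
  shows "(z \<bullet> y) \<otimes>\<^bsub>A\<^esub> x = z \<bullet> (y \<otimes>\<^bsub>A\<^esub> x)"
proof (rule module.trilinear_eqI[OF module_A, where f = "\<lambda>z y x. (z \<bullet> y) \<otimes>\<^bsub>A\<^esub> x"
        and g = "\<lambda>z y x. z \<bullet> (y \<otimes>\<^bsub>A\<^esub> x)", OF _ _ _ _ _ _ _ assms])
  fix U V W :: "'x bword"
  assume "V \<in> {W. W \<noteq> []}"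
  then show "(basis R U \<bullet> basis R V) \<otimes>\<^bsub>A\<^esub> basis R W = basis R U \<bullet> (basis R V \<otimes>\<^bsub>A\<^esub> basis R W)"
    by (cases "W = []")
      (auto simp: conc_basis mult_basis diamond_conc conc_assoc[symmetric] butlast_append)
qed (auto intro!: linear_on_intros)

lemma mult_var:
  fixes y :: "'x bword \<Rightarrow> 'k"
  assumes "y \<in> free_carrier R UNIV"
  shows "basis R [Var x] \<otimes>\<^bsub>A\<^esub> y = basis R [Var x] \<bullet> y"
    and "y \<otimes>\<^bsub>A\<^esub> basis R [Var x] = y \<bullet> basis R [Var x]"
proof -
  show "basis R [Var x] \<otimes>\<^bsub>A\<^esub> y = basis R [Var x] \<bullet> y"
  proof (rule module.linear_on_eqI[OF module_A _ _ _ assms])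
    fix W :: "'x bword"
    show "basis R [Var x] \<otimes>\<^bsub>A\<^esub> basis R W = basis R [Var x] \<bullet> basis R W"
      by (cases "W = []") (auto simp: mult_basis diamond_conc conc_basis)
  qed (auto intro!: linear_on_intros)
  show "y \<otimes>\<^bsub>A\<^esub> basis R [Var x] = y \<bullet> basis R [Var x]"
  proof (rule module.linear_on_eqI[OF module_A _ _ _ assms])
    fix W :: "'x bword"
    have "diamond_w_letter R lam a (Var x) = basis R [a, Var x]" for a
      by (cases a) auto
    then show "basis R W \<otimes>\<^bsub>A\<^esub> basis R [Var x] = basis R W \<bullet> basis R [Var x]"
      by (cases W rule: rev_cases) (auto simp: mult_basis diamond_conc conc_basis)
  qed (auto intro!: linear_on_intros)
qed

lemma rota_baxter_A:
  fixes x y :: "'x bword \<Rightarrow> 'k"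
  assumes "x \<in> free_carrier R UNIV" "y \<in> free_carrier R UNIV"
  shows "rb_op A x \<otimes>\<^bsub>A\<^esub> rb_op A y =
     rb_op A (x \<otimes>\<^bsub>A\<^esub> rb_op A y) \<oplus>\<^bsub>A\<^esub> rb_op A (rb_op A x \<otimes>\<^bsub>A\<^esub> y)
       \<oplus>\<^bsub>A\<^esub> lam \<odot>\<^bsub>A\<^esub> rb_op A (x \<otimes>\<^bsub>A\<^esub> y)"
proof (rule module.bilinear_eqI[OF module_A, where f = "\<lambda>x y. rb_op A x \<otimes>\<^bsub>A\<^esub> rb_op A y"
    and g = "\<lambda>x y. rb_op A (x \<otimes>\<^bsub>A\<^esub> rb_op A y) \<oplus>\<^bsub>A\<^esub> rb_op A (rb_op A x \<otimes>\<^bsub>A\<^esub> y)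
       \<oplus>\<^bsub>A\<^esub> lam \<odot>\<^bsub>A\<^esub> rb_op A (x \<otimes>\<^bsub>A\<^esub> y)", OF _ _ _ _ _ assms])
  fix U V :: "'x bword"
  show "rb_op A (basis R U) \<otimes>\<^bsub>A\<^esub> rb_op A (basis R V) =
     rb_op A (basis R U \<otimes>\<^bsub>A\<^esub> rb_op A (basis R V)) \<oplus>\<^bsub>A\<^esub> rb_op A (rb_op A (basis R U) \<otimes>\<^bsub>A\<^esub> basis R V)
       \<oplus>\<^bsub>A\<^esub> lam \<odot>\<^bsub>A\<^esub> rb_op A (basis R U \<otimes>\<^bsub>A\<^esub> basis R V)"
    by (simp add: rb_op_basis mult_letters) (simp add: rb_op_word_rb mult_basis)
qed (auto intro!: linear_on_intros)

lemma mult_nonempty: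
  fixes x y :: "'x bword \<Rightarrow> 'k"
  assumes "x \<in> free_carrier R {W. W \<noteq> []}" "y \<in> free_carrier R {W. W \<noteq> []}"
  shows "x \<otimes>\<^bsub>A\<^esub> y \<in> free_carrier R {W. W \<noteq> []}"
  unfolding mult_word_rb
proof (rule bilin_ext_closed[OF _ assms])
  fix W W' :: "'x bword"
  assume *: "W \<in> {W. W \<noteq> []}" "W' \<in> {W. W \<noteq> []}"
  have "lin_ext R (\<lambda>Z. basis R (butlast W @ Z @ tl W')) (diamond_w_letter R lam (last W) (hd W'))
      \<in> free_carrier R {W. W \<noteq> []}"
    by (rule lin_ext_closed[OF _ diamond_letter_nonempty]) auto
  then show "diamond_w_basis R lam W W' \<in> free_carrier R {W. W \<noteq> []}"
    using * by (simp add: diamond_w_basis.simps)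
qed

subsection \<open>Associativity\<close>

text \<open>
  The left product changes the beginning of the middle word and the right product its end; when
  these are different letters the two operations do not interfere.
\<close>

lemma assoc_split_middle:
  assumes "x \<in> free_carrier R UNIV" "y \<in> free_carrier R UNIV" "b \<noteq> []" "b' \<noteq> []"
  shows "x \<otimes>\<^bsub>A\<^esub> basis R (b @ b') \<otimes>\<^bsub>A\<^esub> y = x \<otimes>\<^bsub>A\<^esub> (basis R (b @ b') \<otimes>\<^bsub>A\<^esub> y)"
  using assms by (simp add: mult_conc_left mult_conc_right flip: conc_basis)

text \<open>
  The letters before \<open>a\<close> and after \<open>c\<close> are only carried along.
\<close>

lemma assoc_letters:
  assumes "basis R [a] \<otimes>\<^bsub>A\<^esub> basis R [b] \<otimes>\<^bsub>A\<^esub> basis R [c] =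
    basis R [a] \<otimes>\<^bsub>A\<^esub> (basis R [b] \<otimes>\<^bsub>A\<^esub> basis R [c])"
  shows "basis R (u @ [a]) \<otimes>\<^bsub>A\<^esub> basis R [b] \<otimes>\<^bsub>A\<^esub> basis R (c # v) =
    basis R (u @ [a]) \<otimes>\<^bsub>A\<^esub> (basis R [b] \<otimes>\<^bsub>A\<^esub> basis R (c # v))"
proof -
  have ab: "basis R [a] \<otimes>\<^bsub>A\<^esub> basis R [b] \<in> free_carrier R {W. W \<noteq> []}"
    and bc: "basis R [b] \<otimes>\<^bsub>A\<^esub> basis R [c] \<in> free_carrier R {W. W \<noteq> []}"
    by (auto intro!: mult_nonempty)
  have u: "basis R (u @ [a]) = basis R u \<bullet> basis R [a]"
    and v: "basis R (c # v) = basis R [c] \<bullet> basis R v"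
    by (simp_all add: conc_basis)
  show ?thesis
    using ab bc by (simp add: u v mult_conc_left mult_conc_right assms conc_assoc)
qed

lemma assoc_var_left:
  assumes "y \<in> free_carrier R {W. W \<noteq> []}" "z \<in> free_carrier R UNIV"
  shows "basis R [Var v] \<otimes>\<^bsub>A\<^esub> y \<otimes>\<^bsub>A\<^esub> z = basis R [Var v] \<otimes>\<^bsub>A\<^esub> (y \<otimes>\<^bsub>A\<^esub> z)"
  using assms by (simp add: mult_var mult_conc_left)

lemma assoc_var_middle:
  assumes "x \<in> free_carrier R {W. W \<noteq> []}" "z \<in> free_carrier R {W. W \<noteq> []}"
  shows "x \<otimes>\<^bsub>A\<^esub> basis R [Var v] \<otimes>\<^bsub>A\<^esub> z = x \<otimes>\<^bsub>A\<^esub> (basis R [Var v] \<otimes>\<^bsub>A\<^esub> z)"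
  using assms by (simp add: mult_var mult_conc_left mult_conc_right conc_assoc)

lemma assoc_var_right:
  assumes "x \<in> free_carrier R UNIV" "y \<in> free_carrier R {W. W \<noteq> []}"
  shows "x \<otimes>\<^bsub>A\<^esub> y \<otimes>\<^bsub>A\<^esub> basis R [Var v] = x \<otimes>\<^bsub>A\<^esub> (y \<otimes>\<^bsub>A\<^esub> basis R [Var v])"
  using assms by (simp add: mult_var mult_conc_right)

end

text \<open>
  The additive bookkeeping of \<open>assoc_rb_op\<close>, where the terms stand for
  \<open>P (P a w)\<close> (named \<open>X\<close>), \<open>P (u P b)\<close> (named \<open>Y\<close>), \<open>P (u b)\<close> (named \<open>B\<close>) and \<open>P (P u b)\<close>
  (named \<open>C\<close>). The missing \<open>C2\<close> equals the sum of the \<open>X\<close>.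
\<close>

lemma (in module) rb_rearrange:
  assumes "l \<in> carrier R"
    "X1 \<in> carrier M" "X2 \<in> carrier M" "X3 \<in> carrier M"
    "Y1 \<in> carrier M" "Y2 \<in> carrier M" "Y3 \<in> carrier M"
    "B1 \<in> carrier M" "B2 \<in> carrier M" "B3 \<in> carrier M"
    "C1 \<in> carrier M" "C3 \<in> carrier M"
  shows "(Y1 \<oplus>\<^bsub>M\<^esub> Y2 \<oplus>\<^bsub>M\<^esub> l \<odot>\<^bsub>M\<^esub> Y3 \<oplus>\<^bsub>M\<^esub> X1 \<oplus>\<^bsub>M\<^esub> l \<odot>\<^bsub>M\<^esub> B2) \<oplus>\<^bsub>M\<^esub> (C1 \<oplus>\<^bsub>M\<^esub> X2 \<oplus>\<^bsub>M\<^esub> l \<odot>\<^bsub>M\<^esub> C3)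
      \<oplus>\<^bsub>M\<^esub> l \<odot>\<^bsub>M\<^esub> (B1 \<oplus>\<^bsub>M\<^esub> X3 \<oplus>\<^bsub>M\<^esub> l \<odot>\<^bsub>M\<^esub> B3) =
    (Y1 \<oplus>\<^bsub>M\<^esub> C1 \<oplus>\<^bsub>M\<^esub> l \<odot>\<^bsub>M\<^esub> B1) \<oplus>\<^bsub>M\<^esub> (Y2 \<oplus>\<^bsub>M\<^esub> (X1 \<oplus>\<^bsub>M\<^esub> X2 \<oplus>\<^bsub>M\<^esub> l \<odot>\<^bsub>M\<^esub> X3) \<oplus>\<^bsub>M\<^esub> l \<odot>\<^bsub>M\<^esub> B2)
      \<oplus>\<^bsub>M\<^esub> l \<odot>\<^bsub>M\<^esub> (Y3 \<oplus>\<^bsub>M\<^esub> C3 \<oplus>\<^bsub>M\<^esub> l \<odot>\<^bsub>M\<^esub> B3)"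
  using assms by (simp add: smult_r_distr M.a_ac)

context rb_weight
begin

lemma rb_op_add_A:
  "\<lbrakk>x \<in> free_carrier R UNIV; y \<in> free_carrier R UNIV\<rbrakk>
    \<Longrightarrow> rb_op A (x \<oplus>\<^bsub>A\<^esub> y) = rb_op A x \<oplus>\<^bsub>A\<^esub> rb_op A y"
  using linear_on_plus[OF linear_on_rb_op[OF linear_on_id_A], of x UNIV y] by simp

lemma rb_op_smult_A:
  "\<lbrakk>a \<in> carrier R; x \<in> free_carrier R UNIV\<rbrakk>
    \<Longrightarrow> rb_op A (a \<odot>\<^bsub>A\<^esub> x) = a \<odot>\<^bsub>A\<^esub> rb_op A x"
  using linear_on_scale[OF linear_on_rb_op[OF linear_on_id_A], of a x UNIV] by simp

lemma mult_add_A: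
  assumes "x \<in> free_carrier R UNIV" "y \<in> free_carrier R UNIV" "z \<in> free_carrier R UNIV"
  shows "(x \<oplus>\<^bsub>A\<^esub> y) \<otimes>\<^bsub>A\<^esub> z = x \<otimes>\<^bsub>A\<^esub> z \<oplus>\<^bsub>A\<^esub> y \<otimes>\<^bsub>A\<^esub> z"
    and "z \<otimes>\<^bsub>A\<^esub> (x \<oplus>\<^bsub>A\<^esub> y) = z \<otimes>\<^bsub>A\<^esub> x \<oplus>\<^bsub>A\<^esub> z \<otimes>\<^bsub>A\<^esub> y"
  using linear_on_plus[OF linear_on_mult_left[OF linear_on_id_A assms(3)], of x UNIV y]
    linear_on_plus[OF linear_on_mult_right[OF assms(3) linear_on_id_A], of x UNIV y] assms
  by simp_all

lemma mult_smult_A: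
  assumes "a \<in> carrier R" "x \<in> free_carrier R UNIV" "y \<in> free_carrier R UNIV"
  shows "(a \<odot>\<^bsub>A\<^esub> x) \<otimes>\<^bsub>A\<^esub> y = a \<odot>\<^bsub>A\<^esub> (x \<otimes>\<^bsub>A\<^esub> y)"
    and "y \<otimes>\<^bsub>A\<^esub> (a \<odot>\<^bsub>A\<^esub> x) = a \<odot>\<^bsub>A\<^esub> (y \<otimes>\<^bsub>A\<^esub> x)"
  using linear_on_scale[OF linear_on_mult_left[OF linear_on_id_A assms(3)], of a x UNIV]
    linear_on_scale[OF linear_on_mult_right[OF assms(3) linear_on_id_A], of a x UNIV] assms
  by simp_all

lemma add_smult_A_closed:
  "\<lbrakk>x \<in> free_carrier R UNIV; y \<in> free_carrier R UNIV\<rbrakk> \<Longrightarrow> x \<oplus>\<^bsub>A\<^esub> y \<in> free_carrier R UNIV"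
  "\<lbrakk>a \<in> carrier R; x \<in> free_carrier R UNIV\<rbrakk> \<Longrightarrow> a \<odot>\<^bsub>A\<^esub> x \<in> free_carrier R UNIV"
  by simp_all

text \<open>
  Expanding \<open>P u P v\<close> and then the product with \<open>P w\<close> gives terms \<open>P (a P w)\<close>, \<open>P (P a w)\<close> and
  \<open>P (a w)\<close> with \<open>a\<close> one of \<open>u P v\<close>, \<open>P u v\<close>, \<open>u v\<close>; the other side gives terms \<open>P (u P b)\<close>,
  \<open>P (P u b)\<close> and \<open>P (u b)\<close> with \<open>b\<close> one of \<open>v P w\<close>, \<open>P v w\<close>, \<open>v w\<close>. Five of the hypotheses match
  single terms. The other two, \<open>h1\<close> and \<open>h4\<close>, have \<open>P v P w\<close> or \<open>P u P v\<close> as a factor, and each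
  matches one term of one side with three terms of the other.
\<close>

lemma assoc_rb_op:
  fixes u v w :: "'x bword \<Rightarrow> 'k"
  defines "P \<equiv> rb_op A"
  assumes u: "u \<in> free_carrier R UNIV" and v: "v \<in> free_carrier R UNIV"
    and w: "w \<in> free_carrier R UNIV"
    and h1: "(u \<otimes>\<^bsub>A\<^esub> P v) \<otimes>\<^bsub>A\<^esub> P w = u \<otimes>\<^bsub>A\<^esub> (P v \<otimes>\<^bsub>A\<^esub> P w)"
    and h2: "(P u \<otimes>\<^bsub>A\<^esub> v) \<otimes>\<^bsub>A\<^esub> P w = P u \<otimes>\<^bsub>A\<^esub> (v \<otimes>\<^bsub>A\<^esub> P w)"
    and h3: "(u \<otimes>\<^bsub>A\<^esub> v) \<otimes>\<^bsub>A\<^esub> P w = u \<otimes>\<^bsub>A\<^esub> (v \<otimes>\<^bsub>A\<^esub> P w)"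
    and h4: "(P u \<otimes>\<^bsub>A\<^esub> P v) \<otimes>\<^bsub>A\<^esub> w = P u \<otimes>\<^bsub>A\<^esub> (P v \<otimes>\<^bsub>A\<^esub> w)"
    and h5: "(u \<otimes>\<^bsub>A\<^esub> P v) \<otimes>\<^bsub>A\<^esub> w = u \<otimes>\<^bsub>A\<^esub> (P v \<otimes>\<^bsub>A\<^esub> w)"
    and h6: "(P u \<otimes>\<^bsub>A\<^esub> v) \<otimes>\<^bsub>A\<^esub> w = P u \<otimes>\<^bsub>A\<^esub> (v \<otimes>\<^bsub>A\<^esub> w)"
    and h7: "(u \<otimes>\<^bsub>A\<^esub> v) \<otimes>\<^bsub>A\<^esub> w = u \<otimes>\<^bsub>A\<^esub> (v \<otimes>\<^bsub>A\<^esub> w)"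
  shows "(P u \<otimes>\<^bsub>A\<^esub> P v) \<otimes>\<^bsub>A\<^esub> P w = P u \<otimes>\<^bsub>A\<^esub> (P v \<otimes>\<^bsub>A\<^esub> P w)"
proof -
  interpret A: module R "A :: ('k, 'x bword \<Rightarrow> 'k) rb_structure" by simp
  have rb: "P x \<otimes>\<^bsub>A\<^esub> P y = P (x \<otimes>\<^bsub>A\<^esub> P y) \<oplus>\<^bsub>A\<^esub> P (P x \<otimes>\<^bsub>A\<^esub> y) \<oplus>\<^bsub>A\<^esub> lam \<odot>\<^bsub>A\<^esub> P (x \<otimes>\<^bsub>A\<^esub> y)"
    if "x \<in> free_carrier R UNIV" "y \<in> free_carrier R UNIV" for x y
    unfolding P_def by (rule rota_baxter_A[OF that])
  have P_closed: "P x \<in> free_carrier R UNIV" if "x \<in> free_carrier R UNIV" for x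
    unfolding P_def using that by simp
  have P_add: "P (x \<oplus>\<^bsub>A\<^esub> y) = P x \<oplus>\<^bsub>A\<^esub> P y"
    if "x \<in> free_carrier R UNIV" "y \<in> free_carrier R UNIV" for x y
    unfolding P_def by (rule rb_op_add_A[OF that])
  have P_smult: "P (a \<odot>\<^bsub>A\<^esub> x) = a \<odot>\<^bsub>A\<^esub> P x" if "a \<in> carrier R" "x \<in> free_carrier R UNIV" for a x
    unfolding P_def by (rule rb_op_smult_A[OF that])
  note lin = P_add P_smult mult_add_A mult_smult_A
  note cl = P_closed mult_A_closed add_smult_A_closed lam_closed u v w
  define a1 a2 a3 where "a1 = u \<otimes>\<^bsub>A\<^esub> P v" "a2 = P u \<otimes>\<^bsub>A\<^esub> v" "a3 = u \<otimes>\<^bsub>A\<^esub> v"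
  define b1 b2 b3 where "b1 = v \<otimes>\<^bsub>A\<^esub> P w" "b2 = P v \<otimes>\<^bsub>A\<^esub> w" "b3 = v \<otimes>\<^bsub>A\<^esub> w"
  note ab = a1_a2_a3_def b1_b2_b3_def
  have abcl: "a1 \<in> free_carrier R UNIV" "a2 \<in> free_carrier R UNIV" "a3 \<in> free_carrier R UNIV"
    "b1 \<in> free_carrier R UNIV" "b2 \<in> free_carrier R UNIV" "b3 \<in> free_carrier R UNIV"
    unfolding ab by (simp_all only: cl)
  have uv: "P u \<otimes>\<^bsub>A\<^esub> P v = P a1 \<oplus>\<^bsub>A\<^esub> P a2 \<oplus>\<^bsub>A\<^esub> lam \<odot>\<^bsub>A\<^esub> P a3"
    unfolding ab using rb[OF u v] .
  have vw: "P v \<otimes>\<^bsub>A\<^esub> P w = P b1 \<oplus>\<^bsub>A\<^esub> P b2 \<oplus>\<^bsub>A\<^esub> lam \<odot>\<^bsub>A\<^esub> P b3"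
    unfolding ab using rb[OF v w] .
  have hyp: "a1 \<otimes>\<^bsub>A\<^esub> P w = u \<otimes>\<^bsub>A\<^esub> (P v \<otimes>\<^bsub>A\<^esub> P w)"
    "a2 \<otimes>\<^bsub>A\<^esub> P w = P u \<otimes>\<^bsub>A\<^esub> b1" "a3 \<otimes>\<^bsub>A\<^esub> P w = u \<otimes>\<^bsub>A\<^esub> b1"
    "(P u \<otimes>\<^bsub>A\<^esub> P v) \<otimes>\<^bsub>A\<^esub> w = P u \<otimes>\<^bsub>A\<^esub> b2" "a1 \<otimes>\<^bsub>A\<^esub> w = u \<otimes>\<^bsub>A\<^esub> b2"
    "a2 \<otimes>\<^bsub>A\<^esub> w = P u \<otimes>\<^bsub>A\<^esub> b3" "a3 \<otimes>\<^bsub>A\<^esub> w = u \<otimes>\<^bsub>A\<^esub> b3"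
    unfolding ab by (fact h1 h2 h3 h4 h5 h6 h7)+
  have Y: "P (a1 \<otimes>\<^bsub>A\<^esub> P w) = P (u \<otimes>\<^bsub>A\<^esub> P b1) \<oplus>\<^bsub>A\<^esub> P (u \<otimes>\<^bsub>A\<^esub> P b2) \<oplus>\<^bsub>A\<^esub> lam \<odot>\<^bsub>A\<^esub> P (u \<otimes>\<^bsub>A\<^esub> P b3)"
    unfolding hyp(1) vw by (simp only: lin cl abcl)
  have X: "P (P u \<otimes>\<^bsub>A\<^esub> b2) = P (P a1 \<otimes>\<^bsub>A\<^esub> w) \<oplus>\<^bsub>A\<^esub> P (P a2 \<otimes>\<^bsub>A\<^esub> w) \<oplus>\<^bsub>A\<^esub> lam \<odot>\<^bsub>A\<^esub> P (P a3 \<otimes>\<^bsub>A\<^esub> w)"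
    unfolding hyp(4)[symmetric] uv by (simp only: lin cl abcl)
  have "(P u \<otimes>\<^bsub>A\<^esub> P v) \<otimes>\<^bsub>A\<^esub> P w = P a1 \<otimes>\<^bsub>A\<^esub> P w \<oplus>\<^bsub>A\<^esub> P a2 \<otimes>\<^bsub>A\<^esub> P w \<oplus>\<^bsub>A\<^esub> lam \<odot>\<^bsub>A\<^esub> (P a3 \<otimes>\<^bsub>A\<^esub> P w)"
    unfolding uv by (simp only: lin cl abcl)
  also have "\<dots> = (P (a1 \<otimes>\<^bsub>A\<^esub> P w) \<oplus>\<^bsub>A\<^esub> P (P a1 \<otimes>\<^bsub>A\<^esub> w) \<oplus>\<^bsub>A\<^esub> lam \<odot>\<^bsub>A\<^esub> P (u \<otimes>\<^bsub>A\<^esub> b2)) \<oplus>\<^bsub>A\<^esub>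
      (P (P u \<otimes>\<^bsub>A\<^esub> b1) \<oplus>\<^bsub>A\<^esub> P (P a2 \<otimes>\<^bsub>A\<^esub> w) \<oplus>\<^bsub>A\<^esub> lam \<odot>\<^bsub>A\<^esub> P (P u \<otimes>\<^bsub>A\<^esub> b3)) \<oplus>\<^bsub>A\<^esub>
      lam \<odot>\<^bsub>A\<^esub> (P (u \<otimes>\<^bsub>A\<^esub> b1) \<oplus>\<^bsub>A\<^esub> P (P a3 \<otimes>\<^bsub>A\<^esub> w) \<oplus>\<^bsub>A\<^esub> lam \<odot>\<^bsub>A\<^esub> P (u \<otimes>\<^bsub>A\<^esub> b3))"
    by (simp only: rb[OF abcl(1) w] rb[OF abcl(2) w] rb[OF abcl(3) w] hyp(2,3,5-7))
  also have "\<dots> = (P (u \<otimes>\<^bsub>A\<^esub> P b1) \<oplus>\<^bsub>A\<^esub> P (P u \<otimes>\<^bsub>A\<^esub> b1) \<oplus>\<^bsub>A\<^esub> lam \<odot>\<^bsub>A\<^esub> P (u \<otimes>\<^bsub>A\<^esub> b1)) \<oplus>\<^bsub>A\<^esub>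
      (P (u \<otimes>\<^bsub>A\<^esub> P b2) \<oplus>\<^bsub>A\<^esub> P (P u \<otimes>\<^bsub>A\<^esub> b2) \<oplus>\<^bsub>A\<^esub> lam \<odot>\<^bsub>A\<^esub> P (u \<otimes>\<^bsub>A\<^esub> b2)) \<oplus>\<^bsub>A\<^esub>
      lam \<odot>\<^bsub>A\<^esub> (P (u \<otimes>\<^bsub>A\<^esub> P b3) \<oplus>\<^bsub>A\<^esub> P (P u \<otimes>\<^bsub>A\<^esub> b3) \<oplus>\<^bsub>A\<^esub> lam \<odot>\<^bsub>A\<^esub> P (u \<otimes>\<^bsub>A\<^esub> b3))"
    unfolding X Y
    by (rule A.rb_rearrange; (rule lam_closed)?; simp only: word_rb_simps(1); simp only: cl abcl)
  also have "\<dots> = P u \<otimes>\<^bsub>A\<^esub> P b1 \<oplus>\<^bsub>A\<^esub> P u \<otimes>\<^bsub>A\<^esub> P b2 \<oplus>\<^bsub>A\<^esub> lam \<odot>\<^bsub>A\<^esub> (P u \<otimes>\<^bsub>A\<^esub> P b3)"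
    by (simp only: rb[OF u abcl(4)] rb[OF u abcl(5)] rb[OF u abcl(6)])
  also have "\<dots> = P u \<otimes>\<^bsub>A\<^esub> (P v \<otimes>\<^bsub>A\<^esub> P w)"
    unfolding vw by (simp only: lin cl abcl)
  finally show ?thesis .
qed

text \<open>
  The size counts brackets, so replacing \<open>[Br U]\<close> by \<open>U\<close> makes it smaller and all hypotheses of
  \<open>assoc_rb_op\<close> are available by induction.
\<close>

lemma assoc_words:
  fixes a b c :: "'x bword"
  shows "basis R a \<otimes>\<^bsub>A\<^esub> basis R b \<otimes>\<^bsub>A\<^esub> basis R c = basis R a \<otimes>\<^bsub>A\<^esub> (basis R b \<otimes>\<^bsub>A\<^esub> basis R c)"
proof (induction "size_list size a + size_list size b + size_list size c"
    arbitrary: a b c rule: less_induct)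
  case less
  have assoc: "basis R a' \<otimes>\<^bsub>A\<^esub> basis R b' \<otimes>\<^bsub>A\<^esub> basis R c' = basis R a' \<otimes>\<^bsub>A\<^esub> (basis R b' \<otimes>\<^bsub>A\<^esub> basis R c')"
    if "size_list size a' + size_list size b' + size_list size c' <
      size_list size a + size_list size b + size_list size c" for a' b' c' :: "'x bword"
    using less that by blast
  consider "a = [] \<or> b = [] \<or> c = []" | x y b' where "b = [x] @ y # b'"
    | u \<alpha> \<beta> \<gamma> v where "a = u @ [\<alpha>]" "b = [\<beta>]" "c = \<gamma> # v"
    by (metis append_Cons append_Nil neq_Nil_conv rev_exhaust)
  then show ?case
  proof cases
    case 1
    then show ?thesis by auto
  next
    case 2
    show ?thesis unfolding 2 by (rule assoc_split_middle) auto
  next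
    case 3
    have "basis R [\<alpha>] \<otimes>\<^bsub>A\<^esub> basis R [\<beta>] \<otimes>\<^bsub>A\<^esub> basis R [\<gamma>] =
      basis R [\<alpha>] \<otimes>\<^bsub>A\<^esub> (basis R [\<beta>] \<otimes>\<^bsub>A\<^esub> basis R [\<gamma>])"
    proof (cases "\<exists>x. \<alpha> = Var x \<or> \<beta> = Var x \<or> \<gamma> = Var x")
      case True
      then show ?thesis by (auto intro!: assoc_var_left assoc_var_middle assoc_var_right)
    next
      case False
      then obtain U V W where UVW: "\<alpha> = Br U" "\<beta> = Br V" "\<gamma> = Br W"
        by (metis letter.exhaust)
      show ?thesis
        unfolding UVW rb_op_basis[symmetric]
        by (rule assoc_rb_op; (rule basis_closed, rule UNIV_I)?; (simp only: rb_op_basis)?;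
            rule assoc; simp add: 3 UVW)
    qed
    then show ?thesis unfolding 3 by (rule assoc_letters)
  qed
qed

lemma mult_assoc_A:
  assumes "x \<in> free_carrier R UNIV" "y \<in> free_carrier R UNIV" "z \<in> free_carrier R UNIV"
  shows "x \<otimes>\<^bsub>A\<^esub> y \<otimes>\<^bsub>A\<^esub> z = x \<otimes>\<^bsub>A\<^esub> (y \<otimes>\<^bsub>A\<^esub> z)"
  by (rule module.trilinear_eqI[OF module_A, where f = "\<lambda>x y z. x \<otimes>\<^bsub>A\<^esub> y \<otimes>\<^bsub>A\<^esub> z"
        and g = "\<lambda>x y z. x \<otimes>\<^bsub>A\<^esub> (y \<otimes>\<^bsub>A\<^esub> z)", OF _ _ _ _ _ _ _ assms])
    (auto intro!: linear_on_intros assoc_words)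

subsection \<open>The Rota--Baxter algebras of words\<close>

text \<open>
  The operations do not depend on the set of words, so all computations can be moved into \<open>A\<close>.
\<close>

lemma word_rb_ops:
  "mult (word_rb R lam Y) = mult A" "rb_op (word_rb R lam Y) = rb_op A"
  "add (word_rb R lam Y) = add A" "smult (word_rb R lam Y) = smult A"
  by (simp_all add: word_rb_def)

lemma mult_word_rb_closed:
  assumes "mult_stable Y" "x \<in> free_carrier R Y" "y \<in> free_carrier R Y"
  shows "x \<otimes>\<^bsub>A\<^esub> y \<in> free_carrier R Y"
  unfolding mult_word_rb by (rule bilin_ext_closed[OF diamond_closed]) (use assms in auto)

lemma rb_op_word_rb_closed:
  assumes "\<And>W. W \<in> Y \<Longrightarrow> [Br W] \<in> Y" "x \<in> free_carrier R Y"
  shows "rb_op A x \<in> free_carrier R Y"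
  unfolding rb_op_word_rb by (rule lin_ext_closed[OF _ assms(2)]) (use assms(1) in auto)

lemma nonunitary_rb_words:
  assumes "mult_stable Y" "\<And>W. W \<in> Y \<Longrightarrow> [Br W] \<in> Y"
  shows "nonunitary_rota_baxter_algebra R lam (word_rb R lam Y)"
proof -
  interpret Y: module R "word_rb R lam Y" by (rule module_freeI) simp_all
  show ?thesis
  proof
    fix x y assume "x \<in> carrier (word_rb R lam Y)" "y \<in> carrier (word_rb R lam Y)"
    then have "x \<in> free_carrier R Y" "y \<in> free_carrier R Y"
      and U: "x \<in> free_carrier R UNIV" "y \<in> free_carrier R UNIV" by auto
    then show "x \<otimes>\<^bsub>word_rb R lam Y\<^esub> y \<in> carrier (word_rb R lam Y)"
      using assms by (simp add: word_rb_ops[of Y] mult_word_rb_closed)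
    show "rb_op (word_rb R lam Y) (x \<oplus>\<^bsub>word_rb R lam Y\<^esub> y) =
        rb_op (word_rb R lam Y) x \<oplus>\<^bsub>word_rb R lam Y\<^esub> rb_op (word_rb R lam Y) y"
      unfolding word_rb_ops[of Y] by (rule rb_op_add_A[OF U])
    show "rb_op (word_rb R lam Y) x \<otimes>\<^bsub>word_rb R lam Y\<^esub> rb_op (word_rb R lam Y) y =
        rb_op (word_rb R lam Y) (x \<otimes>\<^bsub>word_rb R lam Y\<^esub> rb_op (word_rb R lam Y) y)
        \<oplus>\<^bsub>word_rb R lam Y\<^esub> rb_op (word_rb R lam Y) (rb_op (word_rb R lam Y) x \<otimes>\<^bsub>word_rb R lam Y\<^esub> y)
        \<oplus>\<^bsub>word_rb R lam Y\<^esub> lam \<odot>\<^bsub>word_rb R lam Y\<^esub> rb_op (word_rb R lam Y) (x \<otimes>\<^bsub>word_rb R lam Y\<^esub> y)"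
      unfolding word_rb_ops[of Y] by (rule rota_baxter_A[OF U])
    fix z assume "z \<in> carrier (word_rb R lam Y)"
    then have U': "z \<in> free_carrier R UNIV" by auto
    show "x \<otimes>\<^bsub>word_rb R lam Y\<^esub> y \<otimes>\<^bsub>word_rb R lam Y\<^esub> z = x \<otimes>\<^bsub>word_rb R lam Y\<^esub> (y \<otimes>\<^bsub>word_rb R lam Y\<^esub> z)"
      unfolding word_rb_ops[of Y] by (rule mult_assoc_A[OF U U'])
    show "(x \<oplus>\<^bsub>word_rb R lam Y\<^esub> y) \<otimes>\<^bsub>word_rb R lam Y\<^esub> z =
        x \<otimes>\<^bsub>word_rb R lam Y\<^esub> z \<oplus>\<^bsub>word_rb R lam Y\<^esub> y \<otimes>\<^bsub>word_rb R lam Y\<^esub> z"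
      "z \<otimes>\<^bsub>word_rb R lam Y\<^esub> (x \<oplus>\<^bsub>word_rb R lam Y\<^esub> y) =
        z \<otimes>\<^bsub>word_rb R lam Y\<^esub> x \<oplus>\<^bsub>word_rb R lam Y\<^esub> z \<otimes>\<^bsub>word_rb R lam Y\<^esub> y"
      unfolding word_rb_ops[of Y] by (rule mult_add_A[OF U U'])+
  next
    fix a x y
    assume a: "a \<in> carrier R" and "x \<in> carrier (word_rb R lam Y)" "y \<in> carrier (word_rb R lam Y)"
    then have U: "x \<in> free_carrier R UNIV" "y \<in> free_carrier R UNIV" by auto
    show "(a \<odot>\<^bsub>word_rb R lam Y\<^esub> x) \<otimes>\<^bsub>word_rb R lam Y\<^esub> y = a \<odot>\<^bsub>word_rb R lam Y\<^esub> (x \<otimes>\<^bsub>word_rb R lam Y\<^esub> y)"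
      unfolding word_rb_ops[of Y] by (rule mult_smult_A(1)[OF a U])
    show "x \<otimes>\<^bsub>word_rb R lam Y\<^esub> (a \<odot>\<^bsub>word_rb R lam Y\<^esub> y) = a \<odot>\<^bsub>word_rb R lam Y\<^esub> (x \<otimes>\<^bsub>word_rb R lam Y\<^esub> y)"
      unfolding word_rb_ops[of Y] by (rule mult_smult_A(2)[OF a U(2,1)])
  next
    fix x assume x: "x \<in> carrier (word_rb R lam Y)"
    then show "rb_op (word_rb R lam Y) x \<in> carrier (word_rb R lam Y)"
      using rb_op_word_rb_closed[of Y x] assms(2) by (simp add: word_rb_ops[of Y])
    show "rb_op (word_rb R lam Y) (a \<odot>\<^bsub>word_rb R lam Y\<^esub> x) =
        a \<odot>\<^bsub>word_rb R lam Y\<^esub> rb_op (word_rb R lam Y) x" if "a \<in> carrier R" for a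
      unfolding word_rb_ops[of Y] by (rule rb_op_smult_A[OF that]) (use x in auto)
  qed (rule lam_closed)
qed

lemma rb_words_unitary:
  assumes "mult_stable Y" "\<And>W. W \<in> Y \<Longrightarrow> [Br W] \<in> Y" "[] \<in> Y"
  shows "rota_baxter_algebra R lam (word_rb R lam Y)"
proof -
  interpret N: nonunitary_rota_baxter_algebra R lam "word_rb R lam Y"
    by (rule nonunitary_rb_words) (use assms in auto)
  show ?thesis
    by (intro rota_baxter_algebra.intro N.nonunitary_rota_baxter_algebra_axioms monoidI
        N.mult_closed N.mult_assoc)
      (use assms(3) in \<open>auto simp: word_rb_ops[of Y]\<close>)
qed

end

section \<open>Sets of bracketed words\<close>

text \<open>
  The flag \<open>e\<close> tells whether the empty word is allowed, at the top level and inside brackets, so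
  that the unitary and the nonunitary case are treated together.
\<close>

inductive_set bracket_letters :: "bool \<Rightarrow> 'x set \<Rightarrow> 'x letter set" for e X where
  Var: "x \<in> X \<Longrightarrow> Var x \<in> bracket_letters e X"
| Br: "\<lbrakk>W \<in> lists (bracket_letters e X); e \<or> W \<noteq> []\<rbrakk> \<Longrightarrow> Br W \<in> bracket_letters e X"

definition words_over :: "bool \<Rightarrow> 'x set \<Rightarrow> 'x bword set" where
  "words_over e X = {W \<in> lists (bracket_letters e X). e \<or> W \<noteq> []}"

lemma Var_letter_iff [simp]: "Var x \<in> bracket_letters e X \<longleftrightarrow> x \<in> X"
  by (auto intro: bracket_letters.Var elim: bracket_letters.cases)

lemma Br_letter_iff [simp]: "Br W \<in> bracket_letters e X \<longleftrightarrow> W \<in> words_over e X"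
  unfolding words_over_def by (auto intro: bracket_letters.Br elim: bracket_letters.cases)

lemma Cons_words_over:
  "a # W \<in> words_over e X \<longleftrightarrow> a \<in> bracket_letters e X \<and> (W = [] \<or> W \<in> words_over e X)"
  by (auto simp: words_over_def)

lemma Nil_words_over [simp]: "[] \<in> words_over e X \<longleftrightarrow> e"
  by (simp add: words_over_def)

lemma words_over_mono: "words_over False X \<subseteq> words_over True X"
proof -
  have "a \<in> bracket_letters True X" if "a \<in> bracket_letters False X" for a
    using that by induction (auto simp: words_over_def)
  then show ?thesis by (auto simp: words_over_def)
qed

text \<open>
  A word has finitely many letters and the stages increase, so its letters occur at a common stage.
\<close>

lemma stages_eq_words_over:
  fixes S :: "nat \<Rightarrow> 'x bword set"
  assumes S0: "S 0 = {W \<in> lists (Var ` X). e \<or> W \<noteq> []}"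
    and Suc: "\<And>n. S (Suc n) = {W \<in> lists (Var ` X \<union> Br ` S n). e \<or> W \<noteq> []}"
  shows "(\<Union>n. S n) = words_over e X"
proof
  have "S n \<subseteq> words_over e X" for n
  proof (induction n)
    case 0
    have "lists (Var ` X) \<subseteq> lists (bracket_letters e X)" by (intro lists_mono) auto
    then show ?case unfolding S0 words_over_def by auto
  next
    case (Suc n)
    then have "lists (Var ` X \<union> Br ` S n) \<subseteq> lists (bracket_letters e X)"
      by (intro lists_mono) auto
    then show ?case unfolding assms(2) words_over_def by auto
  qed
  then show "(\<Union>n. S n) \<subseteq> words_over e X" by blast
  have step: "S n \<subseteq> S (Suc n)" for n
  proof (induction n)
    case 0
    have "lists (Var ` X) \<subseteq> lists (Var ` X \<union> Br ` S 0)" by (intro lists_mono) auto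
    then show ?case unfolding S0 assms(2) by auto
  next
    case (Suc n)
    then have "lists (Var ` X \<union> Br ` S n) \<subseteq> lists (Var ` X \<union> Br ` S (Suc n))"
      by (intro lists_mono) auto
    then show ?case unfolding assms(2)[of "Suc n"] assms(2)[of n] by auto
  qed
  have mono: "S m \<subseteq> S n" if "m \<le> n" for m n
    by (rule lift_Suc_mono_le[of S, OF step that])
  have common: "\<exists>n. W \<in> lists (Var ` X \<union> Br ` S n)"
    if "\<forall>a\<in>set W. \<exists>n. a \<in> Var ` X \<union> Br ` S n" for W
    using that
  proof (induction W)
    case (Cons a W)
    then obtain m n where mn: "a \<in> Var ` X \<union> Br ` S m" "W \<in> lists (Var ` X \<union> Br ` S n)"
      by auto
    have "lists (Var ` X \<union> Br ` S n) \<subseteq> lists (Var ` X \<union> Br ` S (max m n))"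
      using mono[of n "max m n"] by (intro lists_mono) auto
    moreover have "a \<in> Var ` X \<union> Br ` S (max m n)" using mn(1) mono[of m "max m n"] by auto
    ultimately have "a # W \<in> lists (Var ` X \<union> Br ` S (max m n))" using mn(2) by auto
    then show ?case ..
  qed simp
  have "\<exists>n. a \<in> Var ` X \<union> Br ` S n" if "a \<in> bracket_letters e X" for a
    using that
  proof induction
    case (Br W)
    then have "\<forall>a\<in>set W. \<exists>n. a \<in> Var ` X \<union> Br ` S n" by auto
    then obtain n where "W \<in> lists (Var ` X \<union> Br ` S n)" using common by blast
    then have "W \<in> S (Suc n)" using Br unfolding assms(2) by auto
    then show ?case by blast
  qed auto
  then have "\<exists>n. W \<in> S (Suc n)" if "W \<in> words_over e X" for W
    using common[of W] that unfolding assms(2) words_over_def by auto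
  then show "words_over e X \<subseteq> (\<Union>n. S n)" by blast
qed

lemma bracketed_words_eq: "bracketed_words X = words_over True X"
  unfolding bracketed_words_def by (rule stages_eq_words_over) auto

lemma bracketed_words_S_eq: "bracketed_words_S X = words_over False X"
  unfolding bracketed_words_S_def by (rule stages_eq_words_over) auto

lemma successively_iff_factors:
  "successively P xs \<longleftrightarrow> (\<forall>u a b v. xs = u @ [a, b] @ v \<longrightarrow> P a b)"
proof
  assume "successively P xs"
  then show "\<forall>u a b v. xs = u @ [a, b] @ v \<longrightarrow> P a b"
    by (auto simp: successively_append_iff)
next
  assume "\<forall>u a b v. xs = u @ [a, b] @ v \<longrightarrow> P a b"
  then show "successively P xs"
  proof (induction xs rule: induct_list012)
    case (3 x y zs)
    have "P x y" using 3(3)[rule_format, of "[]" x y zs] by simp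
    moreover have "P a b" if "y # zs = u @ [a, b] @ v" for u a b v
      using 3(3)[rule_format, of "x # u" a b v] that by simp
    ultimately show ?case using 3(2) by auto
  qed auto
qed

abbreviation separated :: "'x letter \<Rightarrow> 'x letter \<Rightarrow> bool" where
  "separated a b \<equiv> (\<nexists>U V. a = Br U \<and> b = Br V)"

lemma no_adjacent_brackets_iff:
  "no_adjacent_brackets W \<longleftrightarrow>
     successively separated W \<and> (\<forall>V. Br V \<in> set W \<longrightarrow> no_adjacent_brackets V)"
proof -
  have "(\<nexists>u V V' v. W = u @ [Br V, Br V'] @ v) \<longleftrightarrow> successively separated W"
    unfolding successively_iff_factors by blast
  then show ?thesis by (subst no_adjacent_brackets.simps) simp
qed

definition rb_words_over :: "bool \<Rightarrow> 'x set \<Rightarrow> 'x bword set" where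
  "rb_words_over e X = {W \<in> words_over e X. no_adjacent_brackets W}"

lemma rb_words_eq: "rb_words X = rb_words_over True X"
  by (simp add: rb_words_def rb_words_over_def bracketed_words_eq)

lemma bracketed_words_S_rb_words: "bracketed_words_S X \<inter> rb_words X = rb_words_over False X"
  using words_over_mono
  by (auto simp: rb_words_def rb_words_over_def bracketed_words_eq bracketed_words_S_eq)

lemma no_adjacent_brackets_Br [simp]: "no_adjacent_brackets [Br W] \<longleftrightarrow> no_adjacent_brackets W"
  by (subst no_adjacent_brackets_iff) simp

lemma no_adjacent_brackets_Var [simp]: "no_adjacent_brackets [Var x]"
  by (subst no_adjacent_brackets_iff) simp

lemma no_adjacent_brackets_Nil [simp]: "no_adjacent_brackets []"
  by (subst no_adjacent_brackets_iff) simp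

lemma no_adjacent_brackets_append:
  "no_adjacent_brackets (W @ W') \<longleftrightarrow> no_adjacent_brackets W \<and> no_adjacent_brackets W' \<and>
     (W = [] \<or> W' = [] \<or> separated (last W) (hd W'))"
  by (subst (1 2 3) no_adjacent_brackets_iff) (auto simp: successively_append_iff)

lemma no_adjacent_brackets_Cons:
  "no_adjacent_brackets (Var x # W) \<longleftrightarrow> no_adjacent_brackets W"
  "no_adjacent_brackets (Br V # W) \<longleftrightarrow>
     no_adjacent_brackets V \<and> no_adjacent_brackets W \<and> (W = [] \<or> (\<nexists>V'. hd W = Br V'))"
  using no_adjacent_brackets_append[of "[Var x]" W] no_adjacent_brackets_append[of "[Br V]" W]
  by simp_all

lemma mult_stable_words_over: "mult_stable (words_over e X)"
  unfolding mult_stable_def by (auto simp: Cons_words_over words_over_def)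

lemma mult_stable_rb_words_over: "mult_stable (rb_words_over e X)"
  unfolding mult_stable_def
proof (intro conjI allI impI)
  fix u v :: "'a bword" and a b
  assume *: "u @ [a] \<in> rb_words_over e X" "b # v \<in> rb_words_over e X" "separated a b"
  have "u @ a # b # v \<in> words_over e X"
    using mult_stable_letters[OF mult_stable_words_over] * unfolding rb_words_over_def by blast
  moreover have "no_adjacent_brackets ((u @ [a]) @ b # v)"
    using * unfolding rb_words_over_def by (subst no_adjacent_brackets_append) auto
  ultimately show "u @ a # b # v \<in> rb_words_over e X" by (simp add: rb_words_over_def)
next
  fix u v U V :: "'a bword"
  assume *: "u @ [Br U] \<in> rb_words_over e X" "Br V # v \<in> rb_words_over e X"
  have w: "U \<in> words_over e X \<and> V \<in> words_over e X \<and> [Br U] \<in> words_over e X \<and>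
      [Br V] \<in> words_over e X \<and> (\<forall>Z\<in>words_over e X. u @ Br Z # v \<in> words_over e X)"
    by (rule mult_stable_brackets[OF mult_stable_words_over])
      (use * in \<open>auto simp: rb_words_over_def\<close>)
  have n: "no_adjacent_brackets (u @ [Br U])" "no_adjacent_brackets (Br V # v)"
    using * by (auto simp: rb_words_over_def)
  then show "U \<in> rb_words_over e X" "V \<in> rb_words_over e X" "[Br U] \<in> rb_words_over e X"
    "[Br V] \<in> rb_words_over e X"
    using w by (auto simp: rb_words_over_def no_adjacent_brackets_append no_adjacent_brackets_Cons)
  have "no_adjacent_brackets (u @ Br Z # v)" if "no_adjacent_brackets Z" for Z
    using n that by (simp add: no_adjacent_brackets_append no_adjacent_brackets_Cons)
  then show "\<forall>Z\<in>rb_words_over e X. u @ Br Z # v \<in> rb_words_over e X"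
    using w by (auto simp: rb_words_over_def)
qed

lemma Br_rb_words_over: "W \<in> rb_words_over e X \<Longrightarrow> [Br W] \<in> rb_words_over e X"
  by (simp add: rb_words_over_def Cons_words_over)

section \<open>Evaluation of words\<close>

text \<open>
  A one-letter word has its own equations instead of being multiplied by the value of the
  empty word, so that the value of a nonempty word without empty brackets never involves
  the identity of \<open>B\<close>.
\<close>

fun eval_word :: "('k, 'b, 'm) rb_structure_scheme \<Rightarrow> ('x \<Rightarrow> 'b) \<Rightarrow> 'x bword \<Rightarrow> 'b" where
  "eval_word B f [] = \<one>\<^bsub>B\<^esub>"
| "eval_word B f [Var x] = f x"
| "eval_word B f [Br V] = rb_op B (eval_word B f V)"
| "eval_word B f (a # b # W) = eval_word B f [a] \<otimes>\<^bsub>B\<^esub> eval_word B f (b # W)"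

lemma word_induct [case_names Nil Var Br Cons]:
  fixes W :: "'x bword"
  assumes Nil: "P []" and Var: "\<And>x. P [Var x]" and Br: "\<And>V. P V \<Longrightarrow> P [Br V]"
    and Cons: "\<And>a b W. \<lbrakk>P [a]; P (b # W)\<rbrakk> \<Longrightarrow> P (a # b # W)"
  shows "P W"
proof (induction W rule: word_to_path.induct)
  case (2 x W)
  then show ?case using Var Cons by (cases W) auto
next
  case (3 V W)
  then show ?case using Br Cons by (cases W) auto
qed (rule Nil)

locale rb_evaluation = nonunitary_rota_baxter_algebra R lam B
  for R :: "('k, 'c) ring_scheme" (structure) and lam :: 'k
    and B :: "('k, 'b, 'm) rb_structure_scheme" (structure) +
  fixes f :: "'x \<Rightarrow> 'b" and e :: bool and X :: "'x set"
  assumes f_closed: "x \<in> X \<Longrightarrow> f x \<in> carrier B"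
    and unit: "e \<Longrightarrow> monoid B"

sublocale rb_evaluation \<subseteq> rb_weight R lam
  by unfold_locales (rule weight_closed)

context rb_evaluation
begin

abbreviation eval :: "'x bword \<Rightarrow> 'b" where
  "eval \<equiv> eval_word B f"

abbreviation lift :: "('x bword \<Rightarrow> 'k) \<Rightarrow> 'b" where
  "lift \<equiv> lin_to R B eval"

abbreviation Y :: "'x bword set" where
  "Y \<equiv> words_over e X"

lemma eval_closed: "W \<in> Y \<Longrightarrow> eval W \<in> carrier B"
  by (induction W rule: word_induct)
    (auto simp: Cons_words_over intro: f_closed rb_op_closed mult_closed monoid.one_closed[OF unit])

lemma eval_Cons: "W \<noteq> [] \<Longrightarrow> eval (a # W) = eval [a] \<otimes>\<^bsub>B\<^esub> eval W"
  by (cases W) auto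

lemma eval_append:
  "\<lbrakk>W @ W' \<in> Y; W \<noteq> []; W' \<noteq> []\<rbrakk> \<Longrightarrow> eval (W @ W') = eval W \<otimes>\<^bsub>B\<^esub> eval W'"
proof (induction W)
  case (Cons a W)
  show ?case
  proof (cases "W = []")
    case False
    have cl: "[a] \<in> Y" "W \<in> Y" "W' \<in> Y" "W @ W' \<in> Y"
      using Cons.prems False by (auto simp: words_over_def)
    then show ?thesis
      using Cons False eval_Cons[of "W @ W'" a] eval_Cons[of W a]
      by (simp add: mult_assoc eval_closed Cons_words_over)
  qed (use Cons.prems eval_Cons[of W' a] in simp)
qed simp

lemma linear_on_lift: "Z \<subseteq> Y \<Longrightarrow> linear_on R Z B lift"
  by (rule linear_on_lin_to) (auto intro: eval_closed)

lemma lift_basis: "W \<in> Y \<Longrightarrow> lift (basis R W) = eval W"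
  by (rule lin_to_basis) (rule eval_closed)

lemma lift_closed: "c \<in> free_carrier R Y \<Longrightarrow> lift c \<in> carrier B"
  by (rule linear_on_closed[OF linear_on_lift]) auto

lemma linear_on_mult_left_B:
  "linear_on R Z B g \<Longrightarrow> b \<in> carrier B \<Longrightarrow> linear_on R Z B (\<lambda>c. g c \<otimes>\<^bsub>B\<^esub> b)"
  unfolding linear_on_def by (auto simp: Pi_iff distr_left smult_mult_left intro: mult_closed)

lemma linear_on_mult_right_B:
  "b \<in> carrier B \<Longrightarrow> linear_on R Z B g \<Longrightarrow> linear_on R Z B (\<lambda>c. b \<otimes>\<^bsub>B\<^esub> g c)"
  unfolding linear_on_def by (auto simp: Pi_iff distr_right smult_mult_right intro: mult_closed)

lemma linear_on_rb_op_B: "linear_on R Z B g \<Longrightarrow> linear_on R Z B (\<lambda>c. rb_op B (g c))"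
  unfolding linear_on_def by (auto simp: Pi_iff rb_op_add rb_op_smult intro: rb_op_closed)

lemma lift_rb_op:
  assumes "c \<in> free_carrier R Y"
  shows "lift (lin_ext R (\<lambda>W. basis R [Br W]) c) = rb_op B (lift c)"
proof (rule linear_on_eqI[OF _ _ _ assms])
  have br: "(\<lambda>W. basis R [Br W]) \<in> Y \<rightarrow> free_carrier R Y" by (auto simp: Cons_words_over)
  show "linear_on R Y B (\<lambda>c. lift (lin_ext R (\<lambda>W. basis R [Br W]) c))"
    by (rule linear_on_comp[OF linear_on_lin_ext[OF br] linear_on_lift]) simp
  show "linear_on R Y B (\<lambda>c. rb_op B (lift c))"
    by (rule linear_on_rb_op_B[OF linear_on_lift]) simp
  fix W assume "W \<in> Y"
  then show "lift (lin_ext R (\<lambda>W. basis R [Br W]) (basis R W)) = rb_op B (lift (basis R W))"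
    by (simp add: lin_ext_basis[of _ _ UNIV] lift_basis Cons_words_over)
qed

text \<open>
  Multiplication by the value of a word, except that the empty word acts as the identity map even
  if \<open>B\<close> has no identity element.
\<close>

definition left_act :: "'x bword \<Rightarrow> 'b \<Rightarrow> 'b" where
  "left_act W x = (if W = [] then x else eval W \<otimes>\<^bsub>B\<^esub> x)"

definition right_act :: "'b \<Rightarrow> 'x bword \<Rightarrow> 'b" where
  "right_act x W = (if W = [] then x else x \<otimes>\<^bsub>B\<^esub> eval W)"

lemma eval_context:
  assumes "u \<in> lists (bracket_letters e X)" "v \<in> lists (bracket_letters e X)" "W \<in> Y" "W \<noteq> []"
  shows "eval (u @ W @ v) = right_act (left_act u (eval W)) v"
proof -
  have cl: "u = [] \<or> eval u \<in> carrier B" "v = [] \<or> eval v \<in> carrier B" "eval W \<in> carrier B"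
    using assms eval_closed by (auto simp: words_over_def)
  have "eval (W @ v) = right_act (eval W) v"
    using eval_append[of W v] assms by (auto simp: right_act_def words_over_def)
  moreover have "eval (u @ W @ v) = left_act u (eval (W @ v))"
    using eval_append[of u "W @ v"] assms by (auto simp: left_act_def words_over_def)
  ultimately show ?thesis
    using cl by (auto simp: left_act_def right_act_def mult_assoc)
qed

lemma lift_context:
  assumes u: "u \<in> lists (bracket_letters e X)" and v: "v \<in> lists (bracket_letters e X)"
    and c: "c \<in> free_carrier R (Y \<inter> {W. W \<noteq> []})"
  shows "lift (lin_ext R (\<lambda>W. basis R (u @ W @ v)) c) = right_act (left_act u (lift c)) v"
proof (rule linear_on_eqI[OF _ _ _ c])
  let ?Z = "Y \<inter> {W. W \<noteq> []}"
  have cl: "u = [] \<or> eval u \<in> carrier B" "v = [] \<or> eval v \<in> carrier B"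
    using u v eval_closed by (auto simp: words_over_def)
  have Z: "(\<lambda>W. basis R (u @ W @ v)) \<in> ?Z \<rightarrow> free_carrier R Y"
    using u v by (auto simp: words_over_def)
  show "linear_on R ?Z B (\<lambda>c. lift (lin_ext R (\<lambda>W. basis R (u @ W @ v)) c))"
    by (rule linear_on_comp[OF linear_on_lin_ext[OF Z] linear_on_lift]) simp
  show "linear_on R ?Z B (\<lambda>c. right_act (left_act u (lift c)) v)"
    unfolding left_act_def right_act_def using cl
    by (cases "u = []"; cases "v = []";
        simp add: linear_on_mult_left_B linear_on_mult_right_B linear_on_lift)
  fix W assume W: "W \<in> ?Z"
  then have "u @ W @ v \<in> Y" using u v by (auto simp: words_over_def)
  then show "lift (lin_ext R (\<lambda>W. basis R (u @ W @ v)) (basis R W)) =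
      right_act (left_act u (lift (basis R W))) v"
    using u v W by (simp add: lin_ext_basis[of _ _ UNIV] lift_basis eval_context)
qed

lemma diamond_letter_closed_Y:
  assumes "a \<in> bracket_letters e X" "b \<in> bracket_letters e X"
  shows "diamond_w_letter R lam a b \<in> free_carrier R (Y \<inter> {W. W \<noteq> []})"
  using diamond_closed_aux(2)[OF mult_stable_words_over, of "[]" a e X b "[]"] assms
  by (simp add: free_carrier_Int diamond_letter_nonempty Cons_words_over)

lemma eval_one:
  assumes "e" "x \<in> carrier B"
  shows "eval [] \<otimes>\<^bsub>B\<^esub> x = x" "x \<otimes>\<^bsub>B\<^esub> eval [] = x"
  using assms monoid.l_one[OF unit] monoid.r_one[OF unit] by auto

text \<open>
  For brackets, the recursion of the product is mapped to the Rota--Baxter identity of the test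
  algebra.
\<close>

lemma lift_diamond:
  shows "\<lbrakk>W \<in> Y; W' \<in> Y\<rbrakk> \<Longrightarrow> lift (diamond_w_basis R lam W W') = eval W \<otimes>\<^bsub>B\<^esub> eval W'"
    and "\<lbrakk>a \<in> bracket_letters e X; b \<in> bracket_letters e X\<rbrakk>
      \<Longrightarrow> lift (diamond_w_letter R lam a b) = eval [a] \<otimes>\<^bsub>B\<^esub> eval [b]"
proof (induction W W' and a b rule: diamond_induct)
  case (words W W')
  show ?case
  proof (cases "W = [] \<or> W' = []")
    case True
    then show ?thesis
      using words.prems by (auto simp: lift_basis eval_one eval_closed simp del: eval_word.simps)
  next
    case False
    then obtain u a b v where uv: "W = u @ [a]" "W' = b # v"
      by (metis neq_Nil_conv rev_exhaust)
    have mem: "u \<in> lists (bracket_letters e X)" "v \<in> lists (bracket_letters e X)"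
      "a \<in> bracket_letters e X" "b \<in> bracket_letters e X"
      using words.prems uv by (auto simp: words_over_def)
    then have cl: "u = [] \<or> eval u \<in> carrier B" "v = [] \<or> eval v \<in> carrier B"
      "eval [a] \<in> carrier B" "eval [b] \<in> carrier B"
      using eval_closed by (auto simp: words_over_def)
    have "lift (diamond_w_basis R lam W W') =
        lift (lin_ext R (\<lambda>Z. basis R (u @ Z @ v)) (diamond_w_letter R lam a b))"
      by (simp add: uv diamond_w_basis.simps)
    also have "\<dots> = right_act (left_act u (lift (diamond_w_letter R lam a b))) v"
      using mem by (intro lift_context diamond_letter_closed_Y) auto
    also have "\<dots> = right_act (left_act u (eval [a] \<otimes>\<^bsub>B\<^esub> eval [b])) v"
      using words.IH mem by (simp add: uv)
    also have "\<dots> = left_act u (eval [a]) \<otimes>\<^bsub>B\<^esub> right_act (eval [b]) v"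
      using cl by (auto simp: left_act_def right_act_def mult_assoc mult_closed)
    also have "left_act u (eval [a]) = eval W"
      using eval_append[of u "[a]"] words.prems(1) by (auto simp: uv left_act_def)
    also have "right_act (eval [b]) v = eval W'"
      using eval_append[of "[b]" v] words.prems(2) by (auto simp: uv right_act_def)
    finally show ?thesis .
  qed
next
  case (var_left x a)
  then show ?case by (simp add: lift_basis Cons_words_over)
next
  case (var_right U x)
  then show ?case by (simp add: lift_basis Cons_words_over)
next
  case (brackets U V)
  then have mem: "U \<in> Y" "V \<in> Y" "[Br U] \<in> Y" "[Br V] \<in> Y" by (auto simp: Cons_words_over)
  let ?P = "\<lambda>c. lin_ext R (\<lambda>Z. basis R [Br Z]) c"
  let ?d = "diamond_w_basis R lam"
  have d: "?d U [Br V] \<in> free_carrier R Y" "?d [Br U] V \<in> free_carrier R Y"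
    "?d U V \<in> free_carrier R Y"
    using mem by (auto intro!: diamond_closed mult_stable_words_over)
  then have P: "?P (?d U [Br V]) \<in> free_carrier R Y" "?P (?d [Br U] V) \<in> free_carrier R Y"
    "?P (?d U V) \<in> free_carrier R Y"
    by (auto intro!: lin_ext_closed[of Y] simp: Cons_words_over)
  note plus = linear_on_plus[OF linear_on_lift[OF order_refl]]
    and scale = linear_on_scale[OF linear_on_lift[OF order_refl]]
  have "lift (diamond_w_letter R lam (Br U) (Br V)) =
      lift (?P (?d U [Br V])) \<oplus>\<^bsub>B\<^esub> lift (?P (?d [Br U] V)) \<oplus>\<^bsub>B\<^esub> lam \<odot>\<^bsub>B\<^esub> lift (?P (?d U V))"
    using P by (simp add: plus scale)
  also have "\<dots> = eval [Br U] \<otimes>\<^bsub>B\<^esub> eval [Br V]"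
    using d mem brackets.IH by (simp add: lift_rb_op rota_baxter eval_closed)
  finally show ?case .
qed

lemma lift_mult:
  assumes "x \<in> free_carrier R Y" "y \<in> free_carrier R Y"
  shows "lift (x \<otimes>\<^bsub>A\<^esub> y) = lift x \<otimes>\<^bsub>B\<^esub> lift y"
  unfolding mult_word_rb
proof (rule bilinear_eqI[where f = "\<lambda>x y. lift (bilin_ext R (diamond_w_basis R lam) x y)"
      and g = "\<lambda>x y. lift x \<otimes>\<^bsub>B\<^esub> lift y", OF _ _ _ _ _ assms])
  have cl: "diamond_w_basis R lam W W' \<in> free_carrier R Y" if "W \<in> Y" "W' \<in> Y" for W W'
    using that by (intro diamond_closed mult_stable_words_over)
  show "linear_on R Y B (\<lambda>x. lift (bilin_ext R (diamond_w_basis R lam) x y))"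
    "linear_on R Y B (\<lambda>x. lift x \<otimes>\<^bsub>B\<^esub> lift y)" if "y \<in> free_carrier R Y" for y
    using linear_on_comp[OF linear_on_bilin_left[OF cl that] linear_on_lift[OF order_refl]] that
    by (auto intro!: linear_on_mult_left_B linear_on_lift lift_closed)
  show "linear_on R Y B (\<lambda>y. lift (bilin_ext R (diamond_w_basis R lam) x y))"
    "linear_on R Y B (\<lambda>y. lift x \<otimes>\<^bsub>B\<^esub> lift y)" if "x \<in> free_carrier R Y" for x
    using linear_on_comp[OF linear_on_bilin_right[OF cl that] linear_on_lift[OF order_refl]] that
    by (auto intro!: linear_on_mult_right_B linear_on_lift lift_closed)
  show "lift (bilin_ext R (diamond_w_basis R lam) (basis R W) (basis R W')) =
      lift (basis R W) \<otimes>\<^bsub>B\<^esub> lift (basis R W')" if "W \<in> Y" "W' \<in> Y" for W W'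
    using that by (simp add: bilin_ext_basis[of _ _ _ UNIV] lift_diamond lift_basis)
qed

subsection \<open>The universal property\<close>

abbreviation Z :: "'x bword set" where
  "Z \<equiv> rb_words_over e X"

abbreviation F :: "('k, 'x bword \<Rightarrow> 'k) rb_structure" where
  "F \<equiv> word_rb R lam Z"

lemma Z_subset: "Z \<subseteq> Y"
  by (auto simp: rb_words_over_def)

lemma restrict_lift_hom: "restrict lift (free_carrier R Z) \<in> nonunitary_rb_hom R F B"
proof -
  have mult: "x \<otimes>\<^bsub>A\<^esub> y \<in> free_carrier R Z" if "x \<in> free_carrier R Z" "y \<in> free_carrier R Z" for x y
    using that by (intro mult_word_rb_closed mult_stable_rb_words_over)
  have op: "rb_op A x \<in> free_carrier R Z" if "x \<in> free_carrier R Z" for x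
    using that by (intro rb_op_word_rb_closed Br_rb_words_over)
  have "lift (rb_op A x) = rb_op B (lift x)" if "x \<in> free_carrier R Y" for x
    using lift_rb_op[OF that] by (simp add: rb_op_word_rb)
  then show ?thesis
    using linear_on_lift[OF Z_subset] free_carrier_mono[OF Z_subset]
    unfolding nonunitary_rb_hom_def word_rb_ops[of Z] linear_on_def
    by (auto simp: mult op lift_mult lift_closed)
qed

text \<open>
  Since a word without adjacent brackets is the product of its letters, and the content of a bracket
  is a smaller word of the same kind, its image is determined.
\<close>

lemma hom_on_words:
  assumes h: "h \<in> nonunitary_rb_hom R F B" and var: "\<And>x. x \<in> X \<Longrightarrow> h (basis R [Var x]) = f x"
    and one: "e \<Longrightarrow> h (basis R []) = \<one>\<^bsub>B\<^esub>"
  shows "W \<in> Z \<Longrightarrow> h (basis R W) = eval W"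
proof (induction W rule: word_induct)
  case Nil
  then show ?case using one by (auto simp: rb_words_over_def)
next
  case (Var x)
  then show ?case using var by (auto simp: rb_words_over_def Cons_words_over)
next
  case (Br V)
  then have V: "V \<in> Z" by (auto simp: rb_words_over_def Cons_words_over)
  then have "basis R V \<in> carrier F" by simp
  then have "h (rb_op F (basis R V)) = rb_op B (h (basis R V))"
    using h by (auto simp: nonunitary_rb_hom_def)
  then show ?case using Br.IH[OF V] by (simp add: word_rb_ops(2)[of Z] rb_op_basis)
next
  case (Cons a b W)
  have "no_adjacent_brackets ([a] @ (b # W))" using Cons.prems by (simp add: rb_words_over_def)
  then have nab: "no_adjacent_brackets [a]" "no_adjacent_brackets (b # W)" "separated a b"
    unfolding no_adjacent_brackets_append by auto
  then have mem: "[a] \<in> Z" "b # W \<in> Z"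
    using Cons.prems by (auto simp: rb_words_over_def Cons_words_over)
  \<comment> \<open>One of the letters is a variable, so their product is their concatenation.\<close>
  have "diamond_w_letter R lam a b = basis R [a, b]" using nab(3) by (cases a; cases b) auto
  then have prod: "basis R [a] \<otimes>\<^bsub>F\<^esub> basis R (b # W) = basis R (a # b # W)"
    by (simp add: word_rb_ops(1)[of Z] mult_basis diamond_conc conc_basis)
  have "h (basis R [a] \<otimes>\<^bsub>F\<^esub> basis R (b # W)) = h (basis R [a]) \<otimes>\<^bsub>B\<^esub> h (basis R (b # W))"
    using h mem by (auto simp: nonunitary_rb_hom_def)
  then show ?case unfolding prod using Cons.IH mem by simp
qed

lemma hom_unique:
  assumes h: "h \<in> nonunitary_rb_hom R F B" and var: "\<And>x. x \<in> X \<Longrightarrow> h (basis R [Var x]) = f x"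
    and one: "e \<Longrightarrow> h (basis R []) = \<one>\<^bsub>B\<^esub>" and ext: "h \<in> extensional (free_carrier R Z)"
  shows "h = restrict lift (free_carrier R Z)"
proof (rule extensionalityI[OF ext])
  fix c assume c: "c \<in> free_carrier R Z"
  have "linear_on R Z B h"
    using h by (auto simp: nonunitary_rb_hom_def linear_on_def)
  then have "h c = lift c"
    using hom_on_words[OF h var one] Z_subset
    by (intro linear_on_eqI[OF _ linear_on_lift[OF Z_subset] _ c]) (auto simp: lift_basis)
  then show "h c = restrict lift (free_carrier R Z) c" using c by simp
qed simp

lemma restrict_lift_basis: "W \<in> Z \<Longrightarrow> restrict lift (free_carrier R Z) (basis R W) = eval W"
  using Z_subset by (auto simp: lift_basis)

end

context rb_weight
begin

lemma word_j_closed: "word_j R \<in> X \<rightarrow> free_carrier R (rb_words_over e X)"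
  by (auto simp: word_j_def rb_words_over_def Cons_words_over)

lemma nonunitary_rb_words_over:
  "nonunitary_rota_baxter_algebra R lam (word_rb R lam (rb_words_over e X))"
  by (intro nonunitary_rb_words mult_stable_rb_words_over Br_rb_words_over)

lemma rb_words_over_unitary: "rota_baxter_algebra R lam (word_rb R lam (rb_words_over True X))"
  by (intro rb_words_unitary mult_stable_rb_words_over Br_rb_words_over)
    (simp_all add: rb_words_over_def)

lemma free_nonunitary_words:
  "free_nonunitary_rota_baxter_algebra TYPE('b) R lam X
     (word_rb R lam (rb_words_over False X)) (word_j R)"
  unfolding free_nonunitary_rota_baxter_algebra_def
proof (intro conjI allI impI ballI)
  fix B :: "('k, 'b) rb_structure" and f
  assume B: "nonunitary_rota_baxter_algebra R lam B" and f: "f \<in> X \<rightarrow> carrier B"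
  interpret E: rb_evaluation R lam B f False X
    by (intro rb_evaluation.intro B rb_evaluation_axioms.intro) (use f in auto)
  let ?h = "restrict E.lift (free_carrier R E.Z)"
  show "\<exists>!h. h \<in> nonunitary_rb_hom R E.F B \<and> h \<in> extensional (carrier E.F) \<and>
      (\<forall>x\<in>X. f x = h (word_j R x))"
  proof (rule ex1I[of _ ?h])
    have "[Var x] \<in> E.Z" if "x \<in> X" for x
      using that by (auto simp: rb_words_over_def Cons_words_over)
    then show "?h \<in> nonunitary_rb_hom R E.F B \<and> ?h \<in> extensional (carrier E.F) \<and>
        (\<forall>x\<in>X. f x = ?h (word_j R x))"
      using E.restrict_lift_hom by (auto simp: word_j_def E.restrict_lift_basis simp del: restrict_apply)
    show "h = ?h" if "h \<in> nonunitary_rb_hom R E.F B \<and> h \<in> extensional (carrier E.F) \<and>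
        (\<forall>x\<in>X. f x = h (word_j R x))" for h
      by (rule E.hom_unique) (use that in \<open>auto simp: word_j_def\<close>)
  qed
qed (simp_all add: nonunitary_rb_words_over word_j_closed)

lemma free_words:
  "free_rota_baxter_algebra TYPE('b) R lam X
     (word_rb R lam (rb_words_over True X)) (word_j R)"
  unfolding free_rota_baxter_algebra_def
proof (intro conjI allI impI ballI)
  fix B :: "('k, 'b) rb_structure" and f
  assume B: "rota_baxter_algebra R lam B" and f: "f \<in> X \<rightarrow> carrier B"
  interpret E: rb_evaluation R lam B f True X
    by (intro rb_evaluation.intro rb_evaluation_axioms.intro
        rota_baxter_algebra.axioms(1)[OF B] rota_baxter_algebra.axioms(2)[OF B]) (use f in auto)
  let ?h = "restrict E.lift (free_carrier R E.Z)"
  show "\<exists>!h. h \<in> rb_hom R E.F B \<and> h \<in> extensional (carrier E.F) \<and> (\<forall>x\<in>X. f x = h (word_j R x))"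
  proof (rule ex1I[of _ ?h])
    have "[Var x] \<in> E.Z" if "x \<in> X" for x
      using that by (auto simp: rb_words_over_def Cons_words_over)
    moreover have "?h (basis R []) = \<one>\<^bsub>B\<^esub>"
      using E.restrict_lift_basis[of "[]"] by (simp add: rb_words_over_def del: restrict_apply)
    ultimately show "?h \<in> rb_hom R E.F B \<and> ?h \<in> extensional (carrier E.F) \<and>
        (\<forall>x\<in>X. f x = ?h (word_j R x))"
      using E.restrict_lift_hom
      by (auto simp: rb_hom_def word_j_def E.restrict_lift_basis simp del: restrict_apply)
    show "h = ?h" if "h \<in> rb_hom R E.F B \<and> h \<in> extensional (carrier E.F) \<and>
        (\<forall>x\<in>X. f x = h (word_j R x))" for h
      by (rule E.hom_unique) (use that in \<open>auto simp: word_j_def rb_hom_def\<close>)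
  qed
qed (simp_all add: rb_words_over_unitary word_j_closed)

end

section \<open>Words and Motzkin paths\<close>

lemma motzkin_paths_height: "p \<in> motzkin_paths X \<Longrightarrow> 0 \<le> height (take i p)"
  by (cases "i \<le> length p") (auto simp: motzkin_paths_def)

lemma motzkin_pathsI:
  "\<lbrakk>set p \<subseteq> {Up, Down} \<union> Level ` X; \<And>i. 0 \<le> height (take i p); height p = 0\<rbrakk> \<Longrightarrow> p \<in> motzkin_paths X"
  by (auto simp: motzkin_paths_def)

lemma motzkin_paths_steps: "p \<in> motzkin_paths X \<Longrightarrow> set p \<subseteq> {Up, Down} \<union> Level ` X"
  by (auto simp: motzkin_paths_def)

lemma motzkin_paths_height_0: "p \<in> motzkin_paths X \<Longrightarrow> height p = 0"
  by (auto simp: motzkin_paths_def)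

lemma motzkin_paths_Nil: "[] \<in> motzkin_paths X"
  by (auto simp: motzkin_paths_def height_def)

lemma motzkin_paths_append:
  assumes "p \<in> motzkin_paths X" "q \<in> motzkin_paths X"
  shows "p @ q \<in> motzkin_paths X"
  using assms motzkin_paths_height[OF assms(1)] motzkin_paths_height[OF assms(2)]
  by (intro motzkin_pathsI) (auto simp: height_append motzkin_paths_height_0 dest: motzkin_paths_steps)

lemma indecomposable_Level: "x \<in> X \<Longrightarrow> indecomposable_path X [Level x]"
  by (auto simp: indecomposable_path_def motzkin_paths_def axis_visits_def height_def take_Cons'
      split: if_splits)

lemma height_take_raise_path:
  assumes "p \<in> motzkin_paths X" "0 < i" "i < length (raise_path p)"
  shows "0 < height (take i (raise_path p))"
proof -
  obtain j where i: "i = Suc j" using assms(2) by (cases i) auto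
  have "height (take i (raise_path p)) = 1 + height (take j p)"
    using assms(3) by (simp add: i raise_path_def height_def)
  then show ?thesis using motzkin_paths_height[OF assms(1), of j] by simp
qed

lemma indecomposable_raise_path:
  assumes "p \<in> motzkin_paths X"
  shows "indecomposable_path X (raise_path p)"
proof -
  have ht: "height (raise_path p) = 0"
    using motzkin_paths_height_0[OF assms] by (simp add: raise_path_def height_def)
  have "0 \<le> height (take i (raise_path p))" for i
    using height_take_raise_path[OF assms, of i] ht
    by (cases "i = 0"; cases "i < length (raise_path p)") (auto simp: height_def)
  then have "raise_path p \<in> motzkin_paths X"
    using ht motzkin_paths_steps[OF assms] by (intro motzkin_pathsI) (auto simp: raise_path_def)
  moreover have "axis_visits (raise_path p) \<subseteq> {0, length (raise_path p)}"
  proof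
    fix i assume i: "i \<in> axis_visits (raise_path p)"
    then have "\<not> (0 < i \<and> i < length (raise_path p))"
      using height_take_raise_path[OF assms, of i] by (auto simp: axis_visits_def)
    with i show "i \<in> {0, length (raise_path p)}"
      by (auto simp: axis_visits_def)
  qed
  ultimately show ?thesis by (simp add: indecomposable_path_def)
qed

text \<open>
  The part up to the first return to the axis is the first indecomposable factor, and heights after
  it are unchanged because the cut is made at height zero.
\<close>

lemma first_return_split:
  assumes p: "p \<in> motzkin_paths X" "p \<noteq> []"
  obtains q r where "p = q @ r" "q \<noteq> []" "indecomposable_path X q" "r \<in> motzkin_paths X"
proof
  let ?n = "first_return p"
  have fin: "finite (axis_visits p - {0})"
    by (rule finite_subset[of _ "{..length p}"]) (auto simp: axis_visits_def)
  have "length p \<in> axis_visits p - {0}"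
    using p motzkin_paths_height_0 by (auto simp: axis_visits_def)
  then have "?n \<in> axis_visits p - {0}"
    unfolding first_return_def using fin by (intro Min_in) auto
  then have n: "0 < ?n" "?n \<le> length p" "height (take ?n p) = 0" by (auto simp: axis_visits_def)
  show "p = take ?n p @ drop ?n p" by simp
  show "take ?n p \<noteq> []" using n(1) p(2) by simp
  have "take ?n p \<in> motzkin_paths X"
    using n motzkin_paths_height[OF p(1)] motzkin_paths_steps[OF p(1)] set_take_subset[of ?n p]
    by (intro motzkin_pathsI) auto
  moreover have "axis_visits (take ?n p) \<subseteq> {0, length (take ?n p)}"
  proof
    fix i assume "i \<in> axis_visits (take ?n p)"
    then have i: "i \<le> ?n" "height (take i p) = 0"
      using n(2) by (auto simp: axis_visits_def min_absorb1)
    have "i = 0 \<or> ?n \<le> i"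
      unfolding first_return_def using i n(2) fin
      by (auto intro!: Min_le simp: axis_visits_def)
    then show "i \<in> {0, length (take ?n p)}" using i n(2) by auto
  qed
  ultimately show "indecomposable_path X (take ?n p)" by (simp add: indecomposable_path_def)
  have "height (take i (drop ?n p)) = height (take (?n + i) p)" for i
    using n(3) height_append[of "take ?n p" "take i (drop ?n p)"] by (simp add: take_add)
  moreover have "height (drop ?n p) = height p"
    using n(3) height_append[of "take ?n p" "drop ?n p"] by simp
  ultimately show "drop ?n p \<in> motzkin_paths X"
    using motzkin_paths_height[OF p(1)] motzkin_paths_steps[OF p(1)] set_drop_subset[of ?n p]
      motzkin_paths_height_0[OF p(1)]
    by (intro motzkin_pathsI) auto
qed

lemma word_to_path_motzkin: "W \<in> words_over True X \<Longrightarrow> word_to_path W \<in> motzkin_paths X"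
proof (induction W rule: word_to_path.induct)
  case (2 x W)
  then have "[Level x] \<in> motzkin_paths X" "word_to_path W \<in> motzkin_paths X"
    using indecomposable_Level[of x X]
    by (auto simp: Cons_words_over indecomposable_path_def motzkin_paths_Nil)
  then show ?case using motzkin_paths_append[of "[Level x]" X "word_to_path W"] by simp
next
  case (3 V W)
  then have "raise_path (word_to_path V) \<in> motzkin_paths X" "word_to_path W \<in> motzkin_paths X"
    using indecomposable_raise_path[of "word_to_path V" X]
    by (auto simp: Cons_words_over indecomposable_path_def motzkin_paths_Nil)
  then show ?case using motzkin_paths_append by simp
qed (simp add: motzkin_paths_Nil)

text \<open>
  Inside a bracket, the path of a word is followed by the down step that closes the bracket. As no
  path of a word starts with a down step, that step cannot belong to a further letter and so shows
  where the word ends. The remainders \<open>s\<close>, \<open>s'\<close> make the statement inductive.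
\<close>

lemma word_to_path_inj_aux:
  "\<lbrakk>word_to_path W @ s = word_to_path W' @ s'; s = [] \<or> hd s = Down; s' = [] \<or> hd s' = Down\<rbrakk>
    \<Longrightarrow> W = W' \<and> s = s'"
proof (induction W arbitrary: W' s s' rule: word_to_path.induct)
  case 1
  then show ?case by (cases W' rule: word_to_path.cases) (auto simp: raise_path_def)
next
  case (2 x W)
  show ?case
  proof (cases W' rule: word_to_path.cases)
    case (2 x' W'')
    then have "x = x'" "word_to_path W @ s = word_to_path W'' @ s'" using "2.prems"(1) by auto
    then show ?thesis using "2.IH"[of s W'' s'] "2.prems"(2,3) 2 by simp
  qed (use "2.prems" in \<open>auto simp: raise_path_def\<close>)
next
  case (3 V W)
  show ?case
  proof (cases W' rule: word_to_path.cases)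
    case (3 V' W'')
    then have
      "word_to_path V @ Down # word_to_path W @ s = word_to_path V' @ Down # word_to_path W'' @ s'"
      using "3.prems"(1) by (simp add: raise_path_def)
    from "3.IH"(1)[OF this] have VW: "V = V'" "word_to_path W @ s = word_to_path W'' @ s'" by auto
    show ?thesis using "3.IH"(2)[OF VW(2) "3.prems"(2,3)] VW(1) 3 by simp
  qed (use "3.prems" in \<open>auto simp: raise_path_def\<close>)
qed

lemma inj_word_to_path: "inj word_to_path"
  by (rule injI) (use word_to_path_inj_aux[of _ "[]" _ "[]"] in auto)

text \<open>
  The first indecomposable factor is a level step or a raised path, hence the path of a letter; a
  raised path is longer than its interior, and the remainder of the path is shorter than the path,
  so induction on the length applies to both.
\<close>

lemma word_to_path_surj:
  "p \<in> motzkin_paths X \<Longrightarrow> \<exists>W\<in>words_over True X. word_to_path W = p"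
proof (induction "length p" arbitrary: p rule: less_induct)
  case less
  show ?case
  proof (cases "p = []")
    case True
    then show ?thesis by (intro bexI[of _ "[]"]) auto
  next
    case False
    then obtain q r where qr: "p = q @ r" "q \<noteq> []" "indecomposable_path X q" "r \<in> motzkin_paths X"
      using first_return_split less.prems by blast
    then obtain W where W: "W \<in> words_over True X" "word_to_path W = r"
      using less.hyps[of r] by auto
    from qr(3,2) show ?thesis
    proof (cases rule: indecomposable_path_cases)
      case (1 x)
      then show ?thesis using W qr(1) by (intro bexI[of _ "Var x # W"]) (auto simp: Cons_words_over)
    next
      case (2 q')
      then obtain V where "V \<in> words_over True X" "word_to_path V = q'"
        using less.hyps[of q'] qr(1) by (auto simp: raise_path_def)
      then show ?thesis
        using W qr(1) 2 by (intro bexI[of _ "Br V # W"]) (auto simp: Cons_words_over)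
    qed
  qed
qed

lemma bij_word_to_path: "bij_betw word_to_path (words_over True X) (motzkin_paths X)"
  unfolding bij_betw_def
proof
  show "inj_on word_to_path (words_over True X)"
    by (rule inj_on_subset[OF inj_word_to_path subset_UNIV])
  show "word_to_path ` words_over True X = motzkin_paths X"
    by (auto simp: image_iff intro: word_to_path_motzkin dest: word_to_path_surj)
qed

lemma word_to_path_eq_Nil [simp]: "word_to_path W = [] \<longleftrightarrow> W = []"
  by (cases W rule: word_to_path.cases) (auto simp: raise_path_def)

lemma hd_word_to_path:
  "W \<noteq> [] \<Longrightarrow> hd (word_to_path W) = (case hd W of Var x \<Rightarrow> Level x | Br V \<Rightarrow> Up)"
  by (cases W rule: word_to_path.cases) (auto simp: raise_path_def)

lemma last_word_to_path:
  "W \<noteq> [] \<Longrightarrow> last (word_to_path W) = (case last W of Var x \<Rightarrow> Level x | Br V \<Rightarrow> Down)"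
  by (induction W rule: word_to_path.induct) (auto simp: raise_path_def)

definition avoids :: "'a \<Rightarrow> 'a \<Rightarrow> 'a list \<Rightarrow> bool" where
  "avoids a b p \<longleftrightarrow> (\<nexists>u v. p = u @ [a, b] @ v)"

lemma avoids_iff_successively: "avoids a b p \<longleftrightarrow> successively (\<lambda>s t. s = a \<longrightarrow> t \<noteq> b) p"
  unfolding avoids_def successively_iff_factors by blast

lemma avoids_Nil [simp]: "avoids a b []"
  by (simp add: avoids_def)

lemma avoids_Cons [simp]: "avoids a b (x # p) \<longleftrightarrow> avoids a b p \<and> (p = [] \<or> x \<noteq> a \<or> hd p \<noteq> b)"
  by (auto simp: avoids_iff_successively successively_Cons)

lemma avoids_append [simp]:
  "avoids a b (p @ q) \<longleftrightarrow>
     avoids a b p \<and> avoids a b q \<and> (p = [] \<or> q = [] \<or> last p \<noteq> a \<or> hd q \<noteq> b)"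
  by (auto simp: avoids_iff_successively successively_append_iff)

text \<open>
  A down step ends the path of a bracket and an up step begins one, so a valley occurs exactly
  between two adjacent brackets.
\<close>

lemma avoids_valley_word_to_path:
  "avoids Down Up (word_to_path W) \<longleftrightarrow> no_adjacent_brackets W"
proof (induction W rule: word_to_path.induct)
  case (2 x W)
  then show ?case by (simp add: no_adjacent_brackets_Cons)
next
  case (3 V W)
  have "avoids Down Up (word_to_path (Br V # W)) \<longleftrightarrow> avoids Down Up (word_to_path V) \<and>
      avoids Down Up (word_to_path W) \<and> (W = [] \<or> hd (word_to_path W) \<noteq> Up)"
    by (auto simp: raise_path_def)
  moreover have "W = [] \<or> hd (word_to_path W) \<noteq> Up \<longleftrightarrow> W = [] \<or> (\<nexists>V'. hd W = Br V')"
    by (cases "W = []"; cases "hd W") (auto simp: hd_word_to_path)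
  ultimately show ?case using "3.IH" by (simp only: no_adjacent_brackets_Cons)
qed simp

text \<open>
  No path of a nonempty word begins with a down step, so a peak occurs exactly at an empty
  bracket.
\<close>

lemma avoids_peak_word_to_path:
  "W \<in> words_over True X \<Longrightarrow>
    avoids Up Down (word_to_path W) \<longleftrightarrow> W \<in> lists (bracket_letters False X)"
proof (induction W rule: word_to_path.induct)
  case (2 x W)
  then show ?case by (auto simp: Cons_words_over)
next
  case (3 V W)
  have "avoids Up Down (word_to_path (Br V # W)) \<longleftrightarrow> V \<noteq> [] \<and>
      avoids Up Down (word_to_path V) \<and> avoids Up Down (word_to_path W)"
  proof (cases "V = []")
    case False
    then have "hd (word_to_path V) \<noteq> Down" "last (word_to_path V) \<noteq> Up"
      by (simp_all add: hd_word_to_path last_word_to_path split: letter.split)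
    then show ?thesis using False by (simp add: raise_path_def)
  qed (simp add: raise_path_def)
  moreover have "V \<in> words_over True X" "W \<in> words_over True X"
    using "3.prems" by (auto simp: Cons_words_over)
  ultimately show ?case using "3.IH" by (auto simp: words_over_def simp del: word_to_path.simps)
qed simp

lemma bij_betw_Collect:
  assumes "bij_betw f A B" "\<And>a. a \<in> A \<Longrightarrow> P a \<longleftrightarrow> Q (f a)"
  shows "bij_betw f {a \<in> A. P a} {b \<in> B. Q b}"
  using assms unfolding bij_betw_def inj_on_def by blast

lemma bij_rb_words: "bij_betw word_to_path (rb_words_over True X) (valley_free X)"
  unfolding rb_words_over_def valley_free_def avoids_def[symmetric]
  by (rule bij_betw_Collect[OF bij_word_to_path]) (simp add: avoids_valley_word_to_path)

lemma bij_rb_words_nonunitary: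
  "bij_betw word_to_path (rb_words_over False X) (peak_free X \<inter> valley_free X)"
proof -
  have words: "rb_words_over False X =
      {W \<in> words_over True X. W \<noteq> [] \<and> W \<in> lists (bracket_letters False X) \<and> no_adjacent_brackets W}"
    using words_over_mono by (auto simp: rb_words_over_def words_over_def)
  have paths: "peak_free X \<inter> valley_free X =
      {p \<in> motzkin_paths X. p \<noteq> [] \<and> avoids Up Down p \<and> avoids Down Up p}"
    unfolding peak_free_def valley_free_def avoids_def by blast
  show ?thesis
    unfolding words paths
    by (rule bij_betw_Collect[OF bij_word_to_path])
      (simp add: avoids_valley_word_to_path avoids_peak_word_to_path)
qed

section \<open>The isomorphism\<close>

lemma path_rb_simps [simp]:
  "carrier (path_rb R lam Y) = free_carrier R Y"
  "zero (path_rb R lam Y) = free_zero R"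
  "add (path_rb R lam Y) = free_add R"
  "smult (path_rb R lam Y) = free_smult R"
  "one (path_rb R lam Y) = basis R []"
  by (simp_all add: path_rb_def)

lemma mult_path_rb: "mult (path_rb R lam Y) = bilin_ext R (diamond_v_basis R lam)"
  by (simp add: path_rb_def)

lemma rb_op_path_rb: "rb_op (path_rb R lam Y) = lin_ext R (\<lambda>p. basis R (raise_path p))"
  by (simp add: path_rb_def)

lemma word_to_path_concat: "word_to_path W = concat (map (\<lambda>a. word_to_path [a]) W)"
  by (induction W rule: word_to_path.induct) auto

lemma words_over_UNIV [simp]: "W \<in> words_over True UNIV"
  by (induction W rule: word_to_path.induct) (auto simp: Cons_words_over)

text \<open>
  Letters correspond to nontrivial indecomposable factors, which is why the decompositions that the
  two products use correspond to each other.
\<close>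

lemma indecomposable_letter: "indecomposable_path UNIV (word_to_path [a])"
  by (cases a) (auto intro!: indecomposable_Level indecomposable_raise_path word_to_path_motzkin)

context rb_weight
begin

definition path_map :: "('x bword \<Rightarrow> 'k) \<Rightarrow> 'x step list \<Rightarrow> 'k" where
  "path_map = lin_ext R (\<lambda>W. basis R (word_to_path W))"

lemma lin_ext_rename:
  "c \<in> free_carrier R UNIV \<Longrightarrow>
    lin_ext R (\<lambda>z. basis R (h z)) (lin_ext R (\<lambda>w. basis R (g w)) c) =
    lin_ext R (\<lambda>w. basis R (h (g w))) c"
  by (simp add: lin_ext_lin_ext[of UNIV _ UNIV _ UNIV] lin_ext_basis[of _ _ UNIV])

text \<open>
  Both products obey the same recursion: at a meeting point of words it is the one on letters, at a
  meeting point of paths the one on indecomposable factors, given by \<open>diamond_v_basis_concat\<close>.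
\<close>

lemma path_map_diamond:
  fixes W W' :: "'x bword" and a b :: "'x letter"
  shows "path_map (diamond_w_basis R lam W W') =
      diamond_v_basis R lam (word_to_path W) (word_to_path W')"
    and "path_map (diamond_w_letter R lam a b) =
      diamond_v_indec R lam (word_to_path [a]) (word_to_path [b])"
proof (induction W W' and a b rule: diamond_induct)
  case (words W W')
  show ?case
  proof (cases "W = [] \<or> W' = []")
    case True
    then show ?thesis
      by (auto simp: path_map_def lin_ext_basis[of _ _ UNIV] diamond_v_basis.simps)
  next
    case False
    let ?ps = "map (\<lambda>a. word_to_path [a])"
    have "diamond_v_basis R lam (word_to_path W) (word_to_path W') =
        diamond_v_basis R lam (concat (?ps W)) (concat (?ps W'))"
      by (simp add: word_to_path_concat[symmetric])
    also have "\<dots> = lin_ext R (\<lambda>z. basis R (concat (butlast (?ps W)) @ z @ concat (tl (?ps W'))))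
        (diamond_v_indec R lam (last (?ps W)) (hd (?ps W')))"
      by (rule diamond_v_basis_concat[of _ UNIV]) (use False indecomposable_letter in auto)
    also have "\<dots> = lin_ext R (\<lambda>z. basis R (word_to_path (butlast W) @ z @ word_to_path (tl W')))
        (path_map (diamond_w_letter R lam (last W) (hd W')))"
      using False words
      by (simp add: map_butlast[symmetric] map_tl[symmetric] last_map list.map_sel(1)
          word_to_path_concat[symmetric] del: word_to_path.simps)
    also have "\<dots> = lin_ext R (\<lambda>Z. basis R (word_to_path (butlast W @ Z @ tl W')))
        (diamond_w_letter R lam (last W) (hd W'))"
      by (simp add: path_map_def lin_ext_rename word_to_path_append)
    also have "\<dots> = path_map (diamond_w_basis R lam W W')"
      using False by (simp add: path_map_def diamond_w_basis.simps lin_ext_rename)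
    finally show ?thesis ..
  qed
next
  case (var_left x a)
  then show ?case
    using word_to_path_append[of "[Var x]" "[a]"]
    by (simp add: path_map_def lin_ext_basis[of _ _ UNIV] diamond_v_indec_level)
next
  case (var_right U x)
  then show ?case
    by (simp add: path_map_def lin_ext_basis[of _ _ UNIV] diamond_v_indec_level)
next
  case (brackets U V)
  have raise: "path_map (lin_ext R (\<lambda>Z. basis R [Br Z]) c) =
      lin_ext R (\<lambda>z. basis R (raise_path z)) (path_map c)"
    if "c \<in> free_carrier R UNIV" for c :: "'x bword \<Rightarrow> 'k"
    using that by (simp add: path_map_def lin_ext_rename)
  have op: "lin_ext R (\<lambda>Z. basis R [Br Z]) c \<in> free_carrier R UNIV"
    if "c \<in> free_carrier R UNIV" for c :: "'x bword \<Rightarrow> 'k"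
    using that by (intro lin_ext_closed[of UNIV]) auto
  have "path_map (diamond_w_letter R lam (Br U) (Br V)) =
    free_add R
      (free_add R
        (path_map (lin_ext R (\<lambda>Z. basis R [Br Z]) (diamond_w_basis R lam U [Br V])))
        (path_map (lin_ext R (\<lambda>Z. basis R [Br Z]) (diamond_w_basis R lam [Br U] V))))
      (free_smult R lam
        (path_map (lin_ext R (\<lambda>Z. basis R [Br Z]) (diamond_w_basis R lam U V))))"
    by (simp add: path_map_def lin_ext_add[of UNIV] lin_ext_smult[of UNIV] op)
  then show ?case
    using brackets by (simp add: raise diamond_v_indec_raise)
qed

context
  fixes e :: bool and X :: "'x set" and V :: "'x step list set"
  assumes bij: "bij_betw word_to_path (rb_words_over e X) V"
begin

lemma path_map_closed:
  "c \<in> free_carrier R (rb_words_over e X) \<Longrightarrow> path_map c \<in> free_carrier R V"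
  unfolding path_map_def by (rule lin_ext_closed) (use bij_betw_apply[OF bij] in auto)

lemma linear_on_path_map: "linear_on R (rb_words_over e X) (free_module R V) path_map"
  unfolding path_map_def by (rule linear_on_lin_ext) (use bij_betw_apply[OF bij] in auto)

lemma diamond_v_closed:
  assumes "p \<in> V" "p' \<in> V"
  shows "diamond_v_basis R lam p p' \<in> free_carrier R V"
proof -
  obtain W W' where W: "W \<in> rb_words_over e X" "W' \<in> rb_words_over e X"
    and p: "p = word_to_path W" "p' = word_to_path W'"
    using assms bij unfolding bij_betw_def by blast
  show ?thesis
    unfolding p path_map_diamond[symmetric]
    by (intro path_map_closed diamond_closed mult_stable_rb_words_over W)
qed

lemma path_map_mult:
  assumes "x \<in> free_carrier R (rb_words_over e X)" "y \<in> free_carrier R (rb_words_over e X)"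
  shows "path_map (bilin_ext R (diamond_w_basis R lam) x y) =
    bilin_ext R (diamond_v_basis R lam) (path_map x) (path_map y)"
proof (rule module.bilinear_eqI[OF module_free_module,
      where f = "\<lambda>x y. path_map (bilin_ext R (diamond_w_basis R lam) x y)"
        and g = "\<lambda>x y. bilin_ext R (diamond_v_basis R lam) (path_map x) (path_map y)",
      OF _ _ _ _ _ assms])
  let ?Y = "rb_words_over e X"
  have cl: "diamond_w_basis R lam W W' \<in> free_carrier R ?Y" if "W \<in> ?Y" "W' \<in> ?Y" for W W'
    using that by (intro diamond_closed mult_stable_rb_words_over)
  show "linear_on R ?Y (free_module R V) (\<lambda>x. path_map (bilin_ext R (diamond_w_basis R lam) x y))"
    if "y \<in> free_carrier R ?Y" for y
    using linear_on_comp[OF linear_on_bilin_left[OF cl that] linear_on_path_map] .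
  show "linear_on R ?Y (free_module R V)
      (\<lambda>x. bilin_ext R (diamond_v_basis R lam) (path_map x) (path_map y))"
    if "y \<in> free_carrier R ?Y" for y
    using linear_on_comp[OF linear_on_path_map
        linear_on_bilin_left[OF diamond_v_closed path_map_closed[OF that]]] .
  show "linear_on R ?Y (free_module R V) (\<lambda>y. path_map (bilin_ext R (diamond_w_basis R lam) x y))"
    if "x \<in> free_carrier R ?Y" for x
    using linear_on_comp[OF linear_on_bilin_right[OF cl that] linear_on_path_map] .
  show "linear_on R ?Y (free_module R V)
      (\<lambda>y. bilin_ext R (diamond_v_basis R lam) (path_map x) (path_map y))"
    if "x \<in> free_carrier R ?Y" for x
    using linear_on_comp[OF linear_on_path_map
        linear_on_bilin_right[OF diamond_v_closed path_map_closed[OF that]]] .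
  show "path_map (bilin_ext R (diamond_w_basis R lam) (basis R W) (basis R W')) =
      bilin_ext R (diamond_v_basis R lam) (path_map (basis R W)) (path_map (basis R W'))"
    if "W \<in> ?Y" "W' \<in> ?Y" for W W'
  proof -
    have "path_map (basis R U) = basis R (word_to_path U)" for U :: "'x bword"
      unfolding path_map_def by (rule lin_ext_basis[of _ _ UNIV]) simp
    moreover have "diamond_v_basis R lam (word_to_path W) (word_to_path W') \<in> free_carrier R V"
      using that bij_betw_apply[OF bij] by (intro diamond_v_closed)
    ultimately show ?thesis
      by (simp add: bilin_ext_basis[of _ _ _ UNIV] path_map_diamond)
  qed
qed

lemma path_map_hom:
  "path_map \<in> nonunitary_rb_hom R (word_rb R lam (rb_words_over e X)) (path_rb R lam V)"
proof -
  have "path_map (lin_ext R (\<lambda>Z. basis R [Br Z]) c) =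
      lin_ext R (\<lambda>z. basis R (raise_path z)) (path_map c)"
    if "c \<in> free_carrier R UNIV" for c :: "'x bword \<Rightarrow> 'k"
    using that by (simp add: path_map_def lin_ext_rename)
  then show ?thesis
    using linear_on_path_map unfolding nonunitary_rb_hom_def linear_on_def
    by (auto simp: mult_word_rb mult_path_rb rb_op_word_rb rb_op_path_rb path_map_mult)
qed

lemma bij_path_map:
  "bij_betw path_map (free_carrier R (rb_words_over e X)) (free_carrier R V)"
  unfolding path_map_def by (rule lin_ext_bij_betw[OF bij])

end

lemma path_map_one: "path_map (basis R []) = basis R []"
  unfolding path_map_def by (subst lin_ext_basis[of _ _ UNIV]) auto

end

text \<open>
  The Rota--Baxter identity and the laws of the product are equations, so they pass to a
  surjective image.
\<close>

lemma nonunitary_rb_image: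
  fixes A :: "('k, 'a, 'm) rb_structure_scheme" and B :: "('k, 'b, 'n) rb_structure_scheme"
  assumes A: "nonunitary_rota_baxter_algebra R lam A" and B: "module R B"
    and h: "h \<in> nonunitary_rb_hom R A B" and surj: "h ` carrier A = carrier B"
  shows "nonunitary_rota_baxter_algebra R lam B"
proof -
  interpret A: nonunitary_rota_baxter_algebra R lam A by (rule A)
  interpret B: module R B by (rule B)
  note cl = A.mult_closed A.rb_op_closed A.weight_closed
  have im: "h x \<in> carrier B" if "x \<in> carrier A" for x
    using h that by (auto simp: nonunitary_rb_hom_def)
  have hom: "h x \<oplus>\<^bsub>B\<^esub> h y = h (x \<oplus>\<^bsub>A\<^esub> y)" "h x \<otimes>\<^bsub>B\<^esub> h y = h (x \<otimes>\<^bsub>A\<^esub> y)"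
    if "x \<in> carrier A" "y \<in> carrier A" for x y
    using h that by (auto simp: nonunitary_rb_hom_def)
  have op: "rb_op B (h x) = h (rb_op A x)" if "x \<in> carrier A" for x
    using h that by (auto simp: nonunitary_rb_hom_def)
  have smult: "a \<odot>\<^bsub>B\<^esub> h x = h (a \<odot>\<^bsub>A\<^esub> x)" if "a \<in> carrier R" "x \<in> carrier A" for a x
    using h that by (auto simp: nonunitary_rb_hom_def)
  have ex: "\<exists>x\<in>carrier A. y = h x" if "y \<in> carrier B" for y using surj that by blast
  show ?thesis
  proof
    fix x y assume xy: "x \<in> carrier B" "y \<in> carrier B"
    from ex[OF xy(1)] ex[OF xy(2)] obtain x' y'
      where *: "x' \<in> carrier A" "y' \<in> carrier A" "x = h x'" "y = h y'" by blast
    show "x \<otimes>\<^bsub>B\<^esub> y \<in> carrier B" using * by (simp add: hom im cl)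
    show "rb_op B (x \<oplus>\<^bsub>B\<^esub> y) = rb_op B x \<oplus>\<^bsub>B\<^esub> rb_op B y"
      using * by (simp add: hom op cl A.rb_op_add)
    show "rb_op B x \<otimes>\<^bsub>B\<^esub> rb_op B y = rb_op B (x \<otimes>\<^bsub>B\<^esub> rb_op B y) \<oplus>\<^bsub>B\<^esub> rb_op B (rb_op B x \<otimes>\<^bsub>B\<^esub> y)
        \<oplus>\<^bsub>B\<^esub> lam \<odot>\<^bsub>B\<^esub> rb_op B (x \<otimes>\<^bsub>B\<^esub> y)"
      using * by (simp add: hom op cl smult A.rota_baxter)
    fix z assume "z \<in> carrier B"
    from ex[OF this] obtain z' where **: "z' \<in> carrier A" "z = h z'" by blast
    show "x \<otimes>\<^bsub>B\<^esub> y \<otimes>\<^bsub>B\<^esub> z = x \<otimes>\<^bsub>B\<^esub> (y \<otimes>\<^bsub>B\<^esub> z)" using * ** by (simp add: hom cl A.mult_assoc)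
    show "(x \<oplus>\<^bsub>B\<^esub> y) \<otimes>\<^bsub>B\<^esub> z = x \<otimes>\<^bsub>B\<^esub> z \<oplus>\<^bsub>B\<^esub> y \<otimes>\<^bsub>B\<^esub> z" using * ** by (simp add: hom cl A.distr_left)
    show "z \<otimes>\<^bsub>B\<^esub> (x \<oplus>\<^bsub>B\<^esub> y) = z \<otimes>\<^bsub>B\<^esub> x \<oplus>\<^bsub>B\<^esub> z \<otimes>\<^bsub>B\<^esub> y" using * ** by (simp add: hom cl A.distr_right)
  next
    fix a x y assume a: "a \<in> carrier R" and xy: "x \<in> carrier B" "y \<in> carrier B"
    from ex[OF xy(1)] ex[OF xy(2)] obtain x' y'
      where *: "x' \<in> carrier A" "y' \<in> carrier A" "x = h x'" "y = h y'" by blast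
    show "(a \<odot>\<^bsub>B\<^esub> x) \<otimes>\<^bsub>B\<^esub> y = a \<odot>\<^bsub>B\<^esub> (x \<otimes>\<^bsub>B\<^esub> y)" "x \<otimes>\<^bsub>B\<^esub> (a \<odot>\<^bsub>B\<^esub> y) = a \<odot>\<^bsub>B\<^esub> (x \<otimes>\<^bsub>B\<^esub> y)"
      using * a by (simp_all add: hom cl smult A.smult_mult_left A.smult_mult_right)
  next
    fix x assume "x \<in> carrier B"
    from ex[OF this] obtain x' where *: "x' \<in> carrier A" "x = h x'" by blast
    show "rb_op B x \<in> carrier B" using * by (simp add: op im cl)
    show "rb_op B (a \<odot>\<^bsub>B\<^esub> x) = a \<odot>\<^bsub>B\<^esub> rb_op B x" if "a \<in> carrier R" for a
      using * that by (simp add: op cl smult A.rb_op_smult)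
  qed (rule A.weight_closed)
qed

lemma rb_image:
  fixes A :: "('k, 'a, 'm) rb_structure_scheme" and B :: "('k, 'b, 'n) rb_structure_scheme"
  assumes A: "rota_baxter_algebra R lam A" and B: "module R B"
    and h: "h \<in> rb_hom R A B" and surj: "h ` carrier A = carrier B"
  shows "rota_baxter_algebra R lam B"
proof -
  interpret A: rota_baxter_algebra R lam A by (rule A)
  have h': "h \<in> nonunitary_rb_hom R A B" and one: "h \<one>\<^bsub>A\<^esub> = \<one>\<^bsub>B\<^esub>" using h by (auto simp: rb_hom_def)
  interpret B: nonunitary_rota_baxter_algebra R lam B
    by (rule nonunitary_rb_image[OF A.nonunitary_rota_baxter_algebra_axioms B h' surj])
  have im: "h x \<in> carrier B" and hom: "h x \<otimes>\<^bsub>B\<^esub> h y = h (x \<otimes>\<^bsub>A\<^esub> y)"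
    if "x \<in> carrier A" "y \<in> carrier A" for x y
    using h' that by (auto simp: nonunitary_rb_hom_def)
  have "monoid B"
  proof (rule monoidI)
    show "\<one>\<^bsub>B\<^esub> \<in> carrier B" using im one by (metis A.one_closed)
    fix y assume "y \<in> carrier B"
    then obtain x where x: "x \<in> carrier A" "y = h x" using surj by blast
    show "\<one>\<^bsub>B\<^esub> \<otimes>\<^bsub>B\<^esub> y = y" "y \<otimes>\<^bsub>B\<^esub> \<one>\<^bsub>B\<^esub> = y" using x by (simp_all add: hom flip: one)
  qed (rule B.mult_closed B.mult_assoc; assumption)+
  then show ?thesis
    by (rule rota_baxter_algebra.intro[OF B.nonunitary_rota_baxter_algebra_axioms])
qed

theorem corollary6p4:
  fixes k :: "('k, 'c) ring_scheme" and lam :: 'k and X :: "'x set"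
  assumes "cring k" and "lam \<in> carrier k" and "X \<noteq> {}"
  shows
    "bij_betw word_to_path (rb_words X) (valley_free X) \<and>
     (\<forall>W \<in> rb_words X.
        lin_ext k (\<lambda>W. basis k (word_to_path W)) (basis k W) = basis k (word_to_path W)) \<and>
     rota_baxter_algebra k lam (word_rb k lam (rb_words X)) \<and>
     rota_baxter_algebra k lam (path_rb k lam (valley_free X)) \<and>
     lin_ext k (\<lambda>W. basis k (word_to_path W))
       \<in> rb_iso k (word_rb k lam (rb_words X)) (path_rb k lam (valley_free X)) \<and>
     bij_betw word_to_path (bracketed_words_S X \<inter> rb_words X) (peak_free X \<inter> valley_free X) \<and>
     nonunitary_rota_baxter_algebra k lam (word_rb k lam (bracketed_words_S X \<inter> rb_words X)) \<and>
     nonunitary_rota_baxter_algebra k lam (path_rb k lam (peak_free X \<inter> valley_free X)) \<and>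
     lin_ext k (\<lambda>W. basis k (word_to_path W))
       \<in> nonunitary_rb_iso k (word_rb k lam (bracketed_words_S X \<inter> rb_words X))
           (path_rb k lam (peak_free X \<inter> valley_free X)) \<and>
     free_rota_baxter_algebra TYPE('b) k lam X (word_rb k lam (rb_words X)) (word_j k) \<and>
     free_nonunitary_rota_baxter_algebra TYPE('b) k lam X
       (word_rb k lam (bracketed_words_S X \<inter> rb_words X)) (word_j k)"
proof -
  interpret rb_weight k lam
    by (intro rb_weight.intro rb_weight_axioms.intro assms)
  note bij = bij_rb_words[of X] and bij' = bij_rb_words_nonunitary[of X]
  have module_path: "module k (path_rb k lam V)" for V :: "'x step list set"
    by (rule module_freeI) simp_all
  have hom:
    "path_map \<in> rb_hom k (word_rb k lam (rb_words_over True X)) (path_rb k lam (valley_free X))"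
    using path_map_hom[OF bij] by (simp add: rb_hom_def path_map_one)
  have "rota_baxter_algebra k lam (path_rb k lam (valley_free X))"
    using bij_betw_imp_surj_on[OF bij_path_map[OF bij]]
    by (intro rb_image[OF rb_words_over_unitary module_path hom]) simp
  moreover have "nonunitary_rota_baxter_algebra k lam (path_rb k lam (peak_free X \<inter> valley_free X))"
    using bij_betw_imp_surj_on[OF bij_path_map[OF bij']]
    by (intro nonunitary_rb_image[OF nonunitary_rb_words_over module_path
          path_map_hom[OF bij']]) simp
  moreover have "path_map \<in> rb_iso k (word_rb k lam (rb_words_over True X))
      (path_rb k lam (valley_free X))"
    using hom bij_path_map[OF bij] by (simp add: rb_iso_def)
  moreover have "path_map \<in> nonunitary_rb_iso k (word_rb k lam (rb_words_over False X))
      (path_rb k lam (peak_free X \<inter> valley_free X))"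
    using path_map_hom[OF bij'] bij_path_map[OF bij'] by (simp add: nonunitary_rb_iso_def)
  moreover have "lin_ext k (\<lambda>W. basis k (word_to_path W)) (basis k W) = basis k (word_to_path W)"
    for W :: "'x bword"
    by (rule lin_ext_basis[of _ _ UNIV]) simp
  ultimately show ?thesis
    unfolding rb_words_eq bracketed_words_S_rb_words[unfolded rb_words_eq] path_map_def
    using bij bij' rb_words_over_unitary nonunitary_rb_words_over free_words free_nonunitary_words
    by blast
qed

end
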